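(* Let $\mathbb{T}$ be the tropical semifield, let $n\ge 0$, and let $f\in\mathbb{T}[x_0,\dots,x_n]$ be a nonzero homogeneous polynomial. For each $d\ge\deg(f)$ let $[f]_d$ be the tropical linear space given by the stable sum of the rows of the Macaulay matrix $\mathcal{D}_d(f)$, let $[f]_d=0$ for $d<\deg(f)$, and let $[f]=\bigoplus_{d\ge 0}[f]_d$. Then $[f]$ is a tropical ideal which is tropically principal over $f$. It satisfies the following conditions: (1) The tropical variety $V^{\mathrm{trop}}([f])\subset\mathbb{P}^n(\mathbb{T})$ is equal to the tropical hypersurface $V^{\mathrm{trop}}(f)$. (2) The Hilbert function of $[f]$ is that of a hypersurface of degree $\deg(f)$ in $\mathbb{P}^n$, i.e. $HF_{[f]}(d)=N^n_d-N^n_{d-\deg(f)}$ for all $d\ge 0$. (3) If $f$ has at least three terms and each term of $f$ contains a variable not appearing in any other term of $f$, then $[f]$ is not realizable over any field. (4) When $n=2$ and $f=x_0+x_1+x_2$ (viewed as a polynomial over the Boolean semifield $\mathbb{B}=\{0,1\}$), the Macaulay tropical ideal $[f]\subset\mathbb{B}[x_0,x_1,x_2]$ is equal to the Maclagan--Rincón ideal $I_{\mathrm{MR}}\subset\mathbb{B}[x_0,x_1,x_2]$.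
   Context: Semifields. A totally ordered idempotent semifield $\mathbb{S}$ is a set with $0$ such that $\mathbb{S}\setminus\{0\}$ is a totally ordered abelian group (written multiplicatively), $0$ is the least element, and addition is maximum. The tropical semifield is $\mathbb{T}=(\mathbb{R}_{\ge 0},\max,\times)$ (isomorphic to $(\mathbb{R}\cup\{\infty\},\min,+)$); the Boolean semifield is $\mathbb{B}=\{0,1\}$. A finite sum in $\mathbb{S}$ tropically vanishes if its value is unchanged by dropping any single term. Tropical linear spaces. For a finite set $E$, a valuated matroid of rank $r$ is a nonzero $p\in\mathbb{S}^{\binom{E}{r}}$ such that for all $A\in\binom{E}{r+1}$, $B\in\binom{E}{r-1}$ the sum $\sum_{i\in A\setminus B}p_{A\setminus\{i\}}p_{B\cup\{i\}}$ tropically vanishes. Its cocircuits are $\beta_C=\sum_{i\notin C}p_{C\cup\{i\}}e_i\in\mathbb{S}^E$ for $C\in\binom{E}{r-1}$, and the tropical linear space $L_p\subset\mathbb{S}^E$ of rank $r$ is the $\mathbb{S}$-submodule spanned by the cocircuits. Given a matrix $A$ over $\mathbb{S}$ with $k$ rows, with columns indexed by $E$, and with some nonzero maximal minor, the stable sum of its rows is $L_p$ with $p_B=\max_{\sigma}\prod_{i=1}^k A_{i,\sigma(i)}$ for $B\in\binom{E}{k}$, the maximum being over bijections $\sigma:\{1,\dots,k\}\to B$ (tropical maximal minors). Tropical ideals. Let $\Delta^n_d$ be the set of degree $d$ monomials in $x_0,\dots,x_n$, $N^n_d=|\Delta^n_d|=\binom{n+d}{d}$ for $d\ge 0$ and $N^n_d=0$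 for $d<0$. The degree $d$ part of $\mathbb{S}[x_0,\dots,x_n]$ is identified with $\mathbb{S}^{\Delta^n_d}$. A homogeneous ideal $J$ is a tropical ideal if each $J_d$ is a tropical linear space; its Hilbert function is $HF_J(d)=N^n_d-\operatorname{rank}(J_d)$. A tropical ideal is tropically principal over $f$ if it is minimal, under inclusion, among tropical ideals containing $f$. Macaulay matrix. For $d\ge\deg(f)$, $\mathcal{D}_d(f)$ is the matrix with rows indexed by $\Delta^n_{d-\deg(f)}$ and columns indexed by $\Delta^n_d$ whose $(X,Y)$ entry is the coefficient of $Y$ in $Xf$. The graded submodule $[f]$ is defined by the same recipe over any $\mathbb{S}$ and is called the Macaulay tropical ideal of $f$. Tropical varieties. For homogeneous $h\in\mathbb{T}[x_0,\dots,x_n]$, $V^{\mathrm{trop}}(h)\subset\mathbb{P}^n(\mathbb{T})=(\mathbb{T}^{n+1}\setminus\{0\})/\mathbb{T}^\times$ is the set of points $y$ at which the sum of the terms of $h$ evaluated at $y$ tropically vanishes (maximum attained at least twice, or all terms zero). For a homogeneous ideal $J$, $V^{\mathrm{trop}}(J)=\bigcap_{h\in J,\ h\text{ homogeneous}}V^{\mathrm{trop}}(h)$. Realizability. A non-archimedean norm on a field $\Bbbk$ is a map $\nu:\Bbbk\to\mathbb{T}$ with $\nu^{-1}(0)=\{0\}$, $\nu(1)=\nu(-1)=1$, $\nu(ab)=\nu(a)\nu(b)$, $\nu(a+b)\le\max(\nu(a),\nu(b))$. For a polynomial $F$ over $\Bbbk$, $\mathrm{trop}(F)$ is obtained by applying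 $\nu$ to the coefficients; for a homogeneous ideal $I\subset\Bbbk[x_0,\dots,x_n]$, $\mathrm{trop}(I)$ is the graded $\mathbb{T}$-submodule with $\mathrm{trop}(I)_d$ spanned by $\{\mathrm{trop}(F):F\in I_d\}$ (it is a tropical ideal). A tropical ideal $J$ is realizable over $\Bbbk$ if $J=\mathrm{trop}(I)$ for some non-archimedean norm $\nu$ on $\Bbbk$ and some homogeneous ideal $I\subset\Bbbk[x_0,\dots,x_n]$. The ideal $I_{\mathrm{MR}}$ for $n=2$. For $k\le d$ let $\Delta^2_{k\to d}$ be the set of subsets of $\Delta^2_d$ of the form $m\Delta^2_k=\{mm':m'\in\Delta^2_k\}$ with $m\in\Delta^2_{d-k}$. For each $d\ge 0$ let $M_d$ be the matroid on $\Delta^2_d$ whose cobases (complements of bases) are the $(d+1)$-element subsets $X\subset\Delta^2_d$ such that $|X\cap K|\le k+1$ for every $k\in\{0,\dots,d\}$ and every $K\in\Delta^2_{k\to d}$. Then $I_{\mathrm{MR}}\subset\mathbb{B}[x_0,x_1,x_2]$ is the ideal whose degree $d$ part is the $\mathbb{B}$-span of the (indicator vectors of the) cocircuits of $M_d$. *)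

theory Defs
  imports Complex_Main "HOL-Library.FuncSet" "HOL-Library.Poly_Mapping"
begin

section \<open>Semifields\<close>

text \<open>
  Compatibility of the order with multiplication need not be assumed: since addition is the
  maximum, it follows from distributivity.
\<close>

class totally_ordered_idempotent_semifield = comm_semiring_1 + linorder +
  assumes add_eq_max: "a + b = max a b"
    and zero_least: "0 \<le> a"
    and ex_mult_inverse: "a \<noteq> 0 \<Longrightarrow> \<exists>b. a * b = 1"
begin

lemma mult_left_mono_semifield:
  assumes "a \<le> b"
  shows "c * a \<le> c * b"
proof -
  have "max (c * a) (c * b) = c * max a b"
    by (simp add: distrib_left flip: add_eq_max)
  then show ?thesis
    using assms by (simp add: max_def split: if_splits)
qed

lemma mult_nonzero_semifield:
  assumes "a \<noteq> 0" "b \<noteq> 0"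
  shows "a * b \<noteq> 0"
proof
  assume ab: "a * b = 0"
  from ex_mult_inverse [OF assms(1)] obtain c where "a * c = 1" by blast
  then have "b = c * (a * b)" by (metis mult.assoc mult.commute mult_1)
  with ab assms(2) show False by simp
qed

end

typedef trop = "{x :: real. 0 \<le> x}" morphisms real_of_trop Abs_trop
  by auto

setup_lifting type_definition_trop

instantiation trop :: comm_semiring_1
begin

lift_definition zero_trop :: trop is 0 by simp
lift_definition one_trop :: trop is 1 by simp
lift_definition plus_trop :: "trop \<Rightarrow> trop \<Rightarrow> trop" is max by simp
lift_definition times_trop :: "trop \<Rightarrow> trop \<Rightarrow> trop" is "(*)" by simp

instance
proof
  fix a b c :: trop
  show "a * b * c = a * (b * c)" by transfer simp
  show "a * b = b * a" by transfer simp
  show "1 * a = a" by transfer simp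
  show "a + b + c = a + (b + c)" by transfer (simp add: max.assoc)
  show "a + b = b + a" by transfer (simp add: max.commute)
  show "0 + a = a" by transfer simp
  show "0 * a = 0" by transfer simp
  show "a * 0 = 0" by transfer simp
  show "(a + b) * c = a * c + b * c"
    by transfer (simp add: max_mult_distrib_right)
  show "(0::trop) \<noteq> 1" by transfer simp
qed

end

instantiation trop :: linorder
begin

lift_definition less_eq_trop :: "trop \<Rightarrow> trop \<Rightarrow> bool" is "(\<le>)" .
lift_definition less_trop :: "trop \<Rightarrow> trop \<Rightarrow> bool" is "(<)" .

instance
proof
  fix a b c :: trop
  show "a < b \<longleftrightarrow> a \<le> b \<and> \<not> b \<le> a" by transfer auto
  show "a \<le> a" by transfer simp
  show "a \<le> b \<Longrightarrow> b \<le> c \<Longrightarrow> a \<le> c" by transfer simp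
  show "a \<le> b \<Longrightarrow> b \<le> a \<Longrightarrow> a = b" by transfer simp
  show "a \<le> b \<or> b \<le> a" by transfer auto
qed

end

instance trop :: totally_ordered_idempotent_semifield
proof
  fix a b :: trop
  show "a + b = max a b" unfolding max_def by transfer (simp add: max_def)
  show "0 \<le> a" by transfer simp
  show "\<exists>b. a * b = 1" if "a \<noteq> 0"
    using that
  proof transfer
    fix x :: real assume "0 \<le> x" "x \<noteq> 0"
    then show "\<exists>y\<in>Collect ((\<le>) 0). x * y = 1"
      by (intro bexI [of _ "1 / x"]) auto
  qed
qed

datatype boolean = B0 | B1

instantiation boolean :: "{comm_semiring_1, linorder}"
begin

definition zero_boolean :: boolean where "0 = B0"
definition one_boolean :: boolean where "1 = B1"
definition plus_boolean :: "boolean \<Rightarrow> boolean \<Rightarrow> boolean"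
  where "a + b = (if a = B1 \<or> b = B1 then B1 else B0)"
definition times_boolean :: "boolean \<Rightarrow> boolean \<Rightarrow> boolean"
  where "a * b = (if a = B1 \<and> b = B1 then B1 else B0)"
definition less_eq_boolean :: "boolean \<Rightarrow> boolean \<Rightarrow> bool"
  where "a \<le> b \<longleftrightarrow> a = B0 \<or> b = B1"
definition less_boolean :: "boolean \<Rightarrow> boolean \<Rightarrow> bool"
  where "a < b \<longleftrightarrow> a = B0 \<and> b = B1"

instance
proof
  note defs = zero_boolean_def one_boolean_def plus_boolean_def times_boolean_def
    less_eq_boolean_def less_boolean_def
  fix a b c :: boolean
  show "a * b * c = a * (b * c)" by (simp add: defs)
  show "a * b = b * a" by (auto simp: defs)
  show "1 * a = a" by (cases a) (simp_all add: defs)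
  show "a + b + c = a + (b + c)" by (simp add: defs)
  show "a + b = b + a" by (auto simp: defs)
  show "0 + a = a" by (cases a) (simp_all add: defs)
  show "0 * a = 0" by (simp add: defs)
  show "a * 0 = 0" by (simp add: defs)
  show "(a + b) * c = a * c + b * c" by (auto simp: defs)
  show "(0::boolean) \<noteq> 1" by (simp add: defs)
  show "a < b \<longleftrightarrow> a \<le> b \<and> \<not> b \<le> a" by (cases a; cases b) (simp_all add: defs)
  show "a \<le> a" by (cases a) (simp_all add: defs)
  show "a \<le> b \<Longrightarrow> b \<le> c \<Longrightarrow> a \<le> c" by (auto simp: defs)
  show "a \<le> b \<Longrightarrow> b \<le> a \<Longrightarrow> a = b" by (auto simp: defs)
  show "a \<le> b \<or> b \<le> a" by (cases a) (simp_all add: defs)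
qed

end

instance boolean :: totally_ordered_idempotent_semifield
proof
  note defs = zero_boolean_def one_boolean_def plus_boolean_def times_boolean_def
    less_eq_boolean_def less_boolean_def
  fix a b :: boolean
  show "a + b = max a b" by (cases a; cases b) (simp_all add: defs max_def)
  show "0 \<le> a" by (simp add: defs)
  show "a \<noteq> 0 \<Longrightarrow> \<exists>b. a * b = 1" by (cases a) (auto simp: defs)
qed

definition trop_vanishes :: "'i set \<Rightarrow> ('i \<Rightarrow> 's::totally_ordered_idempotent_semifield) \<Rightarrow> bool"
  where "trop_vanishes I a \<longleftrightarrow> (\<forall>j\<in>I. (\<Sum>i\<in>I - {j}. a i) = (\<Sum>i\<in>I. a i))"


section \<open>Tropical linear spaces\<close>

text \<open>
  For a finite set \<open>E\<close>, the module of \<open>E\<close>-indexed vectors consists of the finitely supported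
  functions \<open>v\<close> with \<open>Poly_Mapping.keys v \<subseteq> E\<close>. With monomials as indices, vectors are
  literally polynomials.
\<close>

definition is_submodule :: "('e \<Rightarrow>\<^sub>0 's::comm_semiring_1) set \<Rightarrow> bool"
  where "is_submodule V \<longleftrightarrow>
    0 \<in> V \<and> (\<forall>u\<in>V. \<forall>v\<in>V. u + v \<in> V) \<and> (\<forall>c. \<forall>v\<in>V. Poly_Mapping.map ((*) c) v \<in> V)"

definition submodule_span :: "('e \<Rightarrow>\<^sub>0 's::comm_semiring_1) set \<Rightarrow> ('e \<Rightarrow>\<^sub>0 's) set"
  where "submodule_span G = is_submodule hull G"

text \<open>
  Only the values of \<open>p\<close> on \<open>r\<close>-element subsets of \<open>E\<close> matter, here and in \<open>lin_space\<close>.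
  Writing the size of \<open>B\<close> and \<open>C\<close> below as \<open>card _ + 1 = r\<close> avoids truncated
  subtraction: for \<open>r = 0\<close> there are no such sets.
\<close>

definition valuated_matroid ::
    "'e set \<Rightarrow> nat \<Rightarrow> ('e set \<Rightarrow> 's::totally_ordered_idempotent_semifield) \<Rightarrow> bool"
  where "valuated_matroid E r p \<longleftrightarrow>
    finite E \<and>
    (\<exists>B\<subseteq>E. card B = r \<and> p B \<noteq> 0) \<and>
    (\<forall>A B. A \<subseteq> E \<and> card A = r + 1 \<and> B \<subseteq> E \<and> card B + 1 = r \<longrightarrow>
      trop_vanishes (A - B) (\<lambda>i. p (A - {i}) * p (insert i B)))"

definition cocircuit_vector ::
    "'e set \<Rightarrow> ('e set \<Rightarrow> 's::totally_ordered_idempotent_semifield) \<Rightarrow> 'e set \<Rightarrow> 'e \<Rightarrow>\<^sub>0 's"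
  where "cocircuit_vector E p C = (\<Sum>i\<in>E - C. Poly_Mapping.single i (p (insert i C)))"

definition lin_space ::
    "'e set \<Rightarrow> nat \<Rightarrow> ('e set \<Rightarrow> 's::totally_ordered_idempotent_semifield) \<Rightarrow> ('e \<Rightarrow>\<^sub>0 's) set"
  where "lin_space E r p = submodule_span {cocircuit_vector E p C |C. C \<subseteq> E \<and> card C + 1 = r}"

definition trop_linear_space_of_rank ::
    "'e set \<Rightarrow> nat \<Rightarrow> ('e \<Rightarrow>\<^sub>0 's::totally_ordered_idempotent_semifield) set \<Rightarrow> bool"
  where "trop_linear_space_of_rank E r L \<longleftrightarrow> (\<exists>p. valuated_matroid E r p \<and> L = lin_space E r p)"

definition trop_linear_space ::
    "'e set \<Rightarrow> ('e \<Rightarrow>\<^sub>0 's::totally_ordered_idempotent_semifield) set \<Rightarrow> bool"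
  where "trop_linear_space E L \<longleftrightarrow> (\<exists>r. trop_linear_space_of_rank E r L)"

text \<open>The rank is determined by the tropical linear space.\<close>

definition trop_rank ::
    "'e set \<Rightarrow> ('e \<Rightarrow>\<^sub>0 's::totally_ordered_idempotent_semifield) set \<Rightarrow> nat"
  where "trop_rank E L = (THE r. trop_linear_space_of_rank E r L)"

text \<open>
  The sum below is a maximum. Restricting to extensional functions makes the set of bijections
  from \<open>R\<close> to \<open>B\<close> finite.
\<close>

definition trop_minor ::
    "'r set \<Rightarrow> ('r \<Rightarrow> 'e \<Rightarrow> 's::totally_ordered_idempotent_semifield) \<Rightarrow> 'e set \<Rightarrow> 's"
  where "trop_minor R A B = (\<Sum>\<sigma> | \<sigma> \<in> R \<rightarrow>\<^sub>E B \<and> bij_betw \<sigma> R B. \<Prod>i\<in>R. A i (\<sigma> i))"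

definition stable_sum ::
    "'r set \<Rightarrow> 'e set \<Rightarrow> ('r \<Rightarrow> 'e \<Rightarrow> 's::totally_ordered_idempotent_semifield) \<Rightarrow> ('e \<Rightarrow>\<^sub>0 's) set"
  where "stable_sum R E A = lin_space E (card R) (trop_minor R A)"


section \<open>Polynomials and homogeneous ideals\<close>

text \<open>
  A monomial is an exponent vector \<open>nat \<Rightarrow>\<^sub>0 nat\<close>; monomials multiply by adding exponents.
\<close>

type_synonym monom = "nat \<Rightarrow>\<^sub>0 nat"
type_synonym 'a mpoly = "monom \<Rightarrow>\<^sub>0 'a"

definition mdeg :: "monom \<Rightarrow> nat"
  where "mdeg m = (\<Sum>i\<in>Poly_Mapping.keys m. Poly_Mapping.lookup m i)"

definition monoms :: "nat \<Rightarrow> nat \<Rightarrow> monom set"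
  where "monoms n d = {m. Poly_Mapping.keys m \<subseteq> {0..n} \<and> mdeg m = d}"

definition num_monoms :: "nat \<Rightarrow> int \<Rightarrow> int"
  where "num_monoms n d = (if d < 0 then 0 else int ((n + nat d) choose nat d))"

definition Var :: "nat \<Rightarrow> 'a::comm_semiring_1 mpoly"
  where "Var i = Poly_Mapping.single (Poly_Mapping.single i 1) 1"

definition polys :: "nat \<Rightarrow> 'a::comm_semiring_1 mpoly set"
  where "polys n = {f. \<forall>m\<in>Poly_Mapping.keys f. Poly_Mapping.keys m \<subseteq> {0..n}}"

definition hom_polys :: "nat \<Rightarrow> nat \<Rightarrow> 'a::comm_semiring_1 mpoly set"
  where "hom_polys n d = {f. Poly_Mapping.keys f \<subseteq> monoms n d}"

definition hom_component :: "nat \<Rightarrow> 'a::comm_semiring_1 mpoly \<Rightarrow> 'a mpoly"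
  where "hom_component d f = Poly_Mapping.mapp (\<lambda>m c. if mdeg m = d then c else 0) f"

definition homogeneous :: "'a::comm_semiring_1 mpoly \<Rightarrow> bool"
  where "homogeneous f \<longleftrightarrow> (\<exists>d. \<forall>m\<in>Poly_Mapping.keys f. mdeg m = d)"

definition pdeg :: "'a::comm_semiring_1 mpoly \<Rightarrow> nat"
  where "pdeg f = Max (mdeg ` Poly_Mapping.keys f)"

definition homogeneous_ideal :: "nat \<Rightarrow> 'a::comm_semiring_1 mpoly set \<Rightarrow> bool"
  where "homogeneous_ideal n J \<longleftrightarrow>
    J \<subseteq> polys n \<and> 0 \<in> J \<and> (\<forall>g\<in>J. \<forall>h\<in>J. g + h \<in> J) \<and> (\<forall>g\<in>polys n. \<forall>h\<in>J. g * h \<in> J) \<and>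
    (\<forall>g\<in>J. \<forall>d. hom_component d g \<in> J)"

definition graded_part :: "nat \<Rightarrow> nat \<Rightarrow> 'a::comm_semiring_1 mpoly set \<Rightarrow> 'a mpoly set"
  where "graded_part n d J = J \<inter> hom_polys n d"

definition graded_sum :: "nat \<Rightarrow> (nat \<Rightarrow> 'a::comm_semiring_1 mpoly set) \<Rightarrow> 'a mpoly set"
  where "graded_sum n V = {g \<in> polys n. \<forall>d. hom_component d g \<in> V d}"


section \<open>Tropical ideals\<close>

definition tropical_ideal ::
    "nat \<Rightarrow> 's::totally_ordered_idempotent_semifield mpoly set \<Rightarrow> bool"
  where "tropical_ideal n J \<longleftrightarrow>
    homogeneous_ideal n J \<and> (\<forall>d. trop_linear_space (monoms n d) (graded_part n d J))"

definition hilbert_fun ::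
    "nat \<Rightarrow> 's::totally_ordered_idempotent_semifield mpoly set \<Rightarrow> nat \<Rightarrow> int"
  where "hilbert_fun n J d =
    num_monoms n (int d) - int (trop_rank (monoms n d) (graded_part n d J))"

definition tropically_principal_over ::
    "nat \<Rightarrow> 's::totally_ordered_idempotent_semifield mpoly set \<Rightarrow> 's mpoly \<Rightarrow> bool"
  where "tropically_principal_over n J f \<longleftrightarrow>
    tropical_ideal n J \<and> f \<in> J \<and>
    (\<forall>J'. tropical_ideal n J' \<and> f \<in> J' \<and> J' \<subseteq> J \<longrightarrow> J' = J)"

definition macaulay_matrix ::
    "'s::totally_ordered_idempotent_semifield mpoly \<Rightarrow> monom \<Rightarrow> monom \<Rightarrow> 's"
  where "macaulay_matrix f X Y = Poly_Mapping.lookup (Poly_Mapping.single X 1 * f) Y"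

definition macaulay_part ::
    "nat \<Rightarrow> 's::totally_ordered_idempotent_semifield mpoly \<Rightarrow> nat \<Rightarrow> 's mpoly set"
  where "macaulay_part n f d =
    (if d < pdeg f then {0}
     else stable_sum (monoms n (d - pdeg f)) (monoms n d) (macaulay_matrix f))"

definition macaulay_ideal ::
    "nat \<Rightarrow> 's::totally_ordered_idempotent_semifield mpoly \<Rightarrow> 's mpoly set"
  where "macaulay_ideal n f = graded_sum n (macaulay_part n f)"


section \<open>Tropical varieties\<close>

definition nonzero_vectors :: "nat \<Rightarrow> (nat \<Rightarrow> 's::totally_ordered_idempotent_semifield) set"
  where "nonzero_vectors n = {y. (\<exists>i\<le>n. y i \<noteq> 0) \<and> (\<forall>i>n. y i = 0)}"

definition proportional ::
    "nat \<Rightarrow> ((nat \<Rightarrow> 's::totally_ordered_idempotent_semifield) \<times> (nat \<Rightarrow> 's)) set"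
  where "proportional n =
    {(y, z). y \<in> nonzero_vectors n \<and> z \<in> nonzero_vectors n \<and> (\<exists>c. c \<noteq> 0 \<and> z = (\<lambda>i. c * y i))}"

definition proj_space :: "nat \<Rightarrow> (nat \<Rightarrow> 's::totally_ordered_idempotent_semifield) set set"
  where "proj_space n = nonzero_vectors n // proportional n"

definition vanishes_at ::
    "'s::totally_ordered_idempotent_semifield mpoly \<Rightarrow> (nat \<Rightarrow> 's) \<Rightarrow> bool"
  where "vanishes_at h y \<longleftrightarrow>
    trop_vanishes (Poly_Mapping.keys h)
      (\<lambda>m. Poly_Mapping.lookup h m * (\<Prod>i\<in>Poly_Mapping.keys m. y i ^ Poly_Mapping.lookup m i))"

text \<open>
  For homogeneous \<open>h\<close>, vanishing does not depend on the representative of a projective point.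
\<close>

definition trop_hypersurface ::
    "nat \<Rightarrow> 's::totally_ordered_idempotent_semifield mpoly \<Rightarrow> (nat \<Rightarrow> 's) set set"
  where "trop_hypersurface n h = {P \<in> proj_space n. \<forall>y\<in>P. vanishes_at h y}"

definition trop_variety ::
    "nat \<Rightarrow> 's::totally_ordered_idempotent_semifield mpoly set \<Rightarrow> (nat \<Rightarrow> 's) set set"
  where "trop_variety n J = {P \<in> proj_space n. \<forall>h\<in>J. homogeneous h \<longrightarrow> P \<in> trop_hypersurface n h}"


section \<open>Realizability\<close>

definition nonarch_norm :: "('k::field \<Rightarrow> trop) \<Rightarrow> bool"
  where "nonarch_norm \<nu> \<longleftrightarrow>
    (\<forall>a. \<nu> a = 0 \<longleftrightarrow> a = 0) \<and> \<nu> 1 = 1 \<and> \<nu> (- 1) = 1 \<and>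
    (\<forall>a b. \<nu> (a * b) = \<nu> a * \<nu> b) \<and> (\<forall>a b. \<nu> (a + b) \<le> max (\<nu> a) (\<nu> b))"

definition trop_poly :: "('k::field \<Rightarrow> trop) \<Rightarrow> 'k mpoly \<Rightarrow> trop mpoly"
  where "trop_poly \<nu> F = Poly_Mapping.map \<nu> F"

definition trop_of_ideal :: "nat \<Rightarrow> ('k::field \<Rightarrow> trop) \<Rightarrow> 'k mpoly set \<Rightarrow> trop mpoly set"
  where "trop_of_ideal n \<nu> I =
    graded_sum n (\<lambda>d. submodule_span (trop_poly \<nu> ` graded_part n d I))"

definition realizable_over :: "'k::field itself \<Rightarrow> nat \<Rightarrow> trop mpoly set \<Rightarrow> bool"
  where "realizable_over K n J \<longleftrightarrow>
    (\<exists>(\<nu> :: 'k \<Rightarrow> trop) I. nonarch_norm \<nu> \<and> homogeneous_ideal n I \<and> J = trop_of_ideal n \<nu> I)"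


section \<open>The Maclagan--Rincon ideal in three variables\<close>

text \<open>
  A matroid is given by its ground set and its set of bases. Its circuits are the minimal
  dependent sets, and its cocircuits are the circuits of the dual matroid, whose bases are the
  complements of the bases.
\<close>

definition dependent_sets :: "'e set \<Rightarrow> 'e set set \<Rightarrow> 'e set set"
  where "dependent_sets E \<B> = {D. D \<subseteq> E \<and> \<not> (\<exists>B\<in>\<B>. D \<subseteq> B)}"

definition circuits :: "'e set \<Rightarrow> 'e set set \<Rightarrow> 'e set set"
  where "circuits E \<B> =
    {C \<in> dependent_sets E \<B>. \<forall>D. D \<subset> C \<longrightarrow> D \<notin> dependent_sets E \<B>}"

definition cocircuits :: "'e set \<Rightarrow> 'e set set \<Rightarrow> 'e set set"
  where "cocircuits E \<B> = circuits E ((\<lambda>B. E - B) ` \<B>)"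

definition monom_translates :: "nat \<Rightarrow> nat \<Rightarrow> monom set set"
  where "monom_translates k d = {(\<lambda>m'. m + m') ` monoms 2 k |m. m \<in> monoms 2 (d - k)}"

definition MR_cobases :: "nat \<Rightarrow> monom set set"
  where "MR_cobases d =
    {X. X \<subseteq> monoms 2 d \<and> card X = d + 1 \<and>
        (\<forall>k\<in>{0..d}. \<forall>K\<in>monom_translates k d. card (X \<inter> K) \<le> k + 1)}"

definition MR_bases :: "nat \<Rightarrow> monom set set"
  where "MR_bases d = (\<lambda>X. monoms 2 d - X) ` MR_cobases d"

definition indicator_vector :: "'e set \<Rightarrow> 'e \<Rightarrow>\<^sub>0 boolean"
  where "indicator_vector C = (\<Sum>i\<in>C. Poly_Mapping.single i 1)"

definition MR_ideal :: "boolean mpoly set"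
  where "MR_ideal =
    graded_sum 2 (\<lambda>d. submodule_span (indicator_vector ` cocircuits (monoms 2 d) (MR_bases d)))"

end

theory Submission
  imports Defs
begin

text \<open>
  The tropical maximal minors of a matrix are the weights of optimal matchings of its rows with
  sets of columns, and everything about the Macaulay ideal comes down to modifying matchings.
  The basic tool is \<open>matching_rotation\<close>: switching a matching along an alternating path. It shows
  that the minors form a valuated matroid (\<open>trop_minor_valuated_matroid\<close>).

  The ideal property holds because the Macaulay matrix of one degree is a block of that of the
  next degree, for each variable, with a complementary block having a nonzero minor
  (\<open>macaulay_part_Var\<close>). The rank of a tropical linear space is determined by the supports of its
  vectors; it yields the Hilbert function and, as inclusion of tropical linear spaces of equal
  rank is equality (\<open>lin_space_subset_eq\<close>), also minimality: the multiples \<open>X f\<close> have distinct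
  leading monomials, the leading positions of all vectors of a tropical linear space lie in a
  single basis (\<open>lin_space_leading_positions\<close>), so any tropical ideal containing \<open>f\<close> has at least
  the rank of the Macaulay ideal in each degree (\<open>macaulay_ideal_minimal\<close>).

  For the variety, let \<open>y\<close> be a point of the hypersurface. The largest term of a cocircuit
  evaluated at \<open>y\<close> is turned into another term that is at least as large by rotating its matching
  with steps by a term of \<open>f\<close> that is extreme, in the monomial order, among those of maximal value
  at \<open>y\<close> (\<open>macaulay_part_vanishes\<close>). For stable sums of arbitrary rows vanishing at \<open>y\<close> this would
  fail: the stable sum of two equal rows \<open>(1, 1)\<close> is the whole plane.

  A realization would contain a polynomial \<open>F\<close> with the support of \<open>f\<close>, hence also the multiples of
  \<open>F\<close>. Splitting \<open>F = a + b + c\<close> with \<open>a\<close> and \<open>b\<close> single terms, \<open>F\<close> divides \<open>a\<^sup>3 + b\<^sup>3 + c\<^sup>3 - 3abc\<close>. If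
  every term has a variable of its own, all rows can be matched to columns outside the support
  of this multiple; but a nonzero vector of a tropical linear space meets every basis
  (\<open>macaulay_ideal_not_realizable\<close>).

  For \<open>x\<^sub>0 + x\<^sub>1 + x\<^sub>2\<close> over the Boolean semifield the bases are the sets of columns matched by Hall's
  theorem. It remains to see that Hall's condition need only be checked for triangles
  \<open>m \<Delta>\<^sub>k\<close> (\<open>hall_condition_closed\<close>, \<open>hall_condition\<close>), where it is the condition on the cobases in
  the definition of the Maclagan--Rincon ideal.
\<close>

abbreviation (input) lookup :: "('a \<Rightarrow>\<^sub>0 'b::zero) \<Rightarrow> 'a \<Rightarrow> 'b"
  where "lookup \<equiv> Poly_Mapping.lookup"

abbreviation (input) keys :: "('a \<Rightarrow>\<^sub>0 'b::zero) \<Rightarrow> 'a set"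
  where "keys \<equiv> Poly_Mapping.keys"

abbreviation (input) single :: "'a \<Rightarrow> 'b \<Rightarrow> 'a \<Rightarrow>\<^sub>0 'b::zero"
  where "single \<equiv> Poly_Mapping.single"

section \<open>Totally ordered idempotent semifields\<close>

context totally_ordered_idempotent_semifield
begin

subclass canonically_ordered_monoid_add
proof
  show "a \<le> b \<longleftrightarrow> (\<exists>c. b = a + c)" for a b
    by (auto simp: add_eq_max max_def intro: exI [of _ b])
qed

subclass semiring_no_zero_divisors
  by standard (rule mult_nonzero_semifield)

subclass ordered_comm_semiring
  by standard (rule mult_left_mono_semifield)

end

lemma mult_le_cancel_semifield:
  fixes a b c :: "'s::totally_ordered_idempotent_semifield"
  assumes "c \<noteq> 0"
  shows "c * a \<le> c * b \<longleftrightarrow> a \<le> b"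
proof
  assume le: "c * a \<le> c * b"
  obtain d where "c * d = 1"
    using ex_mult_inverse [OF assms] by blast
  then have "d * (c * x) = x" for x
    by (simp add: mult.commute flip: mult.assoc)
  then show "a \<le> b"
    using mult_left_mono_semifield [OF le, of d] by simp
qed (rule mult_left_mono_semifield)

lemma mult_cancel_semifield:
  fixes a b c :: "'s::totally_ordered_idempotent_semifield"
  assumes "c \<noteq> 0"
  shows "c * a = c * b \<longleftrightarrow> a = b"
  by (metis assms mult_le_cancel_semifield order_antisym order_refl)

lemma mult_mono_semifield:
  fixes a b c d :: "'s::totally_ordered_idempotent_semifield"
  shows "a \<le> b \<Longrightarrow> c \<le> d \<Longrightarrow> a * c \<le> b * d"
  by (rule mult_mono) simp_all

lemma prod_mono_semifield:
  fixes a b :: "'i \<Rightarrow> 's::totally_ordered_idempotent_semifield"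
  assumes "\<And>i. i \<in> I \<Longrightarrow> a i \<le> b i"
  shows "(\<Prod>i\<in>I. a i) \<le> (\<Prod>i\<in>I. b i)"
  using assms by (induction I rule: infinite_finite_induct) (auto intro: mult_mono_semifield)

lemma prod_eq_imp_eq_semifield:
  fixes a b :: "'i \<Rightarrow> 's::totally_ordered_idempotent_semifield"
  assumes fin: "finite I" and le: "\<And>i. i \<in> I \<Longrightarrow> a i \<le> b i"
    and prod: "(\<Prod>i\<in>I. b i) \<le> (\<Prod>i\<in>I. a i)" and nz: "(\<Prod>i\<in>I. a i) \<noteq> 0" and i: "i \<in> I"
  shows "a i = b i"
proof -
  let ?a = "\<Prod>k\<in>I - {i}. a k" and ?b = "\<Prod>k\<in>I - {i}. b k"
  have split: "(\<Prod>k\<in>I. c k) = c i * (\<Prod>k\<in>I - {i}. c k)" for c :: "'i \<Rightarrow> 's"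
    by (rule prod.remove [OF fin i])
  have ab: "?a \<le> ?b"
    using le by (intro prod_mono_semifield) auto
  have "?a \<noteq> 0"
    using nz split [of a] by auto
  then have b0: "?b \<noteq> 0"
    using ab by (metis le_zero_eq)
  have "b i * ?b \<le> a i * ?a"
    using prod split by metis
  also have "\<dots> \<le> a i * ?b"
    using ab by (rule mult_left_mono_semifield)
  finally have "b i \<le> a i"
    using b0 by (simp add: mult_le_cancel_semifield mult.commute [of _ ?b])
  then show ?thesis
    using le [OF i] by simp
qed

lemma member_le_sum_semifield:
  fixes a :: "'i \<Rightarrow> 's::totally_ordered_idempotent_semifield"
  assumes "finite I" "i \<in> I"
  shows "a i \<le> (\<Sum>i\<in>I. a i)"
  by (subst sum.remove [OF assms]) (simp add: add_eq_max)

lemma sum_le_semifield: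
  fixes a :: "'i \<Rightarrow> 's::totally_ordered_idempotent_semifield"
  assumes "\<And>i. i \<in> I \<Longrightarrow> a i \<le> c"
  shows "(\<Sum>i\<in>I. a i) \<le> c"
  using assms by (induction I rule: infinite_finite_induct) (auto simp: add_eq_max)

lemma sum_attained_semifield:
  fixes a :: "'i \<Rightarrow> 's::totally_ordered_idempotent_semifield"
  assumes "(\<Sum>i\<in>I. a i) \<noteq> 0"
  obtains i where "i \<in> I" "(\<Sum>i\<in>I. a i) = a i"
proof -
  have "\<exists>i\<in>I. (\<Sum>i\<in>I. a i) = a i"
    using assms
  proof (induction I rule: infinite_finite_induct)
    case (insert x I)
    show ?case
    proof (cases "(\<Sum>i\<in>I. a i) \<le> a x")
      case False
      then have "(\<Sum>i\<in>I. a i) \<noteq> 0" by auto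
      with insert False show ?thesis by (auto simp: add_eq_max max_def)
    qed (use insert in \<open>auto simp: add_eq_max max_def\<close>)
  qed auto
  then show thesis using that by blast
qed

text \<open>
  Tropical vanishing says that the maximum is attained twice. In this form it can be used one
  term at a time, without knowing which term is maximal.
\<close>

lemma trop_vanishes_iff:
  fixes a :: "'i \<Rightarrow> 's::totally_ordered_idempotent_semifield"
  assumes fin: "finite I"
  shows "trop_vanishes I a \<longleftrightarrow> (\<forall>i\<in>I. a i \<noteq> 0 \<longrightarrow> (\<exists>j\<in>I. j \<noteq> i \<and> a i \<le> a j))"
proof
  assume van: "trop_vanishes I a"
  show "\<forall>i\<in>I. a i \<noteq> 0 \<longrightarrow> (\<exists>j\<in>I. j \<noteq> i \<and> a i \<le> a j)"
  proof (intro ballI impI)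
    fix i assume i: "i \<in> I" "a i \<noteq> 0"
    have eq: "(\<Sum>k\<in>I - {i}. a k) = (\<Sum>k\<in>I. a k)"
      using van i by (simp add: trop_vanishes_def)
    have le: "a i \<le> (\<Sum>k\<in>I. a k)"
      by (rule member_le_sum_semifield [OF fin i(1)])
    then have "(\<Sum>k\<in>I - {i}. a k) \<noteq> 0"
      using i eq by (metis le_zero_eq)
    then obtain j where "j \<in> I - {i}" "(\<Sum>k\<in>I - {i}. a k) = a j"
      by (rule sum_attained_semifield)
    then show "\<exists>j\<in>I. j \<noteq> i \<and> a i \<le> a j"
      using le eq by auto
  qed
next
  assume twice: "\<forall>i\<in>I. a i \<noteq> 0 \<longrightarrow> (\<exists>j\<in>I. j \<noteq> i \<and> a i \<le> a j)"
  show "trop_vanishes I a"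
    unfolding trop_vanishes_def
  proof
    fix i assume i: "i \<in> I"
    have le: "a k \<le> (\<Sum>k\<in>I - {i}. a k)" if "k \<in> I - {i}" for k
      using fin that by (intro member_le_sum_semifield) auto
    have "a k \<le> (\<Sum>k\<in>I - {i}. a k)" if "k \<in> I" for k
    proof (cases "k = i \<and> a i \<noteq> 0")
      case True
      then obtain j where "j \<in> I - {i}" "a i \<le> a j"
        using twice i by blast
      then show ?thesis
        using le [of j] True by auto
    next
      case False
      then show ?thesis
        using le [of k] that by (cases "k = i") auto
    qed
    then have "(\<Sum>k\<in>I. a k) \<le> (\<Sum>k\<in>I - {i}. a k)"
      by (rule sum_le_semifield)
    moreover have "(\<Sum>k\<in>I - {i}. a k) \<le> (\<Sum>k\<in>I. a k)"
      by (intro sum_le_semifield member_le_sum_semifield) (use fin in auto)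
    ultimately show "(\<Sum>k\<in>I - {i}. a k) = (\<Sum>k\<in>I. a k)"
      by (rule order_antisym [rotated])
  qed
qed


lemma trop_vanishes_twice:
  fixes a :: "'i \<Rightarrow> 's::totally_ordered_idempotent_semifield"
  assumes "trop_vanishes I a" "finite I" "i \<in> I" "a i \<noteq> 0"
  obtains j where "j \<in> I" "j \<noteq> i" "a i \<le> a j"
proof -
  have "\<exists>j\<in>I. j \<noteq> i \<and> a i \<le> a j"
    using assms(1,3,4) trop_vanishes_iff [OF assms(2), of a] by simp
  then show thesis
    using that by blast
qed


section \<open>Spans and tropical linear spaces\<close>

definition scale :: "'s::comm_semiring_1 \<Rightarrow> ('e \<Rightarrow>\<^sub>0 's) \<Rightarrow> 'e \<Rightarrow>\<^sub>0 's"
  where "scale c v = Poly_Mapping.map ((*) c) v"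

lemma lookup_scale: "lookup (scale c v) i = c * lookup v i"
  unfolding scale_def by transfer (simp add: when_def)

lemma is_submodule_iff:
  "is_submodule V \<longleftrightarrow> 0 \<in> V \<and> (\<forall>u\<in>V. \<forall>v\<in>V. u + v \<in> V) \<and> (\<forall>c. \<forall>v\<in>V. scale c v \<in> V)"
  by (simp add: is_submodule_def scale_def)

lemma scale_scale: "scale a (scale b v) = scale (a * b) v"
  by (rule poly_mapping_eqI) (simp add: lookup_scale mult.assoc)

lemma scale_one: "scale 1 v = v"
  by (rule poly_mapping_eqI) (simp add: lookup_scale)

lemma is_submodule_span: "is_submodule (submodule_span G)"
  unfolding submodule_span_def by (rule hull_in) (fastforce simp: is_submodule_iff)

lemma span_superset: "G \<subseteq> submodule_span G"
  unfolding submodule_span_def by (rule hull_subset)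

lemma span_base: "v \<in> G \<Longrightarrow> v \<in> submodule_span G"
  using span_superset by blast

lemma span_minimal: "G \<subseteq> V \<Longrightarrow> is_submodule V \<Longrightarrow> submodule_span G \<subseteq> V"
  unfolding submodule_span_def by (rule hull_minimal)

lemma span_zero: "0 \<in> submodule_span G"
  and span_add: "u \<in> submodule_span G \<Longrightarrow> v \<in> submodule_span G \<Longrightarrow> u + v \<in> submodule_span G"
  and span_scale: "v \<in> submodule_span G \<Longrightarrow> scale c v \<in> submodule_span G"
  using is_submodule_span [of G] by (simp_all add: is_submodule_iff)

lemma span_induct [consumes 1, case_names zero add scale base]:
  assumes "v \<in> submodule_span G" and "P 0"
    and "\<And>u v. P u \<Longrightarrow> P v \<Longrightarrow> P (u + v)" and "\<And>c v. P v \<Longrightarrow> P (scale c v)"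
    and "\<And>v. v \<in> G \<Longrightarrow> P v"
  shows "P v"
proof -
  have "is_submodule {v. P v}"
    using assms(2-4) by (simp add: is_submodule_iff)
  then have "submodule_span G \<subseteq> {v. P v}"
    using assms(5) by (intro span_minimal) auto
  then show ?thesis
    using assms(1) by blast
qed

lemma span_eqI:
  assumes "G \<subseteq> submodule_span H" "H \<subseteq> submodule_span G"
  shows "submodule_span G = submodule_span H"
  by (intro equalityI span_minimal assms is_submodule_span)

lemma lookup_add_eq_zero_semifield:
  fixes u v :: "'e \<Rightarrow>\<^sub>0 's::totally_ordered_idempotent_semifield"
  shows "lookup (u + v) i = 0 \<longleftrightarrow>
    lookup u i = 0 \<and> lookup v i = 0"
  by (simp add: lookup_add)

lemma lookup_cocircuit_vector:
  assumes "finite E"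
  shows "lookup (cocircuit_vector E p C) j = (if j \<in> E - C then p (insert j C) else 0)"
  using assms by (simp add: cocircuit_vector_def lookup_sum lookup_single when_def)

lemma cocircuit_in_lin_space:
  "C \<subseteq> E \<Longrightarrow> card C + 1 = r \<Longrightarrow> cocircuit_vector E p C \<in> lin_space E r p"
  unfolding lin_space_def by (rule span_base) blast

lemma lin_space_zero: "0 \<in> lin_space E r p"
  and lin_space_add: "u \<in> lin_space E r p \<Longrightarrow> v \<in> lin_space E r p \<Longrightarrow> u + v \<in> lin_space E r p"
  and lin_space_scale: "v \<in> lin_space E r p \<Longrightarrow> scale c v \<in> lin_space E r p"
  unfolding lin_space_def by (rule span_zero, erule (1) span_add, erule span_scale)

lemma lin_space_induct [consumes 1, case_names zero add scale cocircuit]: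
  assumes "v \<in> lin_space E r p" and "P 0"
    and "\<And>u v. P u \<Longrightarrow> P v \<Longrightarrow> P (u + v)" and "\<And>c v. P v \<Longrightarrow> P (scale c v)"
    and "\<And>C. C \<subseteq> E \<Longrightarrow> card C + 1 = r \<Longrightarrow> P (cocircuit_vector E p C)"
  shows "P v"
  using assms(1) unfolding lin_space_def
proof (induction rule: span_induct)
  case (base v)
  then show ?case using assms(5) by blast
qed (fact assms)+

lemma lin_space_zero_rank:
  assumes "finite E" shows "lin_space E 0 p = {0}"
proof -
  have "v = 0" if "v \<in> lin_space E 0 p" for v
    using that by (induction rule: lin_space_induct) (auto simp: poly_mapping_eq_iff lookup_scale fun_eq_iff lookup_add)
  then show ?thesis using lin_space_zero by blast
qed

lemma keys_lin_space:
  fixes p :: "'e set \<Rightarrow> 's::totally_ordered_idempotent_semifield"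
  assumes "finite E" "v \<in> lin_space E r p"
  shows "keys v \<subseteq> E"
  using assms(2)
proof (induction rule: lin_space_induct)
  case (add u v)
  then show ?case using keys_add [of u v] by blast
next
  case (scale c v)
  have "keys (scale c v) \<subseteq> keys v"
    by (auto simp: in_keys_iff lookup_scale)
  with scale show ?case by blast
next
  case (cocircuit C)
  show ?case
    by (auto simp: in_keys_iff lookup_cocircuit_vector [OF assms(1)] split: if_splits)
qed simp

lemma valuated_matroid_finite: "valuated_matroid E r p \<Longrightarrow> finite E"
  by (simp add: valuated_matroid_def)

lemma valuated_matroid_basis:
  assumes "valuated_matroid E r p"
  obtains B where "B \<subseteq> E" "card B = r" "p B \<noteq> 0"
  using assms by (auto simp: valuated_matroid_def)

lemma valuated_matroid_vanishes:
  assumes "valuated_matroid E r p" "B \<subseteq> E" "card B = r" "i \<in> E - B" "C \<subseteq> E" "card C + 1 = r"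
  shows "trop_vanishes (insert i B - C) (\<lambda>j. p (insert i B - {j}) * p (insert j C))"
proof -
  have "finite B"
    using assms finite_subset valuated_matroid_finite by blast
  then have "insert i B \<subseteq> E \<and> card (insert i B) = r + 1"
    using assms by auto
  then show ?thesis
    using assms by (auto simp: valuated_matroid_def)
qed

lemma valuated_matroid_exchange:
  assumes vm: "valuated_matroid E r p" and B: "B \<subseteq> E" "card B = r" "p B \<noteq> 0"
    and C: "C \<subseteq> E" "card C + 1 = r" and i: "i \<in> E - B - C" "p (insert i C) \<noteq> 0"
  obtains j where "j \<in> B - C" "p (insert i (B - {j})) \<noteq> 0" "p (insert j C) \<noteq> 0"
proof -
  have fin: "finite B"
    using vm B finite_subset valuated_matroid_finite by blast
  have iB: "insert i B - {i} = B"
    using i by auto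
  have iEB: "i \<in> E - B" and iBC: "i \<in> insert i B - C"
    using i by auto
  have fin': "finite (insert i B - C)"
    using fin by simp
  have "p (insert i B - {i}) * p (insert i C) \<noteq> 0"
    using i B(3) iB by simp
  then obtain j where j: "j \<in> insert i B - C" "j \<noteq> i"
      "p B * p (insert i C) \<le> p (insert i B - {j}) * p (insert j C)"
    by (rule trop_vanishes_twice [OF valuated_matroid_vanishes [OF vm B(1,2) iEB C] fin' iBC])
      (simp add: iB)
  have "p (insert i B - {j}) * p (insert j C) \<noteq> 0"
    using j(3) B(3) i(2) by (metis le_zero_eq mult_eq_0_iff)
  moreover have "insert i B - {j} = insert i (B - {j})"
    using j by auto
  ultimately show thesis
    using j that [of j] by auto
qed

text \<open>
  Nothing cancels in a sum, so it suffices to consider cocircuits. If a nonzero cocircuit has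
  support outside the basis, the exchange relation moves an index of its support into the basis.
\<close>

lemma lin_space_meets_basis:
  fixes p :: "'e set \<Rightarrow> 's::totally_ordered_idempotent_semifield"
  assumes vm: "valuated_matroid E r p" and B: "B \<subseteq> E" "card B = r" "p B \<noteq> 0"
    and v: "v \<in> lin_space E r p" "v \<noteq> 0"
  obtains b where "b \<in> B" "lookup v b \<noteq> 0"
proof -
  have fin: "finite E"
    using vm by (rule valuated_matroid_finite)
  have "v = 0 \<or> (\<exists>b\<in>B. lookup v b \<noteq> 0)"
    using v(1)
  proof (induction rule: lin_space_induct)
    case (add u v)
    then show ?case by (auto simp: lookup_add_eq_zero_semifield)
  next
    case (scale c v)
    then show ?case
      by (cases "c = 0") (auto simp: lookup_scale poly_mapping_eq_iff fun_eq_iff)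
  next
    case (cocircuit C)
    show ?case
    proof (cases "cocircuit_vector E p C = 0")
      case False
      then obtain i where "lookup (cocircuit_vector E p C) i \<noteq> 0"
        by (auto simp: poly_mapping_eq_iff fun_eq_iff)
      then have i: "i \<in> E - C" "p (insert i C) \<noteq> 0"
        by (auto simp: lookup_cocircuit_vector [OF fin] split: if_splits)
      show ?thesis
      proof (cases "i \<in> B")
        case True
        with i show ?thesis by (auto simp: lookup_cocircuit_vector [OF fin])
      next
        case iB: False
        obtain j where "j \<in> B - C" "p (insert j C) \<noteq> 0"
          by (rule valuated_matroid_exchange [OF vm B cocircuit, of i]) (use i iB in auto)
        then show ?thesis using B by (auto simp: lookup_cocircuit_vector [OF fin])
      qed
    qed simp
  qed simp
  then show thesis
    using v that by blast
qed

lemma finite_maximizer: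
  fixes f :: "'a \<Rightarrow> 'b::linorder"
  assumes "finite A" "A \<noteq> {}"
  obtains a where "a \<in> A" "\<And>b. b \<in> A \<Longrightarrow> f b \<le> f a"
proof -
  have "Max (f ` A) \<in> f ` A"
    using assms by simp
  then obtain a where "a \<in> A" "Max (f ` A) = f a" by auto
  then show thesis
    using assms by (metis Max_ge finite_imageI imageI that)
qed

text \<open>
  Drop from a basis an element outside \<open>B\<close>: if the basis meets \<open>B\<close> as much as possible, no
  element of \<open>B\<close> can replace the dropped one.
\<close>

lemma lin_space_vector_avoiding:
  fixes p :: "'e set \<Rightarrow> 's::totally_ordered_idempotent_semifield"
  assumes vm: "valuated_matroid E r p" and B: "B \<subseteq> E"
    and no_basis: "\<And>B'. B' \<subseteq> B \<Longrightarrow> card B' = r \<Longrightarrow> p B' = 0"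
  obtains v where "v \<in> lin_space E r p" "v \<noteq> 0" "\<And>b. b \<in> B \<Longrightarrow> lookup v b = 0"
proof -
  have fin: "finite E"
    using vm by (rule valuated_matroid_finite)
  let ?bases = "{A. A \<subseteq> E \<and> card A = r \<and> p A \<noteq> 0}"
  have "finite ?bases" "?bases \<noteq> {}"
    using finite_subset [of ?bases "Pow E"] fin valuated_matroid_basis [OF vm] by (blast intro: finite_Pow_iff [THEN iffD2])+
  then obtain A where A: "A \<in> ?bases" and max: "\<And>A'. A' \<in> ?bases \<Longrightarrow> card (A' \<inter> B) \<le> card (A \<inter> B)"
    by (rule finite_maximizer [where f = "\<lambda>A. card (A \<inter> B)"]) blast
  have finA: "finite A"
    using A fin finite_subset by blast
  obtain i where i: "i \<in> A" "i \<notin> B"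
    using A no_basis [of A] by blast
  define C where "C = A - {i}"
  have C: "C \<subseteq> E" "card C + 1 = r" "insert i C = A" "i \<in> E - C"
    using A i finA card_Suc_Diff1 by (fastforce simp: C_def)+
  show thesis
  proof
    show "cocircuit_vector E p C \<in> lin_space E r p"
      using C by (intro cocircuit_in_lin_space)
    have "lookup (cocircuit_vector E p C) i \<noteq> 0"
      using A C by (simp add: lookup_cocircuit_vector [OF fin])
    then show "cocircuit_vector E p C \<noteq> 0"
      by auto
  next
    fix b assume b: "b \<in> B"
    show "lookup (cocircuit_vector E p C) b = 0"
    proof (rule ccontr)
      assume "\<not> ?thesis"
      then have b': "b \<in> E - C" "p (insert b C) \<noteq> 0"
        by (auto simp: lookup_cocircuit_vector [OF fin] split: if_splits)
      have finC: "finite C"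
        using finA by (simp add: C_def)
      have "insert b C \<in> ?bases"
        using b' C finC by auto
      then have "card (insert b C \<inter> B) \<le> card (A \<inter> B)"
        by (rule max)
      moreover have "insert b C \<inter> B = insert b (A \<inter> B)"
        using b i by (auto simp: C_def)
      moreover have "b \<notin> A \<inter> B"
        using b b' i by (auto simp: C_def)
      ultimately show False
        using finA by simp
    qed
  qed
qed

lemma lin_space_subset_basis:
  fixes p q :: "'e set \<Rightarrow> 's::totally_ordered_idempotent_semifield"
  assumes p: "valuated_matroid E r p" and q: "valuated_matroid E s q"
    and sub: "lin_space E s q \<subseteq> lin_space E r p"
    and B: "B \<subseteq> E" "card B = r" "p B \<noteq> 0"
  obtains B' where "B' \<subseteq> B" "card B' = s" "q B' \<noteq> 0"
proof (rule ccontr)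
  assume "\<not> thesis"
  then have "q B' = 0" if "B' \<subseteq> B" "card B' = s" for B'
    using \<open>\<And>B'. B' \<subseteq> B \<Longrightarrow> card B' = s \<Longrightarrow> q B' \<noteq> 0 \<Longrightarrow> thesis\<close> that by blast
  then obtain v where v: "v \<in> lin_space E s q" "v \<noteq> 0"
      "\<And>b. b \<in> B \<Longrightarrow> lookup v b = 0"
    by (rule lin_space_vector_avoiding [OF q B(1)]) (blast+)
  then have "v \<in> lin_space E r p"
    using sub by blast
  then obtain b where "b \<in> B" "lookup v b \<noteq> 0"
    using v(2) by (rule lin_space_meets_basis [OF p B])
  with v(3) show False by blast
qed

text \<open>
  The rank is the least size of a set of positions that no nonzero vector of the space avoids:
  a basis is such a set, and every such set contains a basis. This description depends on the
  space only and is monotone in it.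
\<close>

lemma lin_space_subset_rank:
  fixes p q :: "'e set \<Rightarrow> 's::totally_ordered_idempotent_semifield"
  assumes p: "valuated_matroid E r p" and q: "valuated_matroid E s q"
    and sub: "lin_space E s q \<subseteq> lin_space E r p"
  shows "s \<le> r"
proof -
  obtain B where B: "B \<subseteq> E" "card B = r" "p B \<noteq> 0"
    using p by (rule valuated_matroid_basis)
  obtain B' where "B' \<subseteq> B" "card B' = s"
    by (rule lin_space_subset_basis [OF p q sub B])
  then show ?thesis
    using B card_mono finite_subset [OF B(1) valuated_matroid_finite [OF p]] by blast
qed

lemma trop_rank_eq:
  fixes L :: "('e \<Rightarrow>\<^sub>0 's::totally_ordered_idempotent_semifield) set"
  assumes "trop_linear_space_of_rank E r L"
  shows "trop_rank E L = r"
  unfolding trop_rank_def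
proof (rule the_equality [where P = "\<lambda>r. trop_linear_space_of_rank E r L"])
  fix s assume "trop_linear_space_of_rank E s L"
  then obtain q where q: "valuated_matroid E s q" "L = lin_space E s q"
    by (auto simp: trop_linear_space_of_rank_def)
  obtain p where p: "valuated_matroid E r p" "L = lin_space E r p"
    using assms by (auto simp: trop_linear_space_of_rank_def)
  have "s \<le> r" "r \<le> s"
    using p(2) q(2) lin_space_subset_rank [OF p(1) q(1)] lin_space_subset_rank [OF q(1) p(1)] by auto
  then show "s = r" by simp
qed (fact assms)

text \<open>
  In the exchange relation for the basis \<open>insert i C\<close> enlarged by \<open>k\<close>, all terms except those of
  \<open>i\<close> and \<open>k\<close> are zero, because the second cocircuit vanishes on \<open>C\<close>. Vanishing tropically, the
  two remaining terms agree, which is the proportionality.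
\<close>

lemma lin_space_vanishing_proportional:
  fixes p :: "'e set \<Rightarrow> 's::totally_ordered_idempotent_semifield"
  assumes vm: "valuated_matroid E r p" and C: "C \<subseteq> E" "card C + 1 = r"
    and i: "i \<in> E - C" "p (insert i C) \<noteq> 0"
    and v: "v \<in> lin_space E r p" and van: "\<And>c. c \<in> C \<Longrightarrow> lookup v c = 0"
  shows "p (insert i C) * lookup v k =
    lookup v i * lookup (cocircuit_vector E p C) k"
proof -
  have fin: "finite E"
    using vm by (rule valuated_matroid_finite)
  have finC: "finite C"
    using C fin finite_subset by blast
  define B where "B = insert i C"
  have B: "B \<subseteq> E" "card B = r"
    using C i finC by (auto simp: B_def)
  have "(\<forall>c\<in>C. lookup v c = 0) \<longrightarrow>
      p B * lookup v k =
      lookup v i * lookup (cocircuit_vector E p C) k"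
    using v
  proof (induction rule: lin_space_induct)
    case zero
    show ?case by simp
  next
    case (add u v)
    then show ?case
      by (auto simp: lookup_add_eq_zero_semifield lookup_add distrib_left distrib_right)
  next
    case (scale c v)
    then show ?case
      by (cases "c = 0") (auto simp: lookup_scale mult.left_commute mult.assoc)
  next
    case (cocircuit D)
    show ?case
    proof
      assume *: "\<forall>c\<in>C. lookup (cocircuit_vector E p D) c = 0"
      then have van: "p (insert c D) = 0" if "c \<in> C - D" for c
        using that C by (auto simp: lookup_cocircuit_vector [OF fin] split: if_splits)
      let ?\<beta> = "lookup (cocircuit_vector E p D)"
      show "p B * ?\<beta> k = ?\<beta> i * lookup (cocircuit_vector E p C) k"
      proof -
        consider "k \<notin> E" | "k \<in> C" | "k = i" | "k \<in> E - B"
          by (auto simp: B_def)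
        then show ?thesis
        proof cases
          case 1
          then show ?thesis by (simp add: lookup_cocircuit_vector [OF fin])
        next
          case 2
          then show ?thesis using * by (simp add: lookup_cocircuit_vector [OF fin])
        next
          case 3
          then show ?thesis using i by (simp add: lookup_cocircuit_vector [OF fin] B_def mult.commute)
        next
          case 4
          let ?t = "\<lambda>j. p (insert k B - {j}) * p (insert j D)"
          have sets: "insert k B - {k} = B" "insert k B - {i} = insert k C"
            using 4 i by (auto simp: B_def)
          have zero: "?t j = 0" if "j \<in> insert k B - D" "j \<noteq> i" "j \<noteq> k" for j
            using van [of j] that by (auto simp: B_def)
          have fin': "finite (insert k B - D)"
            using finC by (simp add: B_def)
          have twice: "\<exists>j'\<in>insert k B - D. j' \<noteq> j \<and> ?t j \<le> ?t j'"
            if "?t j \<noteq> 0" "j \<in> insert k B - D" for j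
            by (rule trop_vanishes_twice [OF valuated_matroid_vanishes [OF vm B 4 cocircuit] fin' that(2,1)])
              blast
          define s where "s j = (if j \<in> D then 0 else ?t j)" for j
          have le: "s j \<le> s j'" if jj': "{j, j'} = {i, k}" for j j'
          proof (cases "s j = 0")
            case False
            then have j: "j \<notin> D" "?t j \<noteq> 0" by (auto simp: s_def split: if_splits)
            have "j \<in> insert k B - D" using jj' j by (auto simp: B_def doubleton_eq_iff)
            then obtain j2 where j2: "j2 \<in> insert k B - D" "j2 \<noteq> j" "?t j \<le> ?t j2"
              using twice j by blast
            then have "?t j2 \<noteq> 0" using j(2) by (metis le_zero_eq)
            then have "j2 = j'" using zero j2 jj' by (metis doubleton_eq_iff)
            with j2 j show ?thesis by (auto simp: s_def)
          qed simp
          have "p B * ?\<beta> k = s k"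
            using 4 sets(1) by (simp add: s_def lookup_cocircuit_vector [OF fin])
          also have "s k = s i"
            by (intro order_antisym le) auto
          also have "s i = p (insert k C) * ?\<beta> i"
            using i sets(2) by (simp add: s_def lookup_cocircuit_vector [OF fin])
          also have "p (insert k C) = lookup (cocircuit_vector E p C) k"
            using 4 by (simp add: B_def lookup_cocircuit_vector [OF fin])
          finally show ?thesis
            by (simp add: mult.commute)
        qed
      qed
    qed
  qed
  then show ?thesis
    using van by (simp add: B_def)
qed

text \<open>
  A basis of the larger space is also a basis of the smaller one, because it has the right size
  and no nonzero vector avoids it. The fundamental cocircuits for a common basis are
  proportional, since those of the smaller space are vectors of the larger one.
\<close>

lemma lin_space_subset_eq:
  fixes p q :: "'e set \<Rightarrow> 's::totally_ordered_idempotent_semifield"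
  assumes p: "valuated_matroid E r p" and q: "valuated_matroid E r q"
    and sub: "lin_space E r q \<subseteq> lin_space E r p"
  shows "lin_space E r q = lin_space E r p"
proof
  have fin: "finite E"
    using p by (rule valuated_matroid_finite)
  show "lin_space E r p \<subseteq> lin_space E r q"
  proof
    fix v assume "v \<in> lin_space E r p"
    then show "v \<in> lin_space E r q"
    proof (induction rule: lin_space_induct)
      case (cocircuit C)
      show ?case
      proof (cases "cocircuit_vector E p C = 0")
        case False
        then obtain i where "lookup (cocircuit_vector E p C) i \<noteq> 0"
          by (auto simp: poly_mapping_eq_iff fun_eq_iff)
        then have i: "i \<in> E - C" "p (insert i C) \<noteq> 0"
          by (auto simp: lookup_cocircuit_vector [OF fin] split: if_splits)
        have finC: "finite C"
          using cocircuit fin finite_subset by blast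
        have B: "insert i C \<subseteq> E" "card (insert i C) = r"
          using i finC cocircuit by auto
        obtain B' where B': "B' \<subseteq> insert i C" "card B' = r" "q B' \<noteq> 0"
          by (rule lin_space_subset_basis [OF p q sub B i(2)])
        then have "B' = insert i C"
          using B finC by (metis card_subset_eq finite.insertI)
        with B' obtain d where d: "d * q (insert i C) = 1"
          using ex_mult_inverse by (metis mult.commute)
        have "p (insert i C) * lookup (cocircuit_vector E q C) k =
            lookup (cocircuit_vector E q C) i * lookup (cocircuit_vector E p C) k" for k
          using cocircuit_in_lin_space [OF cocircuit, of q] sub
          by (intro lin_space_vanishing_proportional [OF p cocircuit i])
            (auto simp: lookup_cocircuit_vector [OF fin])
        moreover have "lookup (cocircuit_vector E q C) i = q (insert i C)"
          using i by (simp add: lookup_cocircuit_vector [OF fin])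
        ultimately have "scale (p (insert i C)) (cocircuit_vector E q C) =
            scale (q (insert i C)) (cocircuit_vector E p C)"
          by (intro poly_mapping_eqI) (simp add: lookup_scale)
        then have "scale d (scale (p (insert i C)) (cocircuit_vector E q C)) = cocircuit_vector E p C"
          using d by (simp add: scale_scale scale_one)
        then show ?thesis
          using cocircuit_in_lin_space [OF cocircuit, of q] lin_space_scale by metis
      qed (simp add: lin_space_zero)
    qed (auto intro: lin_space_zero lin_space_add lin_space_scale)
  qed
qed (fact sub)

text \<open>
  This is the cut property of a maximum weight basis: if the leading position of a cocircuit lay
  outside the basis, exchanging it for a smaller position of the same cocircuit would increase
  the weight. The leading position of a general vector is that of one of the cocircuits that
  it is a combination of, as nothing cancels.
\<close>

lemma lin_space_leading_positions:
  fixes p :: "'e::linorder set \<Rightarrow> 's::totally_ordered_idempotent_semifield"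
  assumes vm: "valuated_matroid E r p"
  obtains B where "B \<subseteq> E" "card B = r"
    "\<And>v i. v \<in> lin_space E r p \<Longrightarrow> lookup v i \<noteq> 0 \<Longrightarrow>
      (\<And>j. i < j \<Longrightarrow> lookup v j = 0) \<Longrightarrow> i \<in> B"
proof -
  have fin: "finite E"
    using vm by (rule valuated_matroid_finite)
  let ?bases = "{A. A \<subseteq> E \<and> card A = r \<and> p A \<noteq> 0}"
  \<comment> \<open>Any strictly increasing weight would do.\<close>
  define w where "w i = card {j \<in> E. j < i}" for i
  have w: "w j < w i" if "j \<in> E" "i \<in> E" "j < i" for i j
    unfolding w_def by (rule psubset_card_mono) (use fin that in auto)
  have "finite ?bases" "?bases \<noteq> {}"
    using finite_subset [of ?bases "Pow E"] fin valuated_matroid_basis [OF vm] by (blast intro: finite_Pow_iff [THEN iffD2])+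
  then obtain B where B: "B \<in> ?bases" and max: "\<And>A. A \<in> ?bases \<Longrightarrow> sum w A \<le> sum w B"
    by (rule finite_maximizer [where f = "sum w"]) blast
  have finB: "finite B"
    using B fin finite_subset by blast
  show thesis
  proof
    show "B \<subseteq> E" "card B = r" using B by auto
    fix v i
    assume "v \<in> lin_space E r p" and "lookup v i \<noteq> 0"
      and "\<And>j. i < j \<Longrightarrow> lookup v j = 0"
    then show "i \<in> B"
    proof (induction rule: lin_space_induct)
      case (add u v)
      then show ?case by (auto simp: lookup_add_eq_zero_semifield)
    next
      case (scale c v)
      then show ?case by (auto simp: lookup_scale)
    next
      case (cocircuit C)
      then have i: "i \<in> E - C" "p (insert i C) \<noteq> 0"
        by (auto simp: lookup_cocircuit_vector [OF fin] split: if_splits)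
      show ?case
      proof (rule ccontr)
        assume iB: "i \<notin> B"
        obtain j where j: "j \<in> B - C" "p (insert i (B - {j})) \<noteq> 0" "p (insert j C) \<noteq> 0"
          by (rule valuated_matroid_exchange [OF vm _ _ _ cocircuit(1,2), of B i]) (use B i iB in auto)
        have jE: "j \<in> E" using j B by auto
        have "lookup (cocircuit_vector E p C) j \<noteq> 0"
          using j jE by (auto simp: lookup_cocircuit_vector [OF fin])
        then have "j < i"
          using cocircuit(4) [of j] j iB by (metis DiffD1 linorder_neqE)
        have "insert i (B - {j}) \<in> ?bases"
          using B i iB j finB card_Suc_Diff1 by fastforce
        then have "sum w (insert i (B - {j})) \<le> sum w B"
          by (rule max)
        moreover have "sum w B = w j + sum w (B - {j})"
          using j finB by (intro sum.remove) auto
        ultimately show False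
          using w [of j i] jE i \<open>j < i\<close> iB finB by simp
      qed
    qed simp
  qed
qed


section \<open>Matchings, tropical minors and stable sums\<close>

text \<open>
  Follow the alternating path that leaves \<open>x\<close> along \<open>g\<close> and returns to rows along the inverse of
  the matching \<open>\<sigma>\<close>. Either it closes up or it escapes from the range of \<open>\<sigma>\<close> at one column \<open>k\<close>.
  Switching the rows \<open>P\<close> on the path from \<open>\<sigma>\<close> to \<open>g\<close> gives in the first case another matching to
  the same columns; in the second case the column \<open>k\<close> replaces \<open>\<sigma> x\<close>. Which case holds is
  decided by counting, since \<open>\<sigma>\<close> and \<open>g\<close> are injective on \<open>P\<close>.
\<close>

lemma matching_rotation:
  assumes fin: "finite R" and \<sigma>: "inj_on \<sigma> R" and g: "inj_on g R" and x: "x \<in> R"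
  obtains (cycle) P where "P \<subseteq> R" "x \<in> P" "g ` P = \<sigma> ` P"
    | (path) P k where "P \<subseteq> R" "x \<in> P" "k \<notin> \<sigma> ` R" "g ` P = insert k (\<sigma> ` P - {\<sigma> x})"
proof -
  define step where "step = {(y, z). y \<in> R \<and> z \<in> R \<and> \<sigma> z = g y}"
  define P where "P = {z. (x, z) \<in> step\<^sup>*}"
  have PR: "P \<subseteq> R"
  proof
    fix z assume "z \<in> P"
    then have "(x, z) \<in> step\<^sup>*" by (simp add: P_def)
    then show "z \<in> R"
      by (induction rule: rtrancl_induct) (auto simp: x step_def)
  qed
  have xP: "x \<in> P" by (simp add: P_def)
  have finP: "finite P" using PR fin finite_subset by blast
  have inj: "inj_on \<sigma> P" "inj_on g P"
    using \<sigma> g PR inj_on_subset by blast+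
  have card: "card (\<sigma> ` P) = card P" "card (g ` P) = card P"
    using inj by (simp_all add: card_image)
  have returns: "\<sigma> ` P - {\<sigma> x} \<subseteq> g ` P"
  proof (rule subsetI)
    fix s assume "s \<in> \<sigma> ` P - {\<sigma> x}"
    then obtain z where z: "z \<in> P" "s = \<sigma> z" "z \<noteq> x" by blast
    then have "(x, z) \<in> step\<^sup>*" by (simp add: P_def)
    then show "s \<in> g ` P"
    proof (cases rule: rtranclE)
      case (step y)
      then show ?thesis using z by (auto simp: P_def step_def)
    qed (use z in auto)
  qed
  have closed: "g y \<in> \<sigma> ` P" if y: "y \<in> P" "g y \<in> \<sigma> ` R" for y
  proof -
    obtain z where z: "z \<in> R" "g y = \<sigma> z" using y by blast
    then have "(y, z) \<in> step" using y PR by (auto simp: step_def)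
    with y have "z \<in> P"
      by (auto simp: P_def intro: rtrancl_into_rtrancl)
    with z show ?thesis by blast
  qed
  show thesis
  proof (cases "\<sigma> x \<in> g ` P")
    case True
    with returns have "\<sigma> ` P \<subseteq> g ` P" by auto
    then have "\<sigma> ` P = g ` P"
      using card finP by (intro card_subset_eq) auto
    with PR xP show thesis by (intro cycle) auto
  next
    case False
    have "card (\<sigma> ` P - {\<sigma> x}) + 1 = card P"
      using xP finP card by (metis Suc_eq_plus1 card.remove finite_imageI image_eqI)
    then have "card (g ` P - (\<sigma> ` P - {\<sigma> x})) = 1"
      using card returns finP by (subst card_Diff_subset) auto
    then obtain k where k: "g ` P - (\<sigma> ` P - {\<sigma> x}) = {k}"
      by (auto simp: card_1_singleton_iff)
    then have eq: "g ` P = insert k (\<sigma> ` P - {\<sigma> x})"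
      using returns by blast
    have "k \<in> g ` P" "k \<notin> \<sigma> ` P - {\<sigma> x}"
      using k by blast+
    then have "k \<notin> \<sigma> ` P"
      using False by (cases "k = \<sigma> x") auto
    then have "k \<notin> \<sigma> ` R"
      using closed \<open>k \<in> g ` P\<close> by (metis imageE)
    with PR xP eq show thesis by (intro path)
  qed
qed

lemma bij_betw_switch:
  assumes "finite R" "P \<subseteq> R" "\<sigma> ` (R - P) \<union> g ` P = B" "card B = card R"
  shows "bij_betw (\<lambda>x. if x \<in> P then g x else \<sigma> x) R B"
proof -
  have "(\<lambda>x. if x \<in> P then g x else \<sigma> x) ` R = B"
    using assms(2,3) by (auto simp: image_iff)
  then show ?thesis
    using assms(1,4) by (auto simp: bij_betw_def intro: eq_card_imp_inj_on)
qed

lemma prod_eq_zero_iff_semifield: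
  fixes a :: "'i \<Rightarrow> 's::totally_ordered_idempotent_semifield"
  assumes "finite I"
  shows "(\<Prod>i\<in>I. a i) = 0 \<longleftrightarrow> (\<exists>i\<in>I. a i = 0)"
  using assms by (induction I rule: finite_induct) auto

lemma trop_minor_ge:
  fixes A :: "'r \<Rightarrow> 'e \<Rightarrow> 's::totally_ordered_idempotent_semifield"
  assumes "finite R" and \<sigma>: "bij_betw \<sigma> R B"
  shows "(\<Prod>i\<in>R. A i (\<sigma> i)) \<le> trop_minor R A B"
proof -
  have finB: "finite B"
    using assms bij_betw_finite by blast
  let ?M = "{\<sigma>. \<sigma> \<in> R \<rightarrow>\<^sub>E B \<and> bij_betw \<sigma> R B}"
  have "finite ?M"
    by (rule finite_subset [OF _ finite_PiE [of R "\<lambda>_. B"]]) (use assms finB in auto)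
  moreover have "restrict \<sigma> R \<in> ?M"
    using \<sigma> bij_betw_apply by fastforce
  ultimately have "(\<Prod>i\<in>R. A i (restrict \<sigma> R i)) \<le> trop_minor R A B"
    unfolding trop_minor_def by (rule member_le_sum_semifield)
  then show ?thesis by simp
qed

lemma trop_minor_le:
  fixes A :: "'r \<Rightarrow> 'e \<Rightarrow> 's::totally_ordered_idempotent_semifield"
  assumes "\<And>\<sigma>. bij_betw \<sigma> R B \<Longrightarrow> (\<Prod>i\<in>R. A i (\<sigma> i)) \<le> c"
  shows "trop_minor R A B \<le> c"
  unfolding trop_minor_def by (rule sum_le_semifield) (use assms in blast)

lemma trop_minor_attained:
  fixes A :: "'r \<Rightarrow> 'e \<Rightarrow> 's::totally_ordered_idempotent_semifield"
  assumes "trop_minor R A B \<noteq> 0"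
  obtains \<sigma> where "bij_betw \<sigma> R B" "trop_minor R A B = (\<Prod>i\<in>R. A i (\<sigma> i))"
  using assms unfolding trop_minor_def by (rule sum_attained_semifield) blast

lemma trop_minor_nonzero_iff:
  fixes A :: "'r \<Rightarrow> 'e \<Rightarrow> 's::totally_ordered_idempotent_semifield"
  assumes "finite R"
  shows "trop_minor R A B \<noteq> 0 \<longleftrightarrow> (\<exists>\<sigma>. bij_betw \<sigma> R B \<and> (\<forall>i\<in>R. A i (\<sigma> i) \<noteq> 0))"
proof
  assume nz: "trop_minor R A B \<noteq> 0"
  then obtain \<sigma> where \<sigma>: "bij_betw \<sigma> R B" "trop_minor R A B = (\<Prod>i\<in>R. A i (\<sigma> i))"
    by (rule trop_minor_attained)
  with nz assms have "\<forall>i\<in>R. A i (\<sigma> i) \<noteq> 0"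
    by (simp add: prod_eq_zero_iff_semifield)
  with \<sigma>(1) show "\<exists>\<sigma>. bij_betw \<sigma> R B \<and> (\<forall>i\<in>R. A i (\<sigma> i) \<noteq> 0)"
    by blast
next
  assume "\<exists>\<sigma>. bij_betw \<sigma> R B \<and> (\<forall>i\<in>R. A i (\<sigma> i) \<noteq> 0)"
  then obtain \<sigma> where \<sigma>: "bij_betw \<sigma> R B" "\<forall>i\<in>R. A i (\<sigma> i) \<noteq> 0" by blast
  have "(\<Prod>i\<in>R. A i (\<sigma> i)) \<noteq> 0"
    using \<sigma>(2) assms by (simp add: prod_eq_zero_iff_semifield)
  then show "trop_minor R A B \<noteq> 0"
    using trop_minor_ge [OF assms \<sigma>(1), of A] by (metis le_zero_eq)
qed

lemma trop_minor_zero_column: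
  fixes A :: "'r \<Rightarrow> 'e \<Rightarrow> 's::totally_ordered_idempotent_semifield"
  assumes "finite R" "j \<in> B" "\<And>i. i \<in> R \<Longrightarrow> A i j = 0"
  shows "trop_minor R A B = 0"
proof (rule ccontr)
  assume "trop_minor R A B \<noteq> 0"
  then obtain \<sigma> where \<sigma>: "bij_betw \<sigma> R B" "\<forall>i\<in>R. A i (\<sigma> i) \<noteq> 0"
    using trop_minor_nonzero_iff [OF assms(1), of A B] by blast
  then obtain i where "i \<in> R" "\<sigma> i = j"
    using assms(2) by (auto simp: bij_betw_def)
  then show False
    using \<sigma>(2) assms(3) by blast
qed

text \<open>
  Given matchings for two terms of the exchange relation, rotating along the alternating path
  that starts at \<open>i\<close> moves the rows of the path from each matching to the other. This changes
  \<open>i\<close> into another index \<open>k\<close> of the relation and keeps the product, so no term is strictly larger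
  than all others.
\<close>

lemma trop_minor_valuated_matroid:
  fixes A :: "'r \<Rightarrow> 'e \<Rightarrow> 's::totally_ordered_idempotent_semifield"
  assumes finE: "finite E" and fin: "finite R" and B: "B \<subseteq> E" "trop_minor R A B \<noteq> 0"
  shows "valuated_matroid E (card R) (trop_minor R A)"
proof -
  let ?p = "trop_minor R A"
  obtain \<rho> where "bij_betw \<rho> R B"
    using B(2) by (rule trop_minor_attained)
  then have "card B = card R"
    by (simp add: bij_betw_same_card)
  moreover have "trop_vanishes (U - W) (\<lambda>i. ?p (U - {i}) * ?p (insert i W))"
    if U: "U \<subseteq> E" "card U = card R + 1" and W: "W \<subseteq> E" "card W + 1 = card R" for U W
  proof -
    have finU: "finite U" and finW: "finite W"
      using U W finE finite_subset by blast+
    have "\<exists>k\<in>U - W. k \<noteq> i \<and> ?p (U - {i}) * ?p (insert i W) \<le> ?p (U - {k}) * ?p (insert k W)"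
      if i: "i \<in> U - W" and nz: "?p (U - {i}) * ?p (insert i W) \<noteq> 0" for i
    proof -
      obtain \<sigma> where \<sigma>: "bij_betw \<sigma> R (U - {i})" "?p (U - {i}) = (\<Prod>x\<in>R. A x (\<sigma> x))"
        using trop_minor_attained [of R A "U - {i}"] nz by auto
      obtain \<tau> where \<tau>: "bij_betw \<tau> R (insert i W)" "?p (insert i W) = (\<Prod>x\<in>R. A x (\<tau> x))"
        using trop_minor_attained [of R A "insert i W"] nz by auto
      have im: "\<sigma> ` R = U - {i}" "\<tau> ` R = insert i W" and inj: "inj_on \<sigma> R" "inj_on \<tau> R"
        using \<sigma> \<tau> by (auto simp: bij_betw_def)
      have "i \<in> \<tau> ` R"
        using im(2) by simp
      then obtain x where x: "x \<in> R" "\<tau> x = i"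
        by auto
      from fin inj(2) inj(1) x(1) show ?thesis
      proof (cases rule: matching_rotation)
        case (cycle P)
        then have "i \<in> \<sigma> ` R" using x by blast
        then show ?thesis using im by blast
      next
        case (path P k)
        have k: "k \<in> U - W" "k \<noteq> i"
          using path im by blast+
        have rest: "\<sigma> ` (R - P) = (U - {i}) - \<sigma> ` P" "\<tau> ` (R - P) = insert i W - \<tau> ` P"
          using inj im path(1) by (simp_all add: inj_on_image_set_diff)
        have "i \<in> \<tau> ` P"
          using path(2) x(2) by blast
        moreover have k\<tau>: "k \<notin> \<tau> ` P"
          using path(1,3) by blast
        ultimately have \<tau>P: "\<tau> ` P = insert i (\<sigma> ` P - {k})"
          unfolding path(4) x(2) by blast
        have \<sigma>P: "i \<notin> \<sigma> ` P" "k \<in> \<sigma> ` P"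
          unfolding path(4) x(2) using k by blast+
        have \<sigma>U: "\<sigma> ` P \<subseteq> U - {i}"
          using im(1) path(1) by blast
        have \<tau>W: "\<tau> ` P \<subseteq> insert i W"
          using im(2) path(1) by blast
        have 1: "bij_betw (\<lambda>x. if x \<in> P then \<tau> x else \<sigma> x) R (U - {k})"
        proof (rule bij_betw_switch [OF fin path(1)])
          show "\<sigma> ` (R - P) \<union> \<tau> ` P = U - {k}"
            unfolding rest \<tau>P using i k \<sigma>P \<sigma>U by auto
          show "card (U - {k}) = card R"
            using U k finU by simp
        qed
        have 2: "bij_betw (\<lambda>x. if x \<in> P then \<sigma> x else \<tau> x) R (insert k W)"
        proof (rule bij_betw_switch [OF fin path(1)])
          show "\<tau> ` (R - P) \<union> \<sigma> ` P = insert k W"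
            unfolding rest path(4) x(2) using i k k\<tau> \<open>i \<in> \<tau> ` P\<close> \<tau>W by auto
          show "card (insert k W) = card R"
            using W k finW by simp
        qed
        have "?p (U - {i}) * ?p (insert i W) = (\<Prod>x\<in>R. A x (\<sigma> x) * A x (\<tau> x))"
          by (simp add: \<sigma>(2) \<tau>(2) prod.distrib)
        also have "\<dots> = (\<Prod>x\<in>R. A x (if x \<in> P then \<tau> x else \<sigma> x) * A x (if x \<in> P then \<sigma> x else \<tau> x))"
          by (rule prod.cong) (auto simp: mult.commute)
        also have "\<dots> \<le> ?p (U - {k}) * ?p (insert k W)"
          unfolding prod.distrib
          by (intro mult_mono_semifield trop_minor_ge [OF fin 1] trop_minor_ge [OF fin 2])
        finally show ?thesis using k by blast
      qed
    qed
    then show ?thesis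
      by (subst trop_vanishes_iff) (use finU in auto)
  qed
  ultimately show ?thesis
    unfolding valuated_matroid_def using finE B by blast
qed

text \<open>
  A matching of nonzero weight cannot use the columns \<open>T\<close> in the rows \<open>R\<^sub>1\<close>, so the remaining rows,
  equal in number to these columns, have to use all of them.
\<close>

lemma trop_minor_block:
  fixes A :: "'r \<Rightarrow> 'e \<Rightarrow> 's::totally_ordered_idempotent_semifield"
  assumes fin: "finite R" and sub: "R\<^sub>1 \<subseteq> R" and T: "card T = card (R - R\<^sub>1)" "finite T" "B \<inter> T = {}"
    and zero: "\<And>i t. i \<in> R\<^sub>1 \<Longrightarrow> t \<in> T \<Longrightarrow> A i t = 0"
  shows "trop_minor R A (B \<union> T) = trop_minor R\<^sub>1 A B * trop_minor (R - R\<^sub>1) A T"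
proof (rule order_antisym)
  have split: "(\<Prod>i\<in>R. h i) = (\<Prod>i\<in>R\<^sub>1. h i) * (\<Prod>i\<in>R - R\<^sub>1. h i)" for h :: "'r \<Rightarrow> 's"
    using prod.subset_diff [OF sub fin, of h] by (simp add: mult.commute)
  have fin1: "finite R\<^sub>1" "finite (R - R\<^sub>1)"
    using fin sub finite_subset by auto
  show "trop_minor R A (B \<union> T) \<le> trop_minor R\<^sub>1 A B * trop_minor (R - R\<^sub>1) A T"
  proof (rule trop_minor_le)
    fix \<sigma> assume \<sigma>: "bij_betw \<sigma> R (B \<union> T)"
    show "(\<Prod>i\<in>R. A i (\<sigma> i)) \<le> trop_minor R\<^sub>1 A B * trop_minor (R - R\<^sub>1) A T"
    proof (cases "(\<Prod>i\<in>R. A i (\<sigma> i)) = 0")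
      case False
      then have nz: "A i (\<sigma> i) \<noteq> 0" if "i \<in> R" for i
        using False that by (simp add: prod_eq_zero_iff_semifield [OF fin])
      have im: "\<sigma> ` R = B \<union> T" and inj: "inj_on \<sigma> R"
        using \<sigma> by (auto simp: bij_betw_def)
      have no_T: "\<sigma> i \<notin> T" if "i \<in> R\<^sub>1" for i
        using that nz [of i] zero [of i "\<sigma> i"] sub by auto
      have "T \<subseteq> \<sigma> ` (R - R\<^sub>1)"
      proof
        fix t assume t: "t \<in> T"
        then have "t \<in> \<sigma> ` R" using im by simp
        then show "t \<in> \<sigma> ` (R - R\<^sub>1)"
          using no_T t by auto
      qed
      moreover have "card (\<sigma> ` (R - R\<^sub>1)) = card T"
        using inj T(1) by (metis Diff_subset card_image inj_on_subset)
      ultimately have im2: "\<sigma> ` (R - R\<^sub>1) = T"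
        using fin by (metis card_subset_eq finite_Diff finite_imageI)
      have "\<sigma> ` R\<^sub>1 = \<sigma> ` R - \<sigma> ` (R - R\<^sub>1)"
        using inj sub by (metis Diff_Diff_Int Diff_subset inf.absorb2 inj_on_image_set_diff)
      then have im1: "\<sigma> ` R\<^sub>1 = B"
        unfolding im im2 using T(3) by auto
      have "bij_betw \<sigma> R\<^sub>1 B" "bij_betw \<sigma> (R - R\<^sub>1) T"
        using im1 im2 inj sub by (auto simp: bij_betw_def inj_on_subset)
      then show ?thesis
        unfolding split using fin1 by (intro mult_mono_semifield trop_minor_ge)
    qed simp
  qed
  show "trop_minor R\<^sub>1 A B * trop_minor (R - R\<^sub>1) A T \<le> trop_minor R A (B \<union> T)"
  proof (cases "trop_minor R\<^sub>1 A B * trop_minor (R - R\<^sub>1) A T = 0")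
    case False
    obtain \<sigma> where \<sigma>: "bij_betw \<sigma> R\<^sub>1 B" "trop_minor R\<^sub>1 A B = (\<Prod>x\<in>R\<^sub>1. A x (\<sigma> x))"
      using trop_minor_attained [of R\<^sub>1 A B] False by auto
    obtain \<tau> where \<tau>: "bij_betw \<tau> (R - R\<^sub>1) T" "trop_minor (R - R\<^sub>1) A T = (\<Prod>x\<in>R - R\<^sub>1. A x (\<tau> x))"
      using trop_minor_attained [of "R - R\<^sub>1" A T] False by auto
    let ?\<rho> = "\<lambda>x. if x \<in> R\<^sub>1 then \<sigma> x else \<tau> x"
    have "bij_betw ?\<rho> R\<^sub>1 B" "bij_betw ?\<rho> (R - R\<^sub>1) T"
      using \<sigma>(1) \<tau>(1) bij_betw_cong [of R\<^sub>1 ?\<rho> \<sigma> B] bij_betw_cong [of "R - R\<^sub>1" ?\<rho> \<tau> T] by simp_all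
    then have "bij_betw ?\<rho> (R\<^sub>1 \<union> (R - R\<^sub>1)) (B \<union> T)"
      using T(3) by (rule bij_betw_combine)
    then have "bij_betw ?\<rho> R (B \<union> T)"
      using sub by (simp add: Un_absorb1)
    then have "(\<Prod>i\<in>R. A i (?\<rho> i)) \<le> trop_minor R A (B \<union> T)"
      by (rule trop_minor_ge [OF fin])
    then show ?thesis
      unfolding split \<sigma>(2) \<tau>(2) by simp
  next
    case True
    show ?thesis
      unfolding True by (rule zero_le)
  qed
qed

text \<open>
  If the other rows have a nonzero minor on columns that are zero in the rows \<open>R\<^sub>1\<close>, then adding
  these columns to the index set turns every nonzero cocircuit of \<open>R\<^sub>1\<close>, up to a scalar, into a
  cocircuit of \<open>R\<close>.
\<close>

lemma stable_sum_block_subset: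
  fixes A :: "'r \<Rightarrow> 'e \<Rightarrow> 's::totally_ordered_idempotent_semifield"
  assumes finE: "finite E" and fin: "finite R" and sub: "R\<^sub>1 \<subseteq> R"
    and T: "T \<subseteq> E" "trop_minor (R - R\<^sub>1) A T \<noteq> 0"
    and zero: "\<And>i t. i \<in> R\<^sub>1 \<Longrightarrow> t \<in> T \<Longrightarrow> A i t = 0"
  shows "stable_sum R\<^sub>1 E A \<subseteq> stable_sum R E A"
proof
  have finT: "finite T"
    using T finE finite_subset by blast
  have fin1: "finite R\<^sub>1"
    using sub fin finite_subset by blast
  obtain \<rho> where "bij_betw \<rho> (R - R\<^sub>1) T"
    using T(2) by (rule trop_minor_attained)
  then have cardT: "card T = card (R - R\<^sub>1)"
    by (simp add: bij_betw_same_card)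
  have column: "trop_minor R\<^sub>1 A B = 0" if "t \<in> T" "t \<in> B" for t B
    by (rule trop_minor_zero_column [OF fin1 that(2)]) (use zero that in auto)
  let ?p = "trop_minor R A" and ?p\<^sub>1 = "trop_minor R\<^sub>1 A" and ?c = "trop_minor (R - R\<^sub>1) A T"
  obtain d where d: "d * ?c = 1"
    using ex_mult_inverse [OF T(2)] by (metis mult.commute)
  fix v assume "v \<in> stable_sum R\<^sub>1 E A"
  then show "v \<in> stable_sum R E A"
    unfolding stable_sum_def
  proof (induction rule: lin_space_induct)
    case (cocircuit C)
    show ?case
    proof (cases "C \<inter> T = {}")
      case False
      then obtain t where "t \<in> C" "t \<in> T" by blast
      then have "cocircuit_vector E ?p\<^sub>1 C = 0"
        using column by (intro poly_mapping_eqI) (auto simp: lookup_cocircuit_vector [OF finE])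
      then show ?thesis by (simp add: lin_space_zero)
    next
      case True
      have finC: "finite C"
        using cocircuit finE finite_subset by blast
      have "card (R - R\<^sub>1) = card R - card R\<^sub>1" "card R\<^sub>1 \<le> card R"
        using fin sub fin1 by (auto simp: card_Diff_subset card_mono)
      then have card: "card (C \<union> T) + 1 = card R"
        using True finC finT cocircuit cardT by (simp add: card_Un_disjoint)
      have "lookup (cocircuit_vector E ?p (C \<union> T)) j =
          ?c * lookup (cocircuit_vector E ?p\<^sub>1 C) j" for j
      proof (cases "j \<in> T")
        case True
        then show ?thesis
          using column [of j "insert j C"] by (simp add: lookup_cocircuit_vector [OF finE])
      next
        case jT: False
        then have "?p (insert j C \<union> T) = ?p\<^sub>1 (insert j C) * ?c"
          using True by (intro trop_minor_block [OF fin sub cardT finT] zero) auto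
        then show ?thesis
          using jT by (simp add: lookup_cocircuit_vector [OF finE] mult.commute)
      qed
      then have "cocircuit_vector E ?p\<^sub>1 C = scale d (cocircuit_vector E ?p (C \<union> T))"
        using d by (intro poly_mapping_eqI) (simp add: lookup_scale flip: mult.assoc)
      then show ?thesis
        using cocircuit T card by (simp add: lin_space_scale cocircuit_in_lin_space)
    qed
  qed (auto intro: lin_space_zero lin_space_add lin_space_scale)
qed

lemma trop_minor_reindex:
  fixes A :: "'r \<Rightarrow> 'e \<Rightarrow> 's::totally_ordered_idempotent_semifield"
  assumes fin: "finite R" and h: "inj_on h R" and k: "inj_on k B"
  shows "trop_minor (h ` R) A (k ` B) = trop_minor R (\<lambda>x y. A (h x) (k y)) B"
proof (rule order_antisym)
  show "trop_minor (h ` R) A (k ` B) \<le> trop_minor R (\<lambda>x y. A (h x) (k y)) B"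
  proof (rule trop_minor_le)
    fix \<sigma> assume \<sigma>: "bij_betw \<sigma> (h ` R) (k ` B)"
    let ?\<tau> = "inv_into B k \<circ> (\<sigma> \<circ> h)"
    have "bij_betw (\<sigma> \<circ> h) R (k ` B)"
      by (rule bij_betw_trans [OF inj_on_imp_bij_betw [OF h] \<sigma>])
    moreover have "bij_betw (inv_into B k) (k ` B) B"
      using k by (simp add: bij_betw_inv_into inj_on_imp_bij_betw)
    ultimately have bij: "bij_betw ?\<tau> R B"
      by (rule bij_betw_trans)
    have "k (?\<tau> x) = \<sigma> (h x)" if "x \<in> R" for x
    proof -
      have "\<sigma> (h x) \<in> k ` B"
        using \<sigma> that by (auto simp: bij_betw_def)
      then show ?thesis by (simp add: f_inv_into_f)
    qed
    then have "(\<Prod>i\<in>h ` R. A i (\<sigma> i)) = (\<Prod>x\<in>R. A (h x) (k (?\<tau> x)))"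
      by (simp add: prod.reindex [OF h])
    also have "\<dots> \<le> trop_minor R (\<lambda>x y. A (h x) (k y)) B"
      by (rule trop_minor_ge [OF fin bij])
    finally show "(\<Prod>i\<in>h ` R. A i (\<sigma> i)) \<le> trop_minor R (\<lambda>x y. A (h x) (k y)) B" .
  qed
  show "trop_minor R (\<lambda>x y. A (h x) (k y)) B \<le> trop_minor (h ` R) A (k ` B)"
  proof (rule trop_minor_le)
    fix \<sigma> assume \<sigma>: "bij_betw \<sigma> R B"
    let ?\<tau> = "(k \<circ> \<sigma>) \<circ> inv_into R h"
    have "bij_betw (k \<circ> \<sigma>) R (k ` B)"
      by (rule bij_betw_trans [OF \<sigma> inj_on_imp_bij_betw [OF k]])
    moreover have "bij_betw (inv_into R h) (h ` R) R"
      using h by (simp add: bij_betw_inv_into inj_on_imp_bij_betw)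
    ultimately have bij: "bij_betw ?\<tau> (h ` R) (k ` B)"
      by (rule bij_betw_trans [rotated])
    have "(\<Prod>x\<in>R. A (h x) (k (\<sigma> x))) = (\<Prod>i\<in>h ` R. A i (?\<tau> i))"
      by (simp add: prod.reindex [OF h] h)
    also have "\<dots> \<le> trop_minor (h ` R) A (k ` B)"
      by (rule trop_minor_ge [OF finite_imageI [OF fin] bij])
    finally show "(\<Prod>x\<in>R. A (h x) (k (\<sigma> x))) \<le> trop_minor (h ` R) A (k ` B)" .
  qed
qed


section \<open>Monomials and graded submodules\<close>

lemma keys_add_monom:
  fixes m m' :: monom
  shows "keys (m + m') = keys m \<union> keys m'"
  by (auto simp: in_keys_iff lookup_add)

lemma mdeg_eq_sum:
  assumes "finite S" "keys m \<subseteq> S"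
  shows "mdeg m = (\<Sum>i\<in>S. lookup m i)"
  unfolding mdeg_def by (rule sum.mono_neutral_left) (use assms in \<open>auto simp: in_keys_iff\<close>)

lemma mdeg_add: "mdeg (m + m') = mdeg m + mdeg m'"
proof -
  let ?S = "keys m \<union> keys m'"
  have "mdeg (m + m') = (\<Sum>i\<in>?S. lookup (m + m') i)"
    by (rule mdeg_eq_sum) (auto simp: keys_add_monom)
  also have "\<dots> = (\<Sum>i\<in>?S. lookup m i) + (\<Sum>i\<in>?S. lookup m' i)"
    by (simp add: lookup_add sum.distrib)
  also have "\<dots> = mdeg m + mdeg m'"
    by (metis finite_UnI finite_keys mdeg_eq_sum sup_ge1 sup_ge2)
  finally show ?thesis .
qed

lemma mdeg_single: "mdeg (single i k) = k"
  by (simp add: mdeg_def)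

lemma mdeg_zero: "mdeg 0 = 0"
  by (simp add: mdeg_def)

lemma mdeg_eq_0_iff: "mdeg m = 0 \<longleftrightarrow> m = 0"
  by (auto simp: mdeg_def in_keys_iff poly_mapping_eq_iff fun_eq_iff)

lemma monoms_add: "m \<in> monoms n a \<Longrightarrow> m' \<in> monoms n b \<Longrightarrow> m + m' \<in> monoms n (a + b)"
  by (simp add: monoms_def keys_add_monom mdeg_add)

lemma monoms_add_iff:
  assumes "m \<in> monoms n a"
  shows "m + m' \<in> monoms n (a + b) \<longleftrightarrow> m' \<in> monoms n b"
  using assms by (simp add: monoms_def keys_add_monom mdeg_add)

lemma single_in_monoms: "i \<le> n \<Longrightarrow> single i k \<in> monoms n k"
  by (simp add: monoms_def mdeg_single)

lemma monom_divide:
  fixes m :: monom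
  assumes "lookup m i \<noteq> 0"
  obtains m' where "m = single i 1 + m'"
proof
  show "m = single i 1 + (m - single i 1)"
    using assms by (intro poly_mapping_eqI) (auto simp: lookup_add lookup_minus lookup_single when_def)
qed

lemma monoms_zero: "monoms n 0 = {0}"
  by (auto simp: monoms_def mdeg_eq_0_iff)

lemma finite_card_monoms: "finite (monoms n d) \<and> card (monoms n d) = (n + d) choose d"
proof (induction n arbitrary: d)
  case 0
  have "monoms 0 d = {single 0 d}"
  proof (intro equalityI subsetI)
    fix m assume "m \<in> monoms 0 d"
    then have m: "keys m \<subseteq> {0}" "mdeg m = d"
      by (auto simp: monoms_def)
    then have "lookup m 0 = d"
      by (subst (asm) mdeg_eq_sum [of "{0}"]) auto
    then have "m = single 0 d"
      using m(1) by (intro poly_mapping_eqI) (auto simp: lookup_single when_def in_keys_iff subset_iff)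
    then show "m \<in> {single 0 d}" by simp
  qed (simp add: single_in_monoms)
  then show ?case by simp
next
  case (Suc n)
  show ?case
  proof (induction d)
    case (Suc d)
    let ?x = "single (Suc n) 1 :: monom"
    have split: "monoms (Suc n) (Suc d) = monoms n (Suc d) \<union> (+) ?x ` monoms (Suc n) d"
    proof (intro equalityI subsetI)
      fix m assume m: "m \<in> monoms (Suc n) (Suc d)"
      show "m \<in> monoms n (Suc d) \<union> (+) ?x ` monoms (Suc n) d"
      proof (cases "lookup m (Suc n) = 0")
        case True
        then have "Suc n \<notin> keys m" by (simp add: in_keys_iff)
        then have "keys m \<subseteq> {0..n}"
          using m by (force simp: monoms_def le_Suc_eq)
        then show ?thesis using m by (simp add: monoms_def)
      next
        case False
        then obtain m' where m': "m = ?x + m'" by (rule monom_divide)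
        then have "m' \<in> monoms (Suc n) d"
          using m monoms_add_iff [OF single_in_monoms [of "Suc n" "Suc n" 1], of m' d] by simp
        then show ?thesis using m' by simp
      qed
    next
      fix m assume "m \<in> monoms n (Suc d) \<union> (+) ?x ` monoms (Suc n) d"
      then show "m \<in> monoms (Suc n) (Suc d)"
        using monoms_add [OF single_in_monoms [of "Suc n" "Suc n" 1], of _ d]
        by (auto simp: monoms_def [of n])  (auto simp: monoms_def)
    qed
    have disjoint: "monoms n (Suc d) \<inter> (+) ?x ` monoms (Suc n) d = {}"
      by (auto simp: monoms_def keys_add_monom)
    have "inj_on ((+) ?x) (monoms (Suc n) d)"
      by (simp add: inj_on_def)
    then have "card ((+) ?x ` monoms (Suc n) d) = (Suc n + d) choose d"
      using Suc.IH by (simp add: card_image)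
    then show ?case
      using Suc.IH Suc.prems \<open>\<And>d. finite (monoms n d) \<and> _\<close> disjoint unfolding split
      by (simp add: card_Un_disjoint)
  qed (simp add: monoms_zero)
qed

lemma finite_monoms: "finite (monoms n d)"
  and card_monoms: "card (monoms n d) = (n + d) choose d"
  using finite_card_monoms by auto

lemma lookup_single_times:
  fixes h :: "'a::comm_semiring_1 mpoly"
  shows "lookup (single m c * h) (m + z) = c * lookup h z"
proof -
  have "lookup (single m c * h) (m + z) =
      (\<Sum>l. (c * (\<Sum>q. lookup h q when m + z = l + q)) when l = m)"
    unfolding lookup_mult by (rule arg_cong [of _ _ Sum_any]) (auto simp: lookup_single fun_eq_iff when_def)
  also have "\<dots> = c * (\<Sum>q. lookup h q when q = z)"
    by (simp add: eq_commute [of z])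
  finally show ?thesis by simp
qed

lemma lookup_single_times_nonzero:
  fixes h :: "'a::comm_semiring_1 mpoly"
  assumes "lookup (single m c * h) y \<noteq> 0"
  obtains z where "y = m + z" "z \<in> keys h"
  using assms keys_mult [of "single m c" h]
  by (auto simp: in_keys_iff split: if_splits)

lemma single_times_eq_scale: "single m c * h = scale c (single m 1 * h)"
  for h :: "'a::comm_semiring_1 mpoly"
proof (rule poly_mapping_eqI)
  fix y
  show "lookup (single m c * h) y =
      lookup (scale c (single m 1 * h)) y"
  proof (cases "\<exists>z. y = m + z")
    case True
    then show ?thesis by (auto simp: lookup_scale lookup_single_times)
  next
    case False
    have "lookup (single m a * h) y = 0" for a
      by (rule ccontr) (use False lookup_single_times_nonzero in blast)
    then show ?thesis by (simp add: lookup_scale)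
  qed
qed

lemma poly_eq_sum_terms:
  "(\<Sum>m\<in>keys g. single m (lookup g m)) = g"
  by (rule poly_mapping_eqI) (simp add: lookup_sum lookup_single when_def in_keys_iff)

lemma lookup_hom_component:
  "lookup (hom_component d g) m = (if mdeg m = d then lookup g m else 0)"
  by (simp add: hom_component_def lookup_mapp when_def in_keys_iff)

lemma hom_component_add: "hom_component d (g + h) = hom_component d g + hom_component d h"
  by (rule poly_mapping_eqI) (simp add: lookup_hom_component lookup_add)

lemma hom_component_zero: "hom_component d 0 = 0"
  by (rule poly_mapping_eqI) (simp add: lookup_hom_component)

lemma hom_component_scale: "hom_component d (scale c g) = scale c (hom_component d g)"
  by (rule poly_mapping_eqI) (simp add: lookup_hom_component lookup_scale)

lemma hom_component_hom_polys:
  assumes "g \<in> hom_polys n e"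
  shows "hom_component d g = (if d = e then g else 0)"
proof (rule poly_mapping_eqI)
  fix m
  have "mdeg m = e" if "lookup g m \<noteq> 0"
    using assms that by (auto simp: hom_polys_def monoms_def in_keys_iff)
  then show "lookup (hom_component d g) m = lookup (if d = e then g else 0) m"
    by (auto simp: lookup_hom_component)
qed

lemma hom_component_in_hom_polys: "g \<in> polys n \<Longrightarrow> hom_component d g \<in> hom_polys n d"
  by (auto simp: polys_def hom_polys_def monoms_def in_keys_iff lookup_hom_component split: if_splits)

lemma hom_component_single_times:
  "hom_component (d + mdeg m) (single m 1 * h) = single m 1 * hom_component d h"
  and hom_component_single_times_low:
  "d' < mdeg m \<Longrightarrow> hom_component d' (single m 1 * h) = 0"
  for h :: "'a::comm_semiring_1 mpoly"
proof -
  have zero: "lookup (single m 1 * g) y = 0"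
    if "\<nexists>z. y = m + z" for y and g :: "'a mpoly"
    by (rule ccontr) (use that lookup_single_times_nonzero in blast)
  show "hom_component (d + mdeg m) (single m 1 * h) = single m 1 * hom_component d h"
  proof (rule poly_mapping_eqI)
    fix y
    show "lookup (hom_component (d + mdeg m) (single m 1 * h)) y =
        lookup (single m 1 * hom_component d h) y"
      by (cases "\<exists>z. y = m + z")
        (auto simp: lookup_hom_component lookup_single_times mdeg_add zero)
  qed
  show "d' < mdeg m \<Longrightarrow> hom_component d' (single m 1 * h) = 0"
  proof (rule poly_mapping_eqI)
    fix y assume "d' < mdeg m"
    then show "lookup (hom_component d' (single m 1 * h)) y =
        lookup 0 y"
      by (cases "\<exists>z. y = m + z") (auto simp: lookup_hom_component mdeg_add zero)
  qed
qed

lemma hom_polys_subset_polys: "hom_polys n d \<subseteq> polys n"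
  by (auto simp: hom_polys_def polys_def monoms_def)

lemma polys_add: "g \<in> polys n \<Longrightarrow> h \<in> polys n \<Longrightarrow> g + h \<in> polys n"
  using keys_add [of g h] by (auto simp: polys_def)

lemma polys_mult:
  fixes g h :: "'a::comm_semiring_1 mpoly"
  assumes "g \<in> polys n" "h \<in> polys n" shows "g * h \<in> polys n"
  unfolding polys_def
proof (intro CollectI ballI)
  fix m assume "m \<in> keys (g * h)"
  then obtain a b where "m = a + b" "a \<in> keys g" "b \<in> keys h"
    using keys_mult [of g h] by blast
  then show "keys m \<subseteq> {0..n}"
    using assms by (simp add: polys_def keys_add_monom)
qed

lemma polys_scale: "g \<in> polys n \<Longrightarrow> scale c g \<in> polys n"
  by (auto simp: polys_def in_keys_iff lookup_scale)

lemma hom_polys_mult: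
  fixes g h :: "'a::comm_semiring_1 mpoly"
  assumes "g \<in> hom_polys n a" "h \<in> hom_polys n b" shows "g * h \<in> hom_polys n (a + b)"
proof -
  have "m \<in> monoms n (a + b)" if m: "m \<in> keys (g * h)" for m
  proof -
    obtain k l where "m = k + l" "k \<in> keys g" "l \<in> keys h"
      using m keys_mult [of g h] by blast
    then show ?thesis
      using assms by (auto simp: hom_polys_def intro: monoms_add)
  qed
  then show ?thesis by (auto simp: hom_polys_def)
qed

lemma is_submodule_hom_polys: "is_submodule (hom_polys n d :: 'a::comm_semiring_1 mpoly set)"
proof -
  have "keys (scale c v) \<subseteq> keys v" for c :: 'a and v :: "'a mpoly"
    by (auto simp: in_keys_iff lookup_scale)
  moreover have "keys (u + v) \<subseteq> keys u \<union> keys v" for u v :: "'a mpoly"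
    by (rule keys_add)
  ultimately show ?thesis
    unfolding is_submodule_iff hom_polys_def by (simp, blast)
qed

lemma graded_part_graded_sum:
  assumes V: "V d \<subseteq> hom_polys n d" and zero: "\<And>d. 0 \<in> V d"
  shows "graded_part n d (graded_sum n V) = V d"
proof (intro equalityI subsetI)
  fix g assume "g \<in> graded_part n d (graded_sum n V)"
  then have "g \<in> hom_polys n d" "hom_component d g \<in> V d"
    by (auto simp: graded_part_def graded_sum_def)
  then show "g \<in> V d"
    by (simp add: hom_component_hom_polys)
next
  fix g assume g: "g \<in> V d"
  then have "g \<in> hom_polys n d" using V by blast
  moreover have "g \<in> polys n"
    using calculation hom_polys_subset_polys by blast
  ultimately show "g \<in> graded_part n d (graded_sum n V)"
    using g zero by (simp add: graded_part_def graded_sum_def hom_component_hom_polys)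
qed

text \<open>
  Multiplication by a polynomial is reduced to multiplication by single variables.
\<close>

lemma homogeneous_ideal_graded_sum:
  fixes V :: "nat \<Rightarrow> 'a::comm_semiring_1 mpoly set"
  assumes V: "\<And>d. V d \<subseteq> hom_polys n d" and sub: "\<And>d. is_submodule (V d)"
    and var: "\<And>i d v. i \<le> n \<Longrightarrow> v \<in> V d \<Longrightarrow> Var i * v \<in> V (Suc d)"
  shows "homogeneous_ideal n (graded_sum n V)"
proof -
  have zero: "0 \<in> V d" and add: "u \<in> V d \<Longrightarrow> v \<in> V d \<Longrightarrow> u + v \<in> V d"
    and scale: "v \<in> V d \<Longrightarrow> scale c v \<in> V d" for c d u v
    using sub [of d] by (auto simp: is_submodule_iff)
  let ?J = "graded_sum n V"
  have J_zero: "0 \<in> ?J"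
    using zero by (simp add: graded_sum_def polys_def hom_component_zero)
  have J_add: "g + h \<in> ?J" if "g \<in> ?J" "h \<in> ?J" for g h
    using that by (simp add: graded_sum_def polys_add hom_component_add add)
  have J_scale: "scale c g \<in> ?J" if "g \<in> ?J" for c g
    using that by (simp add: graded_sum_def polys_scale hom_component_scale scale)
  have monomial: "single m 1 * v \<in> V (d + mdeg m)"
    if "keys m \<subseteq> {0..n}" "v \<in> V d" for m v d
    using that
  proof (induction "mdeg m" arbitrary: m)
    case 0
    then show ?case by (simp add: mdeg_eq_0_iff mdeg_zero)
  next
    case (Suc k)
    then obtain i where i: "lookup m i \<noteq> 0"
      by (metis mdeg_eq_0_iff nat.distinct(1) poly_mapping_eqI lookup_zero)
    then obtain m' where m': "m = single i 1 + m'"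
      by (rule monom_divide)
    have "i \<in> keys m" using i by (simp add: in_keys_iff)
    then have "i \<le> n" using Suc.prems by auto
    moreover have "single m' 1 * v \<in> V (d + mdeg m')"
      using Suc m' by (intro Suc.hyps) (auto simp: mdeg_add mdeg_single keys_add_monom)
    ultimately have "Var i * (single m' 1 * v) \<in> V (Suc (d + mdeg m'))"
      by (rule var)
    then show ?case
      by (simp add: m' Var_def mdeg_add mdeg_single mult_single flip: mult.assoc)
  qed
  have J_monomial: "single m c * h \<in> ?J"
    if m: "keys m \<subseteq> {0..n}" and h: "h \<in> ?J" for m c h
  proof -
    have "single m 1 * h \<in> polys n"
      using m h by (intro polys_mult) (auto simp: polys_def graded_sum_def)
    moreover have "hom_component d (single m 1 * h) \<in> V d" for d
    proof (cases "d < mdeg m")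
      case True
      then show ?thesis by (simp add: hom_component_single_times_low zero)
    next
      case False
      then have "d = (d - mdeg m) + mdeg m" by simp
      then show ?thesis
        using monomial [OF m, of "hom_component (d - mdeg m) h" "d - mdeg m"] h
          hom_component_single_times [of "d - mdeg m" m h]
        by (simp add: graded_sum_def)
    qed
    ultimately have "single m 1 * h \<in> ?J"
      by (simp add: graded_sum_def)
    then show ?thesis
      unfolding single_times_eq_scale [of m c] by (rule J_scale)
  qed
  have J_mult: "g * h \<in> ?J" if g: "g \<in> polys n" and h: "h \<in> ?J" for g h
  proof -
    have "(\<Sum>m\<in>S. single m (lookup g m) * h) \<in> ?J"
      if "S \<subseteq> keys g" for S
      using finite_subset [OF that finite_keys] that
    proof (induction S rule: finite_induct)
      case (insert m S)
      then have "keys m \<subseteq> {0..n}"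
        using g by (auto simp: polys_def)
      then show ?case
        using insert h by (simp add: J_add J_monomial)
    qed (simp add: J_zero)
    from this [OF subset_refl] show ?thesis
      by (simp add: poly_eq_sum_terms flip: sum_distrib_right)
  qed
  have J_component: "hom_component d g \<in> ?J" if "g \<in> ?J" for d g
  proof -
    have part: "graded_part n d ?J = V d"
      by (rule graded_part_graded_sum [OF V zero])
    have "hom_component d g \<in> graded_part n d ?J"
      unfolding part using that by (simp add: graded_sum_def)
    then show ?thesis by (simp add: graded_part_def)
  qed
  show ?thesis
    unfolding homogeneous_ideal_def
    using J_zero J_add J_mult J_component by (auto simp: graded_sum_def [of n V])
qed

lemma homogeneous_ideal_eqI:
  fixes J J' :: "'a::comm_semiring_1 mpoly set"
  assumes J: "homogeneous_ideal n J" and J': "homogeneous_ideal n J'"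
    and eq: "\<And>d. graded_part n d J = graded_part n d J'"
  shows "J = J'"
proof -
  have "g \<in> L" if "homogeneous_ideal n K" "homogeneous_ideal n L"
      "\<And>d. graded_part n d K = graded_part n d L" "g \<in> K" for g and K L :: "'a mpoly set"
  proof -
    have "g \<in> polys n" using that by (auto simp: homogeneous_ideal_def)
    have component: "hom_component d g \<in> L" for d
    proof -
      have "hom_component d g \<in> graded_part n d K"
        using that(1,4) hom_component_in_hom_polys [OF \<open>g \<in> polys n\<close>]
        by (auto simp: homogeneous_ideal_def graded_part_def)
      then show ?thesis
        unfolding that(3) by (simp add: graded_part_def)
    qed
    have "(\<Sum>d\<in>S. hom_component d g) \<in> L" if "finite S" for S
      using that
    proof (induction S rule: finite_induct)
      case empty
      show ?case using \<open>homogeneous_ideal n L\<close> by (simp add: homogeneous_ideal_def)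
    next
      case (insert d S)
      then show ?case
        using \<open>homogeneous_ideal n L\<close> component by (simp add: homogeneous_ideal_def)
    qed
    then have "(\<Sum>d\<in>mdeg ` keys g. hom_component d g) \<in> L"
      by simp
    also have "(\<Sum>d\<in>mdeg ` keys g. hom_component d g) = g"
    proof (rule poly_mapping_eqI)
      fix m
      show "lookup (\<Sum>d\<in>mdeg ` keys g. hom_component d g) m =
          lookup g m"
        by (auto simp: lookup_sum lookup_hom_component in_keys_iff image_iff)
    qed
    finally show ?thesis .
  qed
  from this [OF J J' eq] this [OF J' J eq [symmetric]] show ?thesis by blast
qed


section \<open>The Macaulay ideal is tropically principal\<close>

lemma macaulay_matrix_translate: "macaulay_matrix f X (X + m) = lookup f m"
  by (simp add: macaulay_matrix_def lookup_single_times)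

lemma macaulay_matrix_nonzero:
  assumes "macaulay_matrix f X Y \<noteq> 0"
  obtains m where "Y = X + m" "m \<in> keys f"
  using assms unfolding macaulay_matrix_def by (rule lookup_single_times_nonzero)

lemma macaulay_matrix_shift: "macaulay_matrix f (Z + X) (Z + Y) = macaulay_matrix f X Y"
proof -
  have "single (Z + X) 1 * f = single Z 1 * (single X 1 * f)"
    by (simp add: mult_single flip: mult.assoc)
  then show ?thesis
    by (simp add: macaulay_matrix_def lookup_single_times)
qed

lemma trop_minor_singleton:
  fixes A :: "'r \<Rightarrow> 'e \<Rightarrow> 's::totally_ordered_idempotent_semifield"
  shows "trop_minor {x} A {j} = A x j"
proof (rule order_antisym)
  show "trop_minor {x} A {j} \<le> A x j"
    by (rule trop_minor_le) (auto simp: bij_betw_def)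
  show "A x j \<le> trop_minor {x} A {j}"
    using trop_minor_ge [of "{x}" "\<lambda>_. j" "{j}" A] by (simp add: bij_betw_def)
qed

lemma homogeneous_imp_hom_polys:
  assumes "f \<in> polys n" "f \<noteq> 0" "homogeneous f"
  shows "f \<in> hom_polys n (pdeg f)"
proof -
  obtain d where d: "\<forall>m\<in>keys f. mdeg m = d"
    using assms(3) by (auto simp: homogeneous_def)
  moreover have "keys f \<noteq> {}"
    using assms(2) by simp
  ultimately have "mdeg ` keys f = {d}"
    by (simp add: image_constant_conv cong: image_cong)
  then have "pdeg f = d"
    by (simp add: pdeg_def)
  then show ?thesis
    using d assms(1) by (auto simp: hom_polys_def monoms_def polys_def)
qed

lemma trop_linear_space_zero:
  assumes "finite E"
  shows "trop_linear_space_of_rank E 0 ({0} :: ('e \<Rightarrow>\<^sub>0 's::totally_ordered_idempotent_semifield) set)"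
proof -
  have "valuated_matroid E 0 (\<lambda>_. 1 :: 's)"
    using assms by (auto simp: valuated_matroid_def)
  moreover have "{0} = lin_space E 0 (\<lambda>_. 1 :: 's)"
    by (simp add: lin_space_zero_rank [OF assms])
  ultimately show ?thesis
    unfolding trop_linear_space_of_rank_def by blast
qed

lemma num_monoms_eq_card: "num_monoms n (int d) = int (card (monoms n d))"
  by (simp add: num_monoms_def card_monoms)

locale homogeneous_form =
  fixes n :: nat and f :: "'s::totally_ordered_idempotent_semifield mpoly"
  assumes f_hom: "f \<in> hom_polys n (pdeg f)" and f_nonzero: "f \<noteq> 0"
begin

abbreviation rows :: "nat \<Rightarrow> monom set"
  where "rows d \<equiv> monoms n (d - pdeg f)"

abbreviation minor :: "nat \<Rightarrow> monom set \<Rightarrow> 's"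
  where "minor d \<equiv> trop_minor (rows d) (macaulay_matrix f)"

lemma keys_nonempty: "keys f \<noteq> {}"
  using f_nonzero by simp

lemma translate_in_columns:
  assumes "m \<in> keys f" "pdeg f \<le> d" "X \<in> rows d"
  shows "X + m \<in> monoms n d"
proof -
  have "m \<in> monoms n (pdeg f)"
    using assms(1) f_hom by (auto simp: hom_polys_def)
  then show ?thesis
    using monoms_add [OF assms(3), of m "pdeg f"] assms(2) by simp
qed

lemma minor_matching_nonzero:
  assumes fin: "finite R" and inj: "inj_on (\<lambda>X. X + c X) R"
    and c: "\<And>X. X \<in> R \<Longrightarrow> c X \<in> keys f"
  shows "trop_minor R (macaulay_matrix f) ((\<lambda>X. X + c X) ` R) \<noteq> 0"
proof -
  have "bij_betw (\<lambda>X. X + c X) R ((\<lambda>X. X + c X) ` R)"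
    using inj by (rule inj_on_imp_bij_betw)
  moreover have "macaulay_matrix f X (X + c X) \<noteq> 0" if "X \<in> R" for X
    using c [OF that] by (simp add: macaulay_matrix_translate in_keys_iff)
  ultimately show ?thesis
    unfolding trop_minor_nonzero_iff [OF fin] by blast
qed

lemma minor_translate_nonzero:
  assumes "finite R" "m \<in> keys f"
  shows "trop_minor R (macaulay_matrix f) ((\<lambda>X. X + m) ` R) \<noteq> 0"
  using assms by (intro minor_matching_nonzero) (auto simp: inj_on_def)

lemma minor_valuated_matroid:
  assumes "pdeg f \<le> d"
  shows "valuated_matroid (monoms n d) (card (rows d)) (minor d)"
proof -
  obtain m where m: "m \<in> keys f"
    using keys_nonempty by blast
  show ?thesis
  proof (rule trop_minor_valuated_matroid)
    show "(\<lambda>X. X + m) ` rows d \<subseteq> monoms n d"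
      using translate_in_columns [OF m assms] by blast
    show "minor d ((\<lambda>X. X + m) ` rows d) \<noteq> 0"
      by (rule minor_translate_nonzero [OF finite_monoms m])
  qed (rule finite_monoms)+
qed

lemma macaulay_part_eq:
  assumes "pdeg f \<le> d"
  shows "macaulay_part n f d = lin_space (monoms n d) (card (rows d)) (minor d)"
  using assms by (simp add: macaulay_part_def stable_sum_def)

lemma macaulay_part_rank:
  "trop_linear_space_of_rank (monoms n d) (if d < pdeg f then 0 else card (rows d)) (macaulay_part n f d)"
proof (cases "d < pdeg f")
  case True
  then show ?thesis
    by (simp add: macaulay_part_def trop_linear_space_zero finite_monoms)
next
  case False
  then have d: "pdeg f \<le> d" by simp
  show ?thesis
    unfolding trop_linear_space_of_rank_def
    using minor_valuated_matroid [OF d] macaulay_part_eq [OF d] False by auto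
qed

lemma macaulay_part_subset: "macaulay_part n f d \<subseteq> hom_polys n d"
proof (cases "d < pdeg f")
  case True
  then show ?thesis by (simp add: macaulay_part_def hom_polys_def)
next
  case False
  then show ?thesis
    by (auto simp: hom_polys_def macaulay_part_eq dest!: keys_lin_space [OF finite_monoms])
qed

lemma macaulay_part_submodule: "is_submodule (macaulay_part n f d)"
proof (cases "d < pdeg f")
  case True
  have "scale c 0 = (0 :: 's mpoly)" for c
    by (rule poly_mapping_eqI) (simp add: lookup_scale)
  with True show ?thesis by (simp add: macaulay_part_def is_submodule_iff)
next
  case False
  then show ?thesis
    by (simp add: macaulay_part_eq lin_space_def is_submodule_span)
qed

lemma macaulay_part_zero: "0 \<in> macaulay_part n f d"
  using macaulay_part_submodule [of d] by (simp add: is_submodule_iff)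

text \<open>
  The rows of the next Macaulay matrix that are multiples of \<open>x\<^sub>i\<close> form a copy of the given
  matrix. The other rows have exponent zero at \<open>x\<^sub>i\<close>; multiplying them by a term of \<open>f\<close> in which
  the exponent of \<open>x\<^sub>i\<close> is as small as possible gives columns where the rows of the copy vanish.
\<close>

lemma macaulay_part_Var:
  assumes i: "i \<le> n" and v: "v \<in> macaulay_part n f d"
  shows "Var i * v \<in> macaulay_part n f (Suc d)"
proof (cases "d < pdeg f")
  case True
  then have "v = 0" using v by (simp add: macaulay_part_def)
  then show ?thesis by (simp add: macaulay_part_zero)
next
  case False
  then have d: "pdeg f \<le> d" "pdeg f \<le> Suc d" by simp_all
  define x :: monom where "x = single i 1"
  have x: "x \<in> monoms n 1"
    using i by (simp add: x_def single_in_monoms)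
  have Var: "Var i = single x 1"
    by (simp add: Var_def x_def)
  let ?E = "monoms n (Suc d)" and ?R = "rows (Suc d)" and ?R\<^sub>1 = "(+) x ` rows d"
    and ?A = "macaulay_matrix f"
  have inj: "inj_on ((+) x) S" for S
    by (simp add: inj_on_def)
  have sub: "?R\<^sub>1 \<subseteq> ?R"
    using monoms_add [OF x, of _ "d - pdeg f"] d by (auto simp: Suc_diff_le)
  \<comment> \<open>A term with the least exponent of \<open>x\<^sub>i\<close>, which is positive if \<open>x\<^sub>i\<close> divides \<open>f\<close>.\<close>
  obtain m where m: "m \<in> keys f"
      and min: "\<And>m'. m' \<in> keys f \<Longrightarrow> lookup m i \<le> lookup m' i"
    using finite_maximizer [of "keys f" "\<lambda>m. - int (lookup m i)"]
      keys_nonempty by auto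
  let ?T = "(\<lambda>X. X + m) ` (?R - ?R\<^sub>1)"
  have no_factor: "lookup X i = 0" if X: "X \<in> ?R - ?R\<^sub>1" for X
  proof (rule ccontr)
    assume "lookup X i \<noteq> 0"
    then obtain X' where X': "X = x + X'"
      unfolding x_def by (rule monom_divide)
    have "X \<in> monoms n (1 + (d - pdeg f))"
      using X d by (simp add: Suc_diff_le)
    then have "X' \<in> rows d"
      unfolding X' monoms_add_iff [OF x] .
    then show False using X X' by blast
  qed
  have zero: "?A X t = 0" if X: "X \<in> ?R\<^sub>1" and t: "t \<in> ?T" for X t
  proof (rule ccontr)
    assume "?A X t \<noteq> 0"
    then obtain m' where m': "t = X + m'" "m' \<in> keys f"
      by (rule macaulay_matrix_nonzero)
    obtain X' where X': "X = x + X'" using X by blast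
    obtain Y where Y: "Y \<in> ?R - ?R\<^sub>1" "t = Y + m" using t by blast
    have "lookup (x + X' + m') i = lookup (Y + m) i"
      using m' X' Y by simp
    then show False
      using no_factor [OF Y(1)] min [OF m'(2)] by (simp add: lookup_add x_def)
  qed
  have block: "stable_sum ?R\<^sub>1 ?E ?A \<subseteq> stable_sum ?R ?E ?A"
  proof (rule stable_sum_block_subset [OF finite_monoms finite_monoms sub _ _ zero])
    show "?T \<subseteq> ?E"
      using translate_in_columns [OF m d(2)] by blast
    show "trop_minor (?R - ?R\<^sub>1) ?A ?T \<noteq> 0"
      by (rule minor_translate_nonzero [OF _ m]) (simp add: finite_monoms)
  qed
  have card_R\<^sub>1: "card ?R\<^sub>1 = card (rows d)"
    by (rule card_image [OF inj])
  have minor: "trop_minor ?R\<^sub>1 ?A ((+) x ` B) = minor d B" for B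
    by (simp add: trop_minor_reindex [OF finite_monoms inj inj] macaulay_matrix_shift)
  have "Var i * v \<in> stable_sum ?R\<^sub>1 ?E ?A"
    using v unfolding macaulay_part_eq [OF d(1)] stable_sum_def card_R\<^sub>1
  proof (induction rule: lin_space_induct)
    case zero
    show ?case by (simp add: lin_space_zero)
  next
    case (add u v)
    then show ?case by (simp add: distrib_left lin_space_add)
  next
    case (scale c v)
    have "Var i * scale c v = scale c (Var i * v)"
    proof -
      have "scale c g = single 0 c * g" for g :: "'s mpoly"
        unfolding scale_def by (rule mult_map_scale_conv_mult)
      then show ?thesis by (simp add: mult.left_commute)
    qed
    then show ?case using scale by (simp add: lin_space_scale)
  next
    case (cocircuit C)
    have xC: "(+) x ` C \<subseteq> ?E"
      using cocircuit monoms_add [OF x, of _ d] by auto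
    have "Var i * cocircuit_vector (monoms n d) (minor d) C =
        cocircuit_vector ?E (trop_minor ?R\<^sub>1 ?A) ((+) x ` C)" (is "?l = ?r")
    proof (rule poly_mapping_eqI)
      fix j
      show "lookup ?l j = lookup ?r j"
      proof (cases "\<exists>j'. j = x + j'")
        case True
        then obtain j' where j': "j = x + j'" ..
        have E: "j \<in> ?E \<longleftrightarrow> j' \<in> monoms n d"
          using monoms_add_iff [OF x, of j' d] j' by simp
        have C: "j \<in> (+) x ` C \<longleftrightarrow> j' \<in> C"
          using j' by auto
        have "insert j ((+) x ` C) = (+) x ` insert j' C"
          using j' by simp
        then have p: "trop_minor ?R\<^sub>1 ?A (insert j ((+) x ` C)) = minor d (insert j' C)"
          using minor [of "insert j' C"] by simp
        have l: "lookup ?l j = lookup (cocircuit_vector (monoms n d) (minor d) C) j'"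
          by (simp add: Var j' lookup_single_times)
        show ?thesis
          unfolding l lookup_cocircuit_vector [OF finite_monoms] using E C p by simp
      next
        case False
        then have "lookup ?l j = 0"
          unfolding Var using lookup_single_times_nonzero by blast
        moreover have "trop_minor ?R\<^sub>1 ?A (insert j ((+) x ` C)) = 0"
        proof (rule trop_minor_zero_column [of _ j])
          show "?A X j = 0" if "X \<in> ?R\<^sub>1" for X
          proof (rule ccontr)
            assume "?A X j \<noteq> 0"
            then obtain m' where "j = X + m'" by (rule macaulay_matrix_nonzero)
            with that False show False by (auto simp: add.assoc)
          qed
        qed (simp_all add: finite_monoms)
        ultimately show ?thesis
          by (simp add: lookup_cocircuit_vector [OF finite_monoms])
      qed
    qed
    moreover have "card ((+) x ` C) + 1 = card (rows d)"
      using cocircuit by (simp add: card_image [OF inj])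
    ultimately show ?case
      using cocircuit_in_lin_space [OF xC] by metis
  qed
  with block have "Var i * v \<in> stable_sum ?R ?E ?A" by blast
  then show ?thesis
    using d by (simp add: macaulay_part_def)
qed

lemma graded_part_macaulay_ideal: "graded_part n d (macaulay_ideal n f) = macaulay_part n f d"
  unfolding macaulay_ideal_def
  by (rule graded_part_graded_sum [OF macaulay_part_subset macaulay_part_zero])

lemma homogeneous_ideal_macaulay_ideal: "homogeneous_ideal n (macaulay_ideal n f)"
  unfolding macaulay_ideal_def
  by (rule homogeneous_ideal_graded_sum)
    (fact macaulay_part_subset, fact macaulay_part_submodule, rule macaulay_part_Var)

lemma tropical_ideal_macaulay_ideal: "tropical_ideal n (macaulay_ideal n f)"
  unfolding tropical_ideal_def graded_part_macaulay_ideal trop_linear_space_def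
proof (intro conjI allI)
  show "\<exists>r. trop_linear_space_of_rank (monoms n d) r (macaulay_part n f d)" for d
    using macaulay_part_rank [of d] by (rule exI)
qed (rule homogeneous_ideal_macaulay_ideal)

lemma hilbert_fun_macaulay_ideal:
  "hilbert_fun n (macaulay_ideal n f) d = num_monoms n (int d) - num_monoms n (int d - int (pdeg f))"
proof -
  have "int (if d < pdeg f then 0 else card (rows d)) = num_monoms n (int d - int (pdeg f))"
  proof (cases "d < pdeg f")
    case False
    then have "int d - int (pdeg f) = int (d - pdeg f)" by simp
    with False show ?thesis by (simp only: num_monoms_eq_card if_False)
  qed (simp add: num_monoms_def)
  then show ?thesis
    unfolding hilbert_fun_def graded_part_macaulay_ideal trop_rank_eq [OF macaulay_part_rank] by simp
qed

lemma macaulay_part_pdeg_cocircuit: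
  "cocircuit_vector (monoms n (pdeg f)) (minor (pdeg f)) {} = f"
proof (rule poly_mapping_eqI)
  fix j
  have "minor (pdeg f) {j} = lookup f j"
    by (simp add: monoms_zero trop_minor_singleton macaulay_matrix_def)
  moreover have "j \<in> monoms n (pdeg f)" if "lookup f j \<noteq> 0"
    using f_hom that by (auto simp: hom_polys_def in_keys_iff)
  ultimately show "lookup (cocircuit_vector (monoms n (pdeg f)) (minor (pdeg f)) {}) j =
      lookup f j"
    by (auto simp: lookup_cocircuit_vector [OF finite_monoms])
qed

lemma form_in_macaulay_part: "f \<in> macaulay_part n f (pdeg f)"
proof -
  have "cocircuit_vector (monoms n (pdeg f)) (minor (pdeg f)) {} \<in> macaulay_part n f (pdeg f)"
    unfolding macaulay_part_eq [OF order_refl]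
    by (rule cocircuit_in_lin_space) (simp_all add: monoms_zero)
  then show ?thesis by (simp only: macaulay_part_pdeg_cocircuit)
qed

lemma macaulay_part_pdeg_multiple:
  assumes "v \<in> macaulay_part n f (pdeg f)"
  obtains c where "v = scale c f"
proof -
  have "\<exists>c. v = scale c f"
    using assms unfolding macaulay_part_eq [OF order_refl]
  proof (induction rule: lin_space_induct)
    case zero
    have "0 = scale 0 f" by (rule poly_mapping_eqI) (simp add: lookup_scale)
    then show ?case ..
  next
    case (add u v)
    then obtain a b where "u = scale a f" "v = scale b f" by blast
    then have "u + v = scale (a + b) f"
      by (intro poly_mapping_eqI) (simp add: lookup_scale lookup_add distrib_right)
    then show ?case ..
  next
    case (scale c v)
    then show ?case by (auto simp: scale_scale)
  next
    case (cocircuit C)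
    then have "finite C" "card C = 0"
      using finite_subset [OF _ finite_monoms] by (auto simp: monoms_zero)
    then have "cocircuit_vector (monoms n (pdeg f)) (minor (pdeg f)) C = scale 1 f"
      using macaulay_part_pdeg_cocircuit by (simp add: scale_one)
    then show ?case ..
  qed
  then show thesis using that by blast
qed

lemma form_in_macaulay_ideal: "f \<in> macaulay_ideal n f"
proof -
  have "f \<in> graded_part n (pdeg f) (macaulay_ideal n f)"
    unfolding graded_part_macaulay_ideal by (rule form_in_macaulay_part)
  then show ?thesis by (simp add: graded_part_def)
qed

text \<open>
  A tropical ideal containing \<open>f\<close> contains all its monomial multiples, whose leading monomials are
  distinct. So its part in each degree has at least the rank of the part of the Macaulay ideal,
  and for tropical linear spaces inclusion together with equality of ranks implies equality.
\<close>

lemma macaulay_ideal_minimal: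
  assumes J: "tropical_ideal n J" and fJ: "f \<in> J" and sub: "J \<subseteq> macaulay_ideal n f"
  shows "J = macaulay_ideal n f"
proof (rule homogeneous_ideal_eqI)
  show hom: "homogeneous_ideal n J"
    using J by (simp add: tropical_ideal_def)
  show "homogeneous_ideal n (macaulay_ideal n f)"
    by (rule homogeneous_ideal_macaulay_ideal)
  fix d
  have subset: "graded_part n d J \<subseteq> macaulay_part n f d"
    using sub by (auto simp: graded_part_def simp flip: graded_part_macaulay_ideal)
  show "graded_part n d J = graded_part n d (macaulay_ideal n f)"
    unfolding graded_part_macaulay_ideal
  proof (cases "d < pdeg f")
    case True
    have "0 \<in> graded_part n d J"
      using hom by (simp add: graded_part_def homogeneous_ideal_def hom_polys_def)
    then show "graded_part n d J = macaulay_part n f d"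
      using subset True by (auto simp: macaulay_part_def)
  next
    case False
    then have d: "pdeg f \<le> d" by simp
    obtain s q where q: "valuated_matroid (monoms n d) s q" "graded_part n d J = lin_space (monoms n d) s q"
      using J unfolding tropical_ideal_def trop_linear_space_def trop_linear_space_of_rank_def by blast
    note p = minor_valuated_matroid [OF d]
    have le: "lin_space (monoms n d) s q \<subseteq> lin_space (monoms n d) (card (rows d)) (minor d)"
      using subset q(2) macaulay_part_eq [OF d] by simp
    obtain B where B: "B \<subseteq> monoms n d" "card B = s"
      and leading: "\<And>v i. v \<in> lin_space (monoms n d) s q \<Longrightarrow> lookup v i \<noteq> 0 \<Longrightarrow>
        (\<And>j. i < j \<Longrightarrow> lookup v j = 0) \<Longrightarrow> i \<in> B"
      using q(1) by (rule lin_space_leading_positions) blast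
    define m where "m = Max (keys f)"
    have m: "m \<in> keys f"
      using keys_nonempty by (simp add: m_def)
    have "(\<lambda>X. X + m) ` rows d \<subseteq> B"
    proof (rule image_subsetI)
      fix X assume X: "X \<in> rows d"
      let ?v = "single X 1 * f"
      have hom_X: "single X (1 :: 's) \<in> hom_polys n (d - pdeg f)"
        using X by (simp add: hom_polys_def)
      have "?v \<in> hom_polys n d"
        using hom_polys_mult [OF hom_X f_hom] d by simp
      moreover have "?v \<in> J"
        using hom fJ subsetD [OF hom_polys_subset_polys hom_X] by (simp add: homogeneous_ideal_def)
      ultimately have "?v \<in> lin_space (monoms n d) s q"
        by (simp add: graded_part_def flip: q(2))
      then show "X + m \<in> B"
      proof (rule leading)
        show "lookup ?v (X + m) \<noteq> 0"
          using m by (simp add: lookup_single_times in_keys_iff)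
        show "lookup ?v j = 0" if "X + m < j" for j
        proof (rule ccontr)
          assume "lookup ?v j \<noteq> 0"
          then obtain z where "j = X + z" "z \<in> keys f"
            by (rule lookup_single_times_nonzero)
          moreover from this have "z \<le> m"
            by (simp add: m_def)
          ultimately show False
            using that by simp
        qed
      qed
    qed
    then have "card ((\<lambda>X. X + m) ` rows d) \<le> s"
      using B finite_subset [OF _ finite_monoms] by (metis card_mono)
    moreover have "card ((\<lambda>X. X + m) ` rows d) = card (rows d)"
      by (rule card_image) (simp add: inj_on_def)
    moreover have "s \<le> card (rows d)"
      using lin_space_subset_rank [OF p q(1) le] .
    ultimately have "s = card (rows d)" by simp
    then show "graded_part n d J = macaulay_part n f d"
      unfolding q(2) macaulay_part_eq [OF d] using lin_space_subset_eq [OF p] q(1) le by blast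
  qed
qed

lemma tropically_principal_macaulay_ideal: "tropically_principal_over n (macaulay_ideal n f) f"
  unfolding tropically_principal_over_def
proof (intro conjI allI impI)
  show "tropical_ideal n (macaulay_ideal n f)"
    by (rule tropical_ideal_macaulay_ideal)
  show "f \<in> macaulay_ideal n f"
    by (rule form_in_macaulay_ideal)
  show "J = macaulay_ideal n f" if "tropical_ideal n J \<and> f \<in> J \<and> J \<subseteq> macaulay_ideal n f" for J
    using that by (intro macaulay_ideal_minimal) simp_all
qed

end


section \<open>The tropical variety of the Macaulay ideal\<close>

definition monom_value :: "(nat \<Rightarrow> 's::comm_semiring_1) \<Rightarrow> monom \<Rightarrow> 's"
  where "monom_value y m = (\<Prod>i\<in>keys m. y i ^ lookup m i)"

lemma monom_value_add: "monom_value y (m + m') = monom_value y m * monom_value y m'"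
proof -
  let ?S = "keys m \<union> keys m'"
  have extend: "monom_value y k = (\<Prod>i\<in>?S. y i ^ lookup k i)"
    if "keys k \<subseteq> ?S" for k
    unfolding monom_value_def by (rule prod.mono_neutral_left) (use that in \<open>auto simp: in_keys_iff\<close>)
  show ?thesis
    by (simp add: extend keys_add_monom lookup_add power_add prod.distrib)
qed

lemma vanishes_at_iff:
  "vanishes_at h y \<longleftrightarrow>
    (\<forall>m. lookup h m * monom_value y m \<noteq> 0 \<longrightarrow>
      (\<exists>m'. m' \<noteq> m \<and> lookup h m * monom_value y m \<le> lookup h m' * monom_value y m'))"
  (is "_ \<longleftrightarrow> (\<forall>m. ?t m \<noteq> 0 \<longrightarrow> (\<exists>m'. m' \<noteq> m \<and> ?t m \<le> ?t m'))")
proof -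
  have keys: "m \<in> keys h" if "?t m \<noteq> 0" for m
    using that by (auto simp: in_keys_iff)
  have "(\<exists>m'. m' \<noteq> m \<and> ?t m \<le> ?t m') \<longleftrightarrow> (\<exists>m'\<in>keys h. m' \<noteq> m \<and> ?t m \<le> ?t m')"
    if "?t m \<noteq> 0" for m
  proof -
    have "?t m' \<noteq> 0" if "?t m \<le> ?t m'" for m'
      using that \<open>?t m \<noteq> 0\<close> by (metis le_zero_eq)
    then show ?thesis using keys by blast
  qed
  then show ?thesis
    unfolding vanishes_at_def monom_value_def [symmetric] trop_vanishes_iff [OF finite_keys]
    using keys by blast
qed

lemma vanishes_at_add:
  assumes "vanishes_at g y" "vanishes_at h y"
  shows "vanishes_at (g + h) y"
  unfolding vanishes_at_iff
proof (intro allI impI)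
  let ?t = "\<lambda>h m. lookup h m * monom_value y m"
  fix m assume nz: "?t (g + h) m \<noteq> 0"
  have t: "?t (g + h) m = max (?t g m) (?t h m)" for m
    by (simp add: lookup_add distrib_right flip: add_eq_max)
  have ge: "?t g m \<le> ?t (g + h) m" "?t h m \<le> ?t (g + h) m" for m
    by (simp_all add: t)
  consider "?t (g + h) m = ?t g m" | "?t (g + h) m = ?t h m"
    unfolding t by (metis max_def)
  then show "\<exists>m'. m' \<noteq> m \<and> ?t (g + h) m \<le> ?t (g + h) m'"
  proof cases
    case 1
    then obtain m' where "m' \<noteq> m" "?t g m \<le> ?t g m'"
      using assms(1) nz unfolding vanishes_at_iff by metis
    then show ?thesis using 1 ge(1) [of m'] by (metis order_trans)
  next
    case 2
    then obtain m' where "m' \<noteq> m" "?t h m \<le> ?t h m'"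
      using assms(2) nz unfolding vanishes_at_iff by metis
    then show ?thesis using 2 ge(2) [of m'] by (metis order_trans)
  qed
qed

lemma vanishes_at_scale:
  assumes "vanishes_at g y"
  shows "vanishes_at (scale c g) y"
  unfolding vanishes_at_iff
proof (intro allI impI)
  fix m assume "lookup (scale c g) m * monom_value y m \<noteq> 0"
  then have "lookup g m * monom_value y m \<noteq> 0"
    by (auto simp: lookup_scale)
  then obtain m' where m': "m' \<noteq> m"
      "lookup g m * monom_value y m \<le> lookup g m' * monom_value y m'"
    using assms unfolding vanishes_at_iff by blast
  from mult_left_mono_semifield [OF m'(2), of c] m'(1)
  show "\<exists>m'. m' \<noteq> m \<and> lookup (scale c g) m * monom_value y m
      \<le> lookup (scale c g) m' * monom_value y m'"
    by (auto simp: lookup_scale mult.assoc)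
qed

lemma vanishes_at_zero: "vanishes_at 0 y"
  by (simp add: vanishes_at_iff)

context homogeneous_form
begin

text \<open>
  In the term of a cocircuit at the column \<open>j\<close>, the row \<open>x\<close> matched to \<open>j\<close> may be matched to
  \<open>x + c\<close> instead, where \<open>c\<close> is a term of \<open>f\<close> of maximal value at \<open>y\<close>. Rotating along the path with
  steps by \<open>c\<close> cannot decrease the value of the term, so if the path leaves the matched columns at
  \<open>k\<close>, the term at \<open>k\<close> is at least as large. The path must not close up. If it did, optimality of
  the matching would force every row on it to use a term of maximal value; when \<open>c\<close> is the
  largest or the smallest such term in the monomial order, the sum of the columns along the
  path shows that all of them use \<open>c\<close>, contrary to \<open>j \<noteq> x + c\<close>. As there are at least two terms of
  maximal value, one of the two extreme ones satisfies \<open>j \<noteq> x + c\<close>.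
\<close>

lemma macaulay_part_vanishes:
  assumes f_van: "vanishes_at f y" and v: "v \<in> macaulay_part n f d"
  shows "vanishes_at v y"
proof (cases "d < pdeg f")
  case True
  then show ?thesis using v by (simp add: macaulay_part_def vanishes_at_zero)
next
  case False
  then have d: "pdeg f \<le> d" by simp
  let ?E = "monoms n d" and ?A = "macaulay_matrix f" and ?ev = "monom_value y"
  define val where "val m = lookup f m * ?ev m" for m
  have finR: "finite (rows d)" by (rule finite_monoms)
  show ?thesis
    using v unfolding macaulay_part_eq [OF d]
  proof (induction rule: lin_space_induct)
    case (cocircuit C)
    have finC: "finite C"
      using cocircuit finite_subset [OF _ finite_monoms] by blast
    show ?case
      unfolding vanishes_at_iff
    proof (intro allI impI)
      let ?\<beta> = "lookup (cocircuit_vector ?E (minor d) C)"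
      fix j assume nz: "?\<beta> j * ?ev j \<noteq> 0"
      then have j: "j \<in> ?E - C" "minor d (insert j C) \<noteq> 0" "?ev j \<noteq> 0"
        by (auto simp: lookup_cocircuit_vector [OF finite_monoms] split: if_splits)
      obtain \<sigma> where \<sigma>: "bij_betw \<sigma> (rows d) (insert j C)"
          "minor d (insert j C) = (\<Prod>X\<in>rows d. ?A X (\<sigma> X))"
        using j(2) by (rule trop_minor_attained)
      have im: "\<sigma> ` rows d = insert j C" and inj: "inj_on \<sigma> (rows d)"
        using \<sigma>(1) by (auto simp: bij_betw_def)
      have A_nz: "?A X (\<sigma> X) \<noteq> 0" if "X \<in> rows d" for X
        using j(2) that unfolding \<sigma>(2) prod_eq_zero_iff_semifield [OF finR] by blast
      have "\<exists>m. \<sigma> X = X + m \<and> m \<in> keys f" if "X \<in> rows d" for X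
        using A_nz [OF that] by (rule macaulay_matrix_nonzero) blast
      then obtain t where t: "\<And>X. X \<in> rows d \<Longrightarrow> \<sigma> X = X + t X"
          and t_key: "\<And>X. X \<in> rows d \<Longrightarrow> t X \<in> keys f"
        by metis
      have A_t: "?A X (\<sigma> X) = lookup f (t X)" if "X \<in> rows d" for X
        unfolding t [OF that] by (rule macaulay_matrix_translate)
      have "j \<in> \<sigma> ` rows d" using im by simp
      then obtain x where x: "x \<in> rows d" "\<sigma> x = j" by auto
      have x_ev: "?ev x \<noteq> 0" "?ev (t x) \<noteq> 0"
        using j(3) t [OF x(1)] x(2) monom_value_add [of y x "t x"] by auto
      define F where "F = {m \<in> keys f. \<forall>m'\<in>keys f. val m' \<le> val m}"
      have finF: "finite F" by (simp add: F_def)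
      obtain m\<^sub>1 where m\<^sub>1: "m\<^sub>1 \<in> keys f"
          "\<And>m. m \<in> keys f \<Longrightarrow> val m \<le> val m\<^sub>1"
        using finite_maximizer [OF finite_keys keys_nonempty, of val] by blast
      have "val (t x) \<noteq> 0"
        using x_ev t_key [OF x(1)] by (simp add: val_def in_keys_iff)
      then have m\<^sub>1_nz: "val m\<^sub>1 \<noteq> 0"
        using m\<^sub>1(2) [OF t_key [OF x(1)]] by (metis le_zero_eq)
      then obtain m\<^sub>2 where m\<^sub>2: "m\<^sub>2 \<noteq> m\<^sub>1" "val m\<^sub>1 \<le> val m\<^sub>2"
        using f_van unfolding vanishes_at_iff val_def by blast
      have "val m\<^sub>2 \<noteq> 0"
        using m\<^sub>2 m\<^sub>1_nz by (metis le_zero_eq)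
      then have "m\<^sub>2 \<in> keys f"
        by (auto simp: val_def in_keys_iff)
      then have F12: "m\<^sub>1 \<in> F" "m\<^sub>2 \<in> F"
        using m\<^sub>1 m\<^sub>2(2) by (auto simp: F_def intro: order_trans)
      have "Min F \<noteq> Max F"
      proof
        assume "Min F = Max F"
        then have "m\<^sub>1 = m\<^sub>2"
          using F12 finF by (metis Max.coboundedI Min.coboundedI order_antisym)
        then show False using m\<^sub>2 by simp
      qed
      then obtain c where c: "c \<in> {Min F, Max F}" "j \<noteq> x + c"
        by (metis add_left_imp_eq insertCI)
      then have cF: "c \<in> F"
        using F12 finF Min_in Max_in by blast
      then have c_key: "c \<in> keys f" and c_max: "\<And>m. m \<in> keys f \<Longrightarrow> val m \<le> val c"
        by (auto simp: F_def)
      have c_ev: "?ev c \<noteq> 0"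
        using c_max [OF m\<^sub>1(1)] m\<^sub>1_nz by (metis le_zero_eq mult_zero_right val_def)
      \<comment> \<open>The path stays in rows whose monomial is nonzero at \<open>y\<close>, so that values can be cancelled.\<close>
      define R where "R = {X \<in> rows d. ?ev X \<noteq> 0}"
      have R: "finite R" "inj_on \<sigma> R" "inj_on (\<lambda>X. X + c) R" "x \<in> R"
        using finR inj x(1) x_ev(1) by (auto simp: R_def inj_on_def)
      have ev_shift: "?ev (X + c) \<noteq> 0" if "X \<in> R" for X
        using that c_ev by (simp add: R_def monom_value_add)
      have le: "lookup f (t X) * ?ev (\<sigma> X) \<le> lookup f c * ?ev (X + c)"
        if "X \<in> rows d" for X
      proof -
        have "val (t X) * ?ev X \<le> val c * ?ev X"
          using c_max [OF t_key [OF that]] by (rule mult_right_mono) simp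
        then show ?thesis
          by (simp add: val_def t [OF that] monom_value_add mult_ac)
      qed
      have split: "(\<Prod>X\<in>rows d. h X) = (\<Prod>X\<in>P. h X) * (\<Prod>X\<in>rows d - P. h X)"
        if "P \<subseteq> R" for P and h :: "monom \<Rightarrow> 's"
        using prod.subset_diff [of P "rows d" h] finR that by (simp add: R_def subset_iff mult.commute)
      let ?switch = "\<lambda>P X. if X \<in> P then X + c else \<sigma> X"
      have switch: "(\<Prod>X\<in>rows d. ?A X (?switch P X)) =
          (\<Prod>X\<in>P. lookup f c) * (\<Prod>X\<in>rows d - P. ?A X (\<sigma> X))" if "P \<subseteq> R" for P
        unfolding split [OF that] by (simp add: macaulay_matrix_translate)
      have keep: "minor d (insert j C) =
          (\<Prod>X\<in>P. lookup f (t X)) * (\<Prod>X\<in>rows d - P. ?A X (\<sigma> X))" if P: "P \<subseteq> R" for P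
      proof -
        have "(\<Prod>X\<in>P. ?A X (\<sigma> X)) = (\<Prod>X\<in>P. lookup f (t X))"
          by (rule prod.cong) (use P A_t in \<open>auto simp: R_def\<close>)
        then show ?thesis unfolding \<sigma>(2) split [OF P] by simp
      qed
      have rest_nz: "(\<Prod>X\<in>rows d - P. ?A X (\<sigma> X)) \<noteq> 0" for P
        using A_nz finR by (simp add: prod_eq_zero_iff_semifield)
      have card_C: "card (insert j C) = card (rows d)"
        using \<sigma>(1) by (metis bij_betw_same_card)
      from R show "\<exists>k. k \<noteq> j \<and> ?\<beta> j * ?ev j \<le> ?\<beta> k * ?ev k"
      proof (cases rule: matching_rotation)
        case (cycle P)
        have PR: "P \<subseteq> rows d" "finite P"
          using cycle(1) R(1) finite_subset by (auto simp: R_def)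
        have inj_P: "inj_on \<sigma> P" "inj_on (\<lambda>X. X + c) P"
          using inj_on_subset [OF R(2) cycle(1)] inj_on_subset [OF R(3) cycle(1)] .
        have "bij_betw (?switch P) (rows d) (insert j C)"
        proof (rule bij_betw_switch [OF finR PR(1) _ card_C])
          show "\<sigma> ` (rows d - P) \<union> (\<lambda>X. X + c) ` P = insert j C"
            unfolding cycle(3) im [symmetric] using PR(1) by blast
        qed
        from trop_minor_ge [OF finR this, of ?A]
        have "(\<Prod>X\<in>P. lookup f c) \<le> (\<Prod>X\<in>P. lookup f (t X))"
          unfolding switch [OF cycle(1)] keep [OF cycle(1)]
          using mult_le_cancel_semifield [OF rest_nz] by (simp add: mult.commute)
        moreover have ev: "(\<Prod>X\<in>P. ?ev (X + c)) = (\<Prod>X\<in>P. ?ev (\<sigma> X))"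
          using prod.reindex [OF inj_P(1), of ?ev] prod.reindex [OF inj_P(2), of ?ev] cycle(3) by simp
        ultimately have prod_le: "(\<Prod>X\<in>P. lookup f c * ?ev (X + c)) \<le>
            (\<Prod>X\<in>P. lookup f (t X) * ?ev (\<sigma> X))"
          unfolding prod.distrib by (intro mult_mono_semifield) simp_all
        have ev_nz: "?ev (\<sigma> X) \<noteq> 0" if "X \<in> P" for X
        proof -
          have "\<sigma> X \<in> (\<lambda>X. X + c) ` P" using that cycle(3) by blast
          then show ?thesis using ev_shift cycle(1) by auto
        qed
        have prod_nz: "(\<Prod>X\<in>P. lookup f (t X) * ?ev (\<sigma> X)) \<noteq> 0"
        proof -
          have "lookup f (t X) * ?ev (\<sigma> X) \<noteq> 0" if "X \<in> P" for X
            using ev_nz [OF that] t_key [of X] that PR(1) by (auto simp: in_keys_iff)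
          then show ?thesis
            unfolding prod_eq_zero_iff_semifield [OF PR(2)] by blast
        qed
        have t_F: "t X \<in> F" if X: "X \<in> P" for X
        proof -
          have Xr: "X \<in> rows d" "?ev X \<noteq> 0"
            using X cycle(1) by (auto simp: R_def)
          have "lookup f (t X) * ?ev (\<sigma> X) = lookup f c * ?ev (X + c)"
            by (rule prod_eq_imp_eq_semifield [OF PR(2) _ prod_le prod_nz X]) (use le PR in blast)
          then have "?ev X * val (t X) = ?ev X * val c"
            by (simp add: val_def t [OF Xr(1)] monom_value_add mult_ac)
          then have "val (t X) = val c"
            using Xr(2) by (simp add: mult_cancel_semifield)
          then show ?thesis using t_key [OF Xr(1)] c_max by (simp add: F_def)
        qed
        have "(\<Sum>X\<in>P. X + c) = (\<Sum>X\<in>P. \<sigma> X)"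
          using sum.reindex [OF inj_P(1), of id] sum.reindex [OF inj_P(2), of id] cycle(3) by simp
        also have "\<dots> = (\<Sum>X\<in>P. X + t X)"
          by (rule sum.cong) (use t PR in auto)
        finally have sum_eq: "(\<Sum>X\<in>P. c) = (\<Sum>X\<in>P. t X)"
          by (simp add: sum.distrib)
        have "t x = c"
        proof (cases "c = Max F")
          case True
          show ?thesis
            by (rule sum_mono_inv [OF sum_eq [symmetric] _ cycle(2) PR(2)])
              (use t_F finF True in simp)
        next
          case False
          then have "c = Min F" using c(1) by simp
          then show ?thesis
            by (intro sum_mono_inv [OF sum_eq _ cycle(2) PR(2), symmetric])
              (use t_F finF in simp)
        qed
        then show ?thesis using t [OF x(1)] x(2) c(2) by simp
      next
        case (path P k)
        have PR: "P \<subseteq> rows d" "finite P"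
          using path(1) R(1) finite_subset by (auto simp: R_def)
        have inj_P: "inj_on \<sigma> P" "inj_on (\<lambda>X. X + c) P"
          using inj_on_subset [OF R(2) path(1)] inj_on_subset [OF R(3) path(1)] .
        have k_in: "k \<in> (\<lambda>X. X + c) ` P" using path(4) by simp
        then have k_ev: "?ev k \<noteq> 0" using ev_shift path(1) by auto
        have kE: "k \<in> ?E"
          using k_in PR(1) translate_in_columns [OF c_key d] by blast
        have k_new: "k \<notin> insert j C"
        proof
          assume "k \<in> insert j C"
          then obtain X where X: "X \<in> rows d" "k = \<sigma> X" using im by auto
          then have "X \<in> R"
            using k_ev by (auto simp: R_def t monom_value_add)
          then show False using path(3) X by blast
        qed
        have j_in: "j \<in> \<sigma> ` P" using path(2) x(2) by blast
        have \<sigma>P: "\<sigma> ` P \<subseteq> insert j C" using im PR(1) by blast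
        have "bij_betw (?switch P) (rows d) (insert k C)"
        proof (rule bij_betw_switch [OF finR PR(1)])
          have "\<sigma> ` (rows d - P) = insert j C - \<sigma> ` P"
            using inj_on_image_set_diff [OF inj _ PR(1)] im by simp
          then show "\<sigma> ` (rows d - P) \<union> (\<lambda>X. X + c) ` P = insert k C"
            unfolding path(4) x(2) using \<sigma>P j_in j(1) by auto
          show "card (insert k C) = card (rows d)"
            using card_C k_new j(1) finC by simp
        qed
        from trop_minor_ge [OF finR this, of ?A]
        have k_ge: "(\<Prod>X\<in>P. lookup f c) * (\<Prod>X\<in>rows d - P. ?A X (\<sigma> X)) \<le> minor d (insert k C)"
          unfolding switch [OF path(1)] .
        let ?Z = "\<Prod>z\<in>\<sigma> ` P - {j}. ?ev z"
        have fin_\<sigma>P: "finite (\<sigma> ` P)" using PR(2) by simp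
        have Z_nz: "?Z \<noteq> 0"
        proof -
          have "?ev z \<noteq> 0" if "z \<in> \<sigma> ` P - {j}" for z
          proof -
            have "z \<in> (\<lambda>X. X + c) ` P" unfolding path(4) x(2) using that by blast
            then show ?thesis using ev_shift path(1) by auto
          qed
          then show ?thesis
            using prod_eq_zero_iff_semifield [of "\<sigma> ` P - {j}" ?ev] fin_\<sigma>P by blast
        qed
        have "(\<Prod>X\<in>P. ?ev (\<sigma> X)) = (\<Prod>z\<in>\<sigma> ` P. ?ev z)"
          by (simp add: prod.reindex [OF inj_P(1)])
        also have "\<dots> = ?ev j * ?Z"
          by (rule prod.remove [OF fin_\<sigma>P j_in])
        finally have ev_j: "(\<Prod>X\<in>P. ?ev (\<sigma> X)) = ?ev j * ?Z" .
        have "(\<Prod>X\<in>P. ?ev (X + c)) = (\<Prod>z\<in>insert k (\<sigma> ` P - {j}). ?ev z)"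
          using prod.reindex [OF inj_P(2), of ?ev] path(4) x(2) by simp
        also have "\<dots> = ?ev k * ?Z"
          using fin_\<sigma>P k_new \<sigma>P by (subst prod.insert) auto
        finally have ev_k: "(\<Prod>X\<in>P. ?ev (X + c)) = ?ev k * ?Z" .
        have "(\<Prod>X\<in>P. lookup f (t X) * ?ev (\<sigma> X)) \<le> (\<Prod>X\<in>P. lookup f c * ?ev (X + c))"
          by (rule prod_mono_semifield) (use le PR in blast)
        then have "?Z * ((\<Prod>X\<in>P. lookup f (t X)) * ?ev j) \<le>
            ?Z * ((\<Prod>X\<in>P. lookup f c) * ?ev k)"
          unfolding prod.distrib ev_j ev_k by (simp only: mult_ac)
        then have main: "(\<Prod>X\<in>P. lookup f (t X)) * ?ev j \<le> (\<Prod>X\<in>P. lookup f c) * ?ev k"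
          unfolding mult_le_cancel_semifield [OF Z_nz] .
        let ?Q = "\<Prod>X\<in>rows d - P. ?A X (\<sigma> X)"
        have "minor d (insert j C) * ?ev j = ?Q * ((\<Prod>X\<in>P. lookup f (t X)) * ?ev j)"
          unfolding keep [OF path(1)] by (simp only: mult_ac)
        also have "\<dots> \<le> ?Q * ((\<Prod>X\<in>P. lookup f c) * ?ev k)"
          using main by (rule mult_left_mono_semifield)
        also have "\<dots> = ((\<Prod>X\<in>P. lookup f c) * ?Q) * ?ev k"
          by (simp only: mult_ac)
        also have "\<dots> \<le> minor d (insert k C) * ?ev k"
          using k_ge by (rule mult_right_mono) simp
        finally have "?\<beta> j * ?ev j \<le> ?\<beta> k * ?ev k"
          using j(1) kE k_new by (simp add: lookup_cocircuit_vector [OF finite_monoms])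
        then show ?thesis using k_new by blast
      qed
    qed
  qed (auto intro: vanishes_at_zero vanishes_at_add vanishes_at_scale)
qed

lemma trop_variety_macaulay_ideal:
  "trop_variety n (macaulay_ideal n f) = trop_hypersurface n f"
proof (intro equalityI subsetI)
  fix P assume "P \<in> trop_variety n (macaulay_ideal n f)"
  moreover have "homogeneous f"
    using f_hom by (auto simp: homogeneous_def hom_polys_def monoms_def)
  ultimately show "P \<in> trop_hypersurface n f"
    using form_in_macaulay_ideal by (simp add: trop_variety_def)
next
  fix P assume P: "P \<in> trop_hypersurface n f"
  have "vanishes_at h y" if h: "h \<in> macaulay_ideal n f" "homogeneous h" and y: "y \<in> P" for h y
  proof (cases "h = 0")
    case True
    then show ?thesis by (simp add: vanishes_at_zero)
  next
    case False
    have "h \<in> polys n"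
      using homogeneous_ideal_macaulay_ideal h by (auto simp: homogeneous_ideal_def)
    then have "h \<in> graded_part n (pdeg h) (macaulay_ideal n f)"
      using h False homogeneous_imp_hom_polys by (simp add: graded_part_def)
    then have "h \<in> macaulay_part n f (pdeg h)"
      by (simp only: graded_part_macaulay_ideal)
    moreover have "vanishes_at f y"
      using P y by (simp add: trop_hypersurface_def)
    ultimately show ?thesis
      using macaulay_part_vanishes by blast
  qed
  then show "P \<in> trop_variety n (macaulay_ideal n f)"
    using P by (simp add: trop_variety_def trop_hypersurface_def)
qed

end


section \<open>Non-realizability\<close>

lemma lookup_trop_poly:
  assumes "nonarch_norm \<nu>"
  shows "lookup (trop_poly \<nu> F) m = \<nu> (lookup F m)"
proof -
  have "\<nu> 0 = 0" using assms by (simp add: nonarch_norm_def)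
  then show ?thesis
    unfolding trop_poly_def by transfer (simp add: when_def)
qed

lemma keys_trop_poly:
  assumes "nonarch_norm \<nu>"
  shows "keys (trop_poly \<nu> F) = keys F"
  using assms by (auto simp: in_keys_iff lookup_trop_poly nonarch_norm_def)

lemma graded_part_trop_of_ideal:
  fixes \<nu> :: "'k::field \<Rightarrow> trop"
  assumes "nonarch_norm \<nu>"
  shows "graded_part n d (trop_of_ideal n \<nu> I) = submodule_span (trop_poly \<nu> ` graded_part n d I)"
  unfolding trop_of_ideal_def
proof (rule graded_part_graded_sum)
  show "submodule_span (trop_poly \<nu> ` graded_part n d I) \<subseteq> hom_polys n d"
    by (rule span_minimal [OF _ is_submodule_hom_polys])
      (auto simp: graded_part_def hom_polys_def keys_trop_poly [OF assms])
qed (rule span_zero)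

lemma keys_mult_subset:
  fixes g h :: "'a::semiring_0 mpoly"
  assumes "keys g \<subseteq> S" "keys h \<subseteq> T"
  shows "keys (g * h) \<subseteq> {a + b |a b. a \<in> S \<and> b \<in> T}"
  using keys_mult [of g h] assms by blast

text \<open>
  Over any commutative ring, \<open>a\<^sup>3 + b\<^sup>3 + c\<^sup>3 - 3abc\<close> is a multiple of \<open>a + b + c\<close>. With \<open>a\<close> and \<open>b\<close> two
  terms of \<open>F\<close> and \<open>c\<close> the rest, this gives a multiple of \<open>F\<close> with few terms. It is nonzero if the
  square of the first of these terms is not also a product of other terms of \<open>F\<close>.
\<close>

lemma sparse_cubic_multiple:
  fixes F :: "'k::field mpoly"
  assumes t: "t1 \<in> keys F" "t2 \<in> keys F" "t1 \<noteq> t2"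
    and extreme: "\<And>p q. p \<in> keys F \<Longrightarrow> q \<in> keys F \<Longrightarrow> p + q = t1 + t1 \<Longrightarrow> p = t1"
    and F: "F \<in> hom_polys n e"
  obtains G where "G \<in> hom_polys n (2 * e)"
    "keys (F * G) \<subseteq> {t1 + t1 + t1, t2 + t2 + t2} \<union>
      {p + q + r |p q r. {p, q, r} \<subseteq> keys F - {t1, t2}} \<union>
      {t1 + t2 + q |q. q \<in> keys F - {t1, t2}}"
    "F * G \<noteq> 0"
proof -
  define K where "K = keys F - {t1, t2}"
  define a where "a = single t1 (lookup F t1)"
  define b where "b = single t2 (lookup F t2)"
  define c where "c = F - a - b"
  have F_eq: "F = a + b + c" by (simp add: c_def)
  have keys: "keys a \<subseteq> {t1}" "keys b \<subseteq> {t2}"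
    by (auto simp: a_def b_def)
  have keys_c: "keys c \<subseteq> K"
    using t(3) by (auto simp: c_def a_def b_def K_def in_keys_iff lookup_minus lookup_single when_def split: if_splits)
  have hom: "a \<in> hom_polys n e" "b \<in> hom_polys n e" "c \<in> hom_polys n e"
    using keys keys_c t F by (auto simp: hom_polys_def K_def)
  have closed: "u + v \<in> hom_polys n d" "u - v \<in> hom_polys n d"
    if "u \<in> hom_polys n d" "v \<in> hom_polys n d" for u v :: "'k mpoly" and d
    using that keys_add [of u v] keys_diff [of u v] by (auto simp: hom_polys_def)
  define G where "G = a * a + b * b + c * c - a * b - b * c - a * c"
  have "G \<in> hom_polys n (e + e)"
    unfolding G_def by (intro closed hom_polys_mult hom)
  then have "G \<in> hom_polys n (2 * e)" by (simp add: mult_2)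
  moreover have "keys (F * G) \<subseteq> {t1 + t1 + t1, t2 + t2 + t2} \<union>
      {p + q + r |p q r. {p, q, r} \<subseteq> K} \<union> {t1 + t2 + q |q. q \<in> K}"
  proof -
    have "F * G = a * a * a + b * b * b + c * c * c - (a * b * c + a * b * c + a * b * c)"
      unfolding F_eq G_def by (simp add: algebra_simps)
    moreover have "keys (u + v + w - (s + s + s)) \<subseteq>
        keys u \<union> keys v \<union> keys w \<union> keys s"
      for u v w s :: "'k mpoly"
    proof -
      have "keys (s + s + s) \<subseteq> keys s"
        using keys_add [of "s + s" s] keys_add [of s s] by blast
      then show ?thesis
        using keys_diff [of "u + v + w" "s + s + s"] keys_add [of "u + v" w] keys_add [of u v] by blast
    qed
    ultimately have FG: "keys (F * G) \<subseteq> keys (a * a * a) \<union>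
        keys (b * b * b) \<union> keys (c * c * c) \<union> keys (a * b * c)"
      by metis
    have "keys (a * a * a) \<subseteq> {t1 + t1 + t1, t2 + t2 + t2}"
      using keys_mult_subset [OF keys_mult_subset [OF keys(1) keys(1)] keys(1)] by auto
    moreover have "keys (b * b * b) \<subseteq> {t1 + t1 + t1, t2 + t2 + t2}"
      using keys_mult_subset [OF keys_mult_subset [OF keys(2) keys(2)] keys(2)] by auto
    ultimately have "keys (a * a * a) \<union> keys (b * b * b) \<subseteq>
        {t1 + t1 + t1, t2 + t2 + t2}"
      by (rule Un_least)
    moreover have "keys (c * c * c) \<subseteq> {p + q + r |p q r. {p, q, r} \<subseteq> K}"
      using keys_mult_subset [OF keys_mult_subset [OF keys_c keys_c] keys_c] by fastforce
    moreover have "keys (a * b * c) \<subseteq> {t1 + t2 + q |q. q \<in> K}"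
      using keys_mult_subset [OF keys_mult_subset [OF keys(1) keys(2)] keys_c] by auto
    ultimately show ?thesis
      by (intro order_trans [OF FG] Un_mono)
  qed
  moreover have "F * G \<noteq> 0"
  proof -
    have other: "lookup (u * w) (t1 + t1) = 0"
      if "keys u \<subseteq> keys F - {t1}" "keys w \<subseteq> keys F"
      for u w :: "'k mpoly"
    proof (rule ccontr)
      assume "\<not> ?thesis"
      then obtain p q where "t1 + t1 = p + q" "p \<in> keys u" "q \<in> keys w"
        using keys_mult [of u w] by (auto simp: in_keys_iff)
      then show False
        using extreme [of p q] that by auto
    qed
    have sub: "keys a \<subseteq> keys F" "keys b \<subseteq> keys F - {t1}"
        "keys c \<subseteq> keys F - {t1}"
      using keys keys_c t by (auto simp: K_def)
    then have sub': "keys b \<subseteq> keys F" "keys c \<subseteq> keys F"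
      by auto
    have "lookup G (t1 + t1) = lookup (a * a) (t1 + t1)"
      unfolding G_def lookup_minus lookup_add mult.commute [of a b] mult.commute [of a c]
      by (simp add: other [OF sub(2)] other [OF sub(3)] sub(1) sub')
    also have "\<dots> \<noteq> 0"
      using t(1) by (simp add: a_def mult_single in_keys_iff)
    finally have "G \<noteq> 0" by auto
    moreover have "F \<noteq> 0" using t(1) by auto
    ultimately show ?thesis by simp
  qed
  ultimately show thesis
    using \<open>G \<in> hom_polys n (2 * e)\<close> that [of G] unfolding K_def by simp
qed

text \<open>
  Each row \<open>X\<close> is matched to \<open>X + t1\<close> unless this column is to be avoided or is needed for another
  row. Only for rows that are products of two terms of \<open>f\<close> is there anything to do. Since every
  term has a variable of its own, products of terms behave like monomials in independent
  variables, and the columns used are told apart by the exponents of these variables.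
\<close>

lemma (in homogeneous_form) sparse_cubic_complement_basis:
  assumes t: "t1 \<in> keys f" "t2 \<in> keys f" "t3 \<in> keys f"
      "t1 \<noteq> t2" "t1 \<noteq> t3" "t2 \<noteq> t3"
    and own: "\<And>m. m \<in> keys f \<Longrightarrow>
      \<exists>i\<in>keys m. \<forall>m'\<in>keys f - {m}. i \<notin> keys m'"
    and d: "d = 3 * pdeg f"
  obtains B where "B \<subseteq> monoms n d" "card B = card (rows d)" "minor d B \<noteq> 0"
    "t1 + t1 + t1 \<notin> B" "t2 + t2 + t2 \<notin> B"
    "\<And>p q r. {p, q, r} \<subseteq> keys f - {t1, t2} \<Longrightarrow> p + q + r \<notin> B"
    "\<And>q. q \<in> keys f - {t1, t2} \<Longrightarrow> t1 + t2 + q \<notin> B"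
proof -
  define K where "K = keys f - {t1, t2}"
  obtain v where v: "\<And>m. m \<in> keys f \<Longrightarrow> v m \<in> keys m"
      "\<And>m m'. m \<in> keys f \<Longrightarrow> m' \<in> keys f - {m} \<Longrightarrow> v m \<notin> keys m'"
    using own by metis
  define ex where "ex m X = lookup X (v m)" for m X :: monom
  have ex_add: "ex m (X + Y) = ex m X + ex m Y" for m X Y
    by (simp add: ex_def lookup_add)
  have ex_self: "ex m m > 0" if "m \<in> keys f" for m
    using v(1) [OF that] by (simp add: ex_def in_keys_iff)
  have ex_other: "ex m m' = 0" if "m \<in> keys f" "m' \<in> keys f" "m' \<noteq> m" for m m'
    using v(2) [OF that(1), of m'] that by (simp add: ex_def in_keys_iff)
  have ex_K: "ex t1 q = 0" "ex t2 q = 0" if "q \<in> K" for q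
    using that t by (auto simp: K_def intro: ex_other)
  have ex12: "ex t1 t1 > 0" "ex t2 t2 > 0" "ex t1 t2 = 0" "ex t2 t1 = 0"
    using t ex_self ex_other by auto
  have neq: "X \<noteq> Y" if "ex m X \<noteq> ex m Y" for m X Y
    using that by auto
  have t3K: "t3 \<in> K" using t by (simp add: K_def)
  \<comment> \<open>Here \<open>X - t2\<close> is the term \<open>q\<close> with \<open>X = t2 + q\<close>.\<close>
  define c where "c X = (if X = t1 + t1 \<or> X = t1 + t2 then t2 else if X = t2 + t2 then t3
    else if \<exists>q\<in>K. X = t2 + q then X - t2 else t1)" for X
  have kind: thesis
    if "X = t1 + t1 \<Longrightarrow> c X = t2 \<Longrightarrow> thesis" "X = t1 + t2 \<Longrightarrow> c X = t2 \<Longrightarrow> thesis"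
      "X = t2 + t2 \<Longrightarrow> c X = t3 \<Longrightarrow> thesis" "\<And>q. q \<in> K \<Longrightarrow> X = t2 + q \<Longrightarrow> c X = q \<Longrightarrow> thesis"
      "c X = t1 \<Longrightarrow> X \<noteq> t1 + t1 \<Longrightarrow> X \<noteq> t1 + t2 \<Longrightarrow> X \<noteq> t2 + t2 \<Longrightarrow>
        (\<And>q. q \<in> K \<Longrightarrow> X \<noteq> t2 + q) \<Longrightarrow> thesis" for X thesis
  proof (cases "X = t1 + t1 \<or> X = t1 + t2")
    case True
    then have "c X = t2" by (simp add: c_def)
    with True that show ?thesis by blast
  next
    case not1: False
    show ?thesis
    proof (cases "X = t2 + t2")
      case True
      with not1 have "c X = t3" by (simp add: c_def)
      with True that(3) show ?thesis by blast
    next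
      case not2: False
      show ?thesis
      proof (cases "\<exists>q\<in>K. X = t2 + q")
        case True
        then obtain q where q: "q \<in> K" "X = t2 + q" by blast
        with not1 not2 have "c X = q" by (auto simp: c_def)
        with q that(4) show ?thesis by blast
      next
        case False
        with not1 not2 have "c X = t1" by (simp add: c_def)
        with False not1 not2 that(5) show ?thesis by blast
      qed
    qed
  qed
  let ?W = "\<lambda>X. X + c X"
  have t1_cancel: "X = Y" if "X + t1 = Y + t1" for X Y
    using that by simp
  have default: "c Y = t1"
    if eq: "?W X = ?W Y" and cX: "c X = t1" and X: "X \<noteq> t1 + t2" "X \<noteq> t2 + t2" for X Y
  proof -
    have e1: "ex t1 X + ex t1 t1 = ex t1 Y + ex t1 (c Y)"
      using eq cX by (metis ex_add)
    show ?thesis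
    proof (rule kind [of Y])
      assume "Y = t1 + t1" "c Y = t2"
      then have "X + t1 = (t1 + t2) + t1"
        using eq cX by (simp add: add_ac)
      then show ?thesis using X t1_cancel by blast
    next
      assume "Y = t1 + t2" "c Y = t2"
      then have "X + t1 = (t2 + t2) + t1"
        using eq cX by (simp add: add_ac)
      then show ?thesis using X t1_cancel by blast
    next
      assume "Y = t2 + t2" "c Y = t3"
      then show ?thesis using e1 ex12 ex_K [OF t3K] by (simp add: ex_add)
    next
      fix q assume "q \<in> K" "Y = t2 + q" "c Y = q"
      then show ?thesis using e1 ex12 ex_K [of q] by (simp add: ex_add)
    qed
  qed
  have special: "c X = c Y"
    if eq: "?W X = ?W Y" and cX: "c X \<noteq> t1" and cY: "c Y \<noteq> t1" for X Y
  proof -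
    have e1: "ex t1 X + ex t1 (c X) = ex t1 Y + ex t1 (c Y)"
      and e2: "ex t2 X + ex t2 (c X) = ex t2 Y + ex t2 (c Y)"
      using eq by (metis ex_add)+
    \<comment> \<open>The exponents of the column tell which of the special cases applies to its row.\<close>
    have profile: "ex t1 Z + ex t1 (c Z) > 0 \<and> c Z = t2 \<or>
        ex t1 Z + ex t1 (c Z) = 0 \<and> ex t2 Z + ex t2 (c Z) = 2 * ex t2 t2 \<and> c Z = t3 \<or>
        ex t1 Z + ex t1 (c Z) = 0 \<and> ex t2 Z + ex t2 (c Z) = ex t2 t2 \<and> c Z \<in> K \<and> Z = t2 + c Z"
      if "c Z \<noteq> t1" for Z
    proof (rule kind [of Z])
      fix q assume "q \<in> K" "Z = t2 + q" "c Z = q"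
      then show ?thesis using ex12 ex_K [of q] by (simp add: ex_add)
    qed (use that ex12 ex_K [OF t3K] in \<open>simp_all add: ex_add\<close>)
    consider "c X = t2" "c Y = t2" | "c X = t3" "c Y = t3"
      | "c X \<in> K" "X = t2 + c X" "c Y \<in> K" "Y = t2 + c Y"
      using profile [OF cX] profile [OF cY] e1 e2 ex12(2) by linarith
    then show ?thesis
    proof cases
      case 3
      let ?q = "c X"
      show ?thesis
      proof (rule ccontr)
        assume "?q \<noteq> c Y"
        then have "ex ?q (c Y) = 0" "ex ?q t2 = 0" "ex ?q ?q > 0"
          using 3 t by (auto simp: K_def intro: ex_other ex_self)
        moreover have "ex ?q (t2 + ?q + ?q) = ex ?q (t2 + c Y + c Y)"
          using eq 3(2,4) by metis
        ultimately show False by (simp add: ex_add)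
      qed
    qed simp_all
  qed
  have inj: "inj_on ?W R" for R
  proof (rule inj_onI)
    fix X Y assume eq: "?W X = ?W Y"
    have not5: "c Z \<noteq> t1 \<or> Z \<noteq> t1 + t2 \<and> Z \<noteq> t2 + t2" for Z
      by (rule kind [of Z]) (use t in \<open>auto simp: K_def\<close>)
    have "c X = c Y"
      using default [OF eq] default [OF eq [symmetric]] special [OF eq] not5 [of X] not5 [of Y] by metis
    then show "X = Y" using eq by simp
  qed
  have c_key: "c X \<in> keys f" for X
    by (rule kind [of X]) (use t in \<open>auto simp: K_def\<close>)
  have le: "pdeg f \<le> d" using d by simp
  let ?B = "?W ` rows d"
  have avoid: "Z \<notin> ?B"
    if Z: "Z \<noteq> t1 + t1 + t2" "Z \<noteq> t1 + t2 + t2" "Z \<noteq> t2 + t2 + t3" "\<And>q. q \<in> K \<Longrightarrow> Z \<noteq> t2 + q + q"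
      and default: "\<And>X. Z = X + t1 \<Longrightarrow> X = t1 + t1 \<or> (\<exists>q\<in>K. X = t2 + q)" for Z
  proof
    assume "Z \<in> ?B"
    then obtain X where X: "Z = X + c X" by blast
    show False
    proof (rule kind [of X])
      assume "X = t1 + t1" "c X = t2" then show False using X Z(1) by simp
    next
      assume "X = t1 + t2" "c X = t2" then show False using X Z(2) by simp
    next
      assume "X = t2 + t2" "c X = t3" then show False using X Z(3) by simp
    next
      fix q assume "q \<in> K" "X = t2 + q" "c X = q" then show False using X Z(4) by simp
    next
      assume "c X = t1" "X \<noteq> t1 + t1" "\<And>q. q \<in> K \<Longrightarrow> X \<noteq> t2 + q"
      then show False using X default [of X] by metis
    qed
  qed
  have t1_factor: "ex t1 (X + t1) > 0" for X
    using ex12 by (simp add: ex_add)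
  show thesis
  proof
    show "?B \<subseteq> monoms n d"
      by (rule image_subsetI) (rule translate_in_columns [OF c_key le])
    show "card ?B = card (rows d)"
      by (rule card_image [OF inj])
    show "minor d ?B \<noteq> 0"
      by (rule minor_matching_nonzero [OF finite_monoms inj c_key])
    show "t1 + t1 + t1 \<notin> ?B"
    proof (rule avoid)
      show "t1 + t1 + t1 \<noteq> t1 + t1 + t2" "t1 + t1 + t1 \<noteq> t1 + t2 + t2" "t1 + t1 + t1 \<noteq> t2 + t2 + t3"
        using ex12 ex_K [OF t3K] by (auto intro!: neq [of t2] simp: ex_add)
      show "t1 + t1 + t1 \<noteq> t2 + q + q" if "q \<in> K" for q
        using ex12 ex_K [OF that] by (auto intro!: neq [of t2] simp: ex_add)
    qed auto
    show "t2 + t2 + t2 \<notin> ?B"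
    proof (rule avoid)
      show "t2 + t2 + t2 \<noteq> t1 + t1 + t2" "t2 + t2 + t2 \<noteq> t1 + t2 + t2" "t2 + t2 + t2 \<noteq> t2 + t2 + t3"
        using ex12 ex_K [OF t3K] by (auto intro!: neq [of t2] simp: ex_add)
      show "t2 + t2 + t2 \<noteq> t2 + q + q" if "q \<in> K" for q
        using ex12 ex_K [OF that] by (auto intro!: neq [of t2] simp: ex_add)
      show "X = t1 + t1 \<or> (\<exists>q\<in>K. X = t2 + q)" if "t2 + t2 + t2 = X + t1" for X
        using t1_factor [of X] ex12 unfolding that [symmetric] by (simp add: ex_add)
    qed
    show "p + q + r \<notin> ?B" if "{p, q, r} \<subseteq> keys f - {t1, t2}" for p q r
    proof -
      have pqr: "p \<in> K" "q \<in> K" "r \<in> K" using that by (auto simp: K_def)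
      note zero = ex_K [OF pqr(1)] ex_K [OF pqr(2)] ex_K [OF pqr(3)]
      show ?thesis
      proof (rule avoid)
        show "p + q + r \<noteq> t1 + t1 + t2" "p + q + r \<noteq> t1 + t2 + t2" "p + q + r \<noteq> t2 + t2 + t3"
          using ex12 zero by (auto intro!: neq [of t2] simp: ex_add)
        show "p + q + r \<noteq> t2 + s + s" if "s \<in> K" for s
          using ex12 zero by (auto intro!: neq [of t2] simp: ex_add)
        show "X = t1 + t1 \<or> (\<exists>q\<in>K. X = t2 + q)" if "p + q + r = X + t1" for X
          using t1_factor [of X] zero unfolding that [symmetric] by (simp add: ex_add)
      qed
    qed
    show "t1 + t2 + q \<notin> ?B" if "q \<in> keys f - {t1, t2}" for q
    proof -
      have q: "q \<in> K" using that by (simp add: K_def)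
      note zero = ex_K [OF q]
      show ?thesis
      proof (rule avoid)
        show "t1 + t2 + q \<noteq> t1 + t1 + t2"
          using ex12 zero by (auto intro!: neq [of t1] simp: ex_add)
        show "t1 + t2 + q \<noteq> t1 + t2 + t2" "t1 + t2 + q \<noteq> t2 + t2 + t3"
          using ex12 zero by (auto intro!: neq [of t2] simp: ex_add)
        show "t1 + t2 + q \<noteq> t2 + s + s" if "s \<in> K" for s
          using ex12 zero ex_K [OF that] by (auto intro!: neq [of t1] simp: ex_add)
        show "X = t1 + t1 \<or> (\<exists>q\<in>K. X = t2 + q)" if "t1 + t2 + q = X + t1" for X
        proof -
          have "(t2 + q) + t1 = X + t1" using that by (simp add: add_ac)
          then show ?thesis using q t1_cancel by blast
        qed
      qed
    qed
  qed
qed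

text \<open>
  A realization contains a polynomial \<open>F\<close> with the same terms as \<open>f\<close>. The sparse multiple of \<open>F\<close>
  yields a nonzero vector of a Macaulay tropical linear space that vanishes on a basis, which is
  impossible.
\<close>

lemma macaulay_ideal_not_realizable:
  fixes f :: "trop mpoly"
  assumes form: "homogeneous_form n f" and card: "card (keys f) \<ge> 3"
    and own: "\<And>m. m \<in> keys f \<Longrightarrow>
      \<exists>i\<in>keys m. \<forall>m'\<in>keys f - {m}. i \<notin> keys m'"
  shows "\<not> realizable_over TYPE('k::field) n (macaulay_ideal n f)"
proof
  interpret homogeneous_form n f by (rule form)
  assume "realizable_over TYPE('k) n (macaulay_ideal n f)"
  then obtain \<nu> :: "'k \<Rightarrow> trop" and I
    where \<nu>: "nonarch_norm \<nu>" and I: "homogeneous_ideal n I" and eq: "macaulay_ideal n f = trop_of_ideal n \<nu> I"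
    unfolding realizable_over_def by blast
  have part: "macaulay_part n f d = submodule_span (trop_poly \<nu> ` graded_part n d I)" for d
    using graded_part_trop_of_ideal [OF \<nu>, of n d I] by (simp add: graded_part_macaulay_ideal flip: eq)
  have trop_in: "trop_poly \<nu> F \<in> macaulay_part n f d" if "F \<in> graded_part n d I" for F d
    unfolding part by (rule span_base) (use that in blast)
  let ?e = "pdeg f"
  have "\<exists>F\<in>graded_part n ?e I. F \<noteq> 0"
  proof (rule ccontr)
    assume "\<not> ?thesis"
    then have "trop_poly \<nu> ` graded_part n ?e I \<subseteq> {0}"
      using keys_trop_poly [OF \<nu>] by (metis image_subsetI keys_eq_empty keys_zero singletonI)
    moreover have "is_submodule ({0} :: trop mpoly set)"
      by (auto simp: is_submodule_iff poly_mapping_eq_iff fun_eq_iff lookup_scale)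
    ultimately have "macaulay_part n f ?e \<subseteq> {0}"
      unfolding part by (rule span_minimal)
    then show False
      using form_in_macaulay_part f_nonzero by blast
  qed
  then obtain F where F: "F \<in> graded_part n ?e I" "F \<noteq> 0" by blast
  obtain a where a: "trop_poly \<nu> F = scale a f"
    using trop_in [OF F(1)] by (rule macaulay_part_pdeg_multiple)
  have "a \<noteq> 0"
  proof
    assume "a = 0"
    then have "trop_poly \<nu> F = 0"
      unfolding a by (intro poly_mapping_eqI) (simp add: lookup_scale)
    then show False
      using F(2) keys_trop_poly [OF \<nu>, of F] by (metis keys_eq_empty keys_zero)
  qed
  then have keys_F: "keys F = keys f"
    unfolding keys_trop_poly [OF \<nu>, of F, symmetric] a by (auto simp: in_keys_iff lookup_scale)
  obtain t1 t2 t3 where t: "t1 \<in> keys f" "t2 \<in> keys f" "t3 \<in> keys f"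
      "t1 \<noteq> t2" "t1 \<noteq> t3" "t2 \<noteq> t3"
  proof -
    obtain S where "S \<subseteq> keys f" "card S = 3"
      using obtain_subset_with_card_n [OF card] by metis
    then show thesis
      using that by (auto simp: card_3_iff)
  qed
  have F_hom: "F \<in> hom_polys n ?e" and F_I: "F \<in> I"
    using F(1) by (auto simp: graded_part_def)
  obtain G where G: "G \<in> hom_polys n (2 * ?e)"
    and keys_FG: "keys (F * G) \<subseteq> {t1 + t1 + t1, t2 + t2 + t2} \<union>
      {p + q + r |p q r. {p, q, r} \<subseteq> keys f - {t1, t2}} \<union>
      {t1 + t2 + q |q. q \<in> keys f - {t1, t2}}"
    and FG_nz: "F * G \<noteq> 0"
  proof (rule sparse_cubic_multiple [OF _ _ t(4) _ F_hom])
    show "p = t1" if "p \<in> keys F" "q \<in> keys F" "p + q = t1 + t1" for p q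
    proof (rule ccontr)
      assume "p \<noteq> t1"
      obtain i where i: "i \<in> keys t1" "\<forall>m\<in>keys f - {t1}. i \<notin> keys m"
        using own [OF t(1)] by blast
      then have "i \<notin> keys p" "q = t1 \<or> i \<notin> keys q"
        using that \<open>p \<noteq> t1\<close> keys_F by blast+
      then have "lookup p i = 0" "q = t1 \<or> lookup q i = 0"
        by (simp_all add: in_keys_iff)
      moreover have "lookup p i + lookup q i = 2 * lookup t1 i"
        using that(3) by (simp add: mult_2 flip: lookup_add)
      ultimately show False
        using i(1) by (auto simp: in_keys_iff)
    qed
  qed (use t keys_F in auto)
  let ?d = "3 * ?e"
  obtain B where B: "B \<subseteq> monoms n ?d" "card B = card (rows ?d)" "minor ?d B \<noteq> 0"
    and avoid: "t1 + t1 + t1 \<notin> B" "t2 + t2 + t2 \<notin> B"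
    "\<And>p q r. {p, q, r} \<subseteq> keys f - {t1, t2} \<Longrightarrow> p + q + r \<notin> B"
    "\<And>q. q \<in> keys f - {t1, t2} \<Longrightarrow> t1 + t2 + q \<notin> B"
    by (rule sparse_cubic_complement_basis [OF t own refl]) blast+
  have "G * F \<in> I"
    using I F_I subsetD [OF hom_polys_subset_polys G] by (simp add: homogeneous_ideal_def)
  moreover have "F * G \<in> hom_polys n ?d"
    using hom_polys_mult [OF F_hom G] by simp
  ultimately have "F * G \<in> graded_part n ?d I"
    by (simp add: graded_part_def mult.commute)
  then have "trop_poly \<nu> (F * G) \<in> macaulay_part n f ?d"
    by (rule trop_in)
  moreover have le: "?e \<le> ?d" by simp
  ultimately have in_part: "trop_poly \<nu> (F * G) \<in> lin_space (monoms n ?d) (card (rows ?d)) (minor ?d)"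
    by (simp only: macaulay_part_eq)
  have "trop_poly \<nu> (F * G) \<noteq> 0"
    using FG_nz keys_trop_poly [OF \<nu>, of "F * G"] by (metis keys_eq_empty)
  then obtain b where "b \<in> B" "lookup (trop_poly \<nu> (F * G)) b \<noteq> 0"
    by (rule lin_space_meets_basis [OF minor_valuated_matroid [OF le] B in_part])
  then have b: "b \<in> B" "b \<in> keys (F * G)"
    by (simp_all add: in_keys_iff flip: keys_trop_poly [OF \<nu>])
  from subsetD [OF keys_FG b(2)] show False
  proof (elim UnE)
    assume "b \<in> {t1 + t1 + t1, t2 + t2 + t2}"
    then show False using avoid(1,2) b(1) by auto
  next
    assume "b \<in> {p + q + r |p q r. {p, q, r} \<subseteq> keys f - {t1, t2}}"
    then obtain p q r where "b = p + q + r" "{p, q, r} \<subseteq> keys f - {t1, t2}" by blast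
    then show False using avoid(3) b(1) by simp
  next
    assume "b \<in> {t1 + t2 + q |q. q \<in> keys f - {t1, t2}}"
    then obtain q where "b = t1 + t2 + q" "q \<in> keys f - {t1, t2}" by blast
    then show False using avoid(4) b(1) by simp
  qed
qed


section \<open>Cocircuits over the Boolean semifield\<close>

lemma boolean_nonzero_iff: "a \<noteq> 0 \<longleftrightarrow> a = 1" for a :: boolean
  by (cases a) (simp_all add: zero_boolean_def one_boolean_def)

lemma lookup_indicator_vector:
  assumes "finite C"
  shows "lookup (indicator_vector C) i = (if i \<in> C then 1 else 0)"
  using assms by (simp add: indicator_vector_def lookup_sum lookup_single when_def)

lemma cocircuits_iff:
  assumes "\<B> \<subseteq> Pow E"
  shows "D \<in> cocircuits E \<B> \<longleftrightarrow>
    D \<subseteq> E \<and> (\<forall>B\<in>\<B>. D \<inter> B \<noteq> {}) \<and> (\<forall>D'. D' \<subset> D \<longrightarrow> (\<exists>B\<in>\<B>. D' \<inter> B = {}))"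
proof -
  have dep: "D \<in> dependent_sets E ((\<lambda>B. E - B) ` \<B>) \<longleftrightarrow> D \<subseteq> E \<and> (\<forall>B\<in>\<B>. D \<inter> B \<noteq> {})" for D
    by (auto simp: dependent_sets_def)
  have "D' \<notin> dependent_sets E ((\<lambda>B. E - B) ` \<B>) \<longleftrightarrow> (\<exists>B\<in>\<B>. D' \<inter> B = {})"
    if "D \<subseteq> E" "D' \<subset> D" for D'
    using that unfolding dep by auto
  then show ?thesis
    unfolding cocircuits_def circuits_def mem_Collect_eq by (simp only: dep cong: conj_cong imp_cong) metis
qed

text \<open>
  Over the Boolean semifield a valuated matroid is its set of bases, and the nonzero cocircuits
  are the indicator vectors of the minimal sets meeting all bases. Given such a set \<open>D\<close> and
  \<open>k \<in> D\<close>, minimality provides a basis that meets \<open>D\<close> in \<open>k\<close> only, and this basis without \<open>k\<close>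
  indexes the cocircuit with support \<open>D\<close>.
\<close>

lemma lin_space_eq_span_cocircuits:
  fixes p :: "'e set \<Rightarrow> boolean"
  assumes vm: "valuated_matroid E r p" and bases: "\<B> = {B. B \<subseteq> E \<and> card B = r \<and> p B \<noteq> 0}"
  shows "lin_space E r p = submodule_span (indicator_vector ` cocircuits E \<B>)"
proof -
  have fin: "finite E" using vm by (rule valuated_matroid_finite)
  have sub: "\<B> \<subseteq> Pow E" by (auto simp: bases)
  define supp where "supp C = {j \<in> E - C. p (insert j C) \<noteq> 0}" for C
  have vector: "cocircuit_vector E p C = indicator_vector (supp C)" for C
  proof (rule poly_mapping_eqI)
    fix j
    have "finite (supp C)" using fin by (simp add: supp_def)
    then show "lookup (cocircuit_vector E p C) j = lookup (indicator_vector (supp C)) j"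
      by (auto simp: lookup_cocircuit_vector [OF fin] lookup_indicator_vector supp_def
          simp flip: boolean_nonzero_iff)
  qed
  have insert_basis: "insert j C \<in> \<B>" if "j \<in> supp C" "C \<subseteq> E" "card C + 1 = r" for j C
    using that finite_subset [OF that(2) fin] by (auto simp: bases supp_def)
  have supp_meets: "supp C \<inter> B \<noteq> {}"
    if C: "supp C \<noteq> {}" "C \<subseteq> E" "card C + 1 = r" and BB: "B \<in> \<B>" for C B
  proof -
    have in_L: "cocircuit_vector E p C \<in> lin_space E r p"
      using C(2,3) by (rule cocircuit_in_lin_space)
    obtain i where "i \<in> supp C" using C(1) by blast
    then have "lookup (cocircuit_vector E p C) i \<noteq> 0"
      by (auto simp: lookup_cocircuit_vector [OF fin] supp_def)
    then have nz: "cocircuit_vector E p C \<noteq> 0" by auto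
    have B: "B \<subseteq> E" "card B = r" "p B \<noteq> 0" using BB by (auto simp: bases)
    obtain b where "b \<in> B" "lookup (cocircuit_vector E p C) b \<noteq> 0"
      by (rule lin_space_meets_basis [OF vm B in_L nz])
    then have "b \<in> B \<inter> supp C"
      by (auto simp: lookup_cocircuit_vector [OF fin] supp_def split: if_splits)
    then show ?thesis by blast
  qed
  show ?thesis
    unfolding lin_space_def
  proof (rule span_eqI)
    show "{cocircuit_vector E p C |C. C \<subseteq> E \<and> card C + 1 = r} \<subseteq>
        submodule_span (indicator_vector ` cocircuits E \<B>)"
    proof
      fix v assume "v \<in> {cocircuit_vector E p C |C. C \<subseteq> E \<and> card C + 1 = r}"
      then obtain C where v: "v = cocircuit_vector E p C" and C: "C \<subseteq> E" "card C + 1 = r" by blast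
      show "v \<in> submodule_span (indicator_vector ` cocircuits E \<B>)"
      proof (cases "supp C = {}")
        case True
        then have "v = 0" by (simp add: v vector indicator_vector_def)
        then show ?thesis by (simp only: span_zero)
      next
        case False
        have "supp C \<in> cocircuits E \<B>"
          unfolding cocircuits_iff [OF sub]
        proof (intro conjI ballI allI impI)
          show "supp C \<subseteq> E" by (auto simp: supp_def)
          show "supp C \<inter> B \<noteq> {}" if "B \<in> \<B>" for B
            using supp_meets False C that by blast
          fix D assume "D \<subset> supp C"
          then obtain k where k: "k \<in> supp C" "k \<notin> D" by blast
          have "D \<inter> insert k C = {}"
            using k \<open>D \<subset> supp C\<close> by (auto simp: supp_def)
          then show "\<exists>B\<in>\<B>. D \<inter> B = {}"
            using insert_basis [OF k(1) C] by blast
        qed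
        then show ?thesis
          unfolding v vector by (intro span_base imageI)
      qed
    qed
    show "indicator_vector ` cocircuits E \<B> \<subseteq>
        submodule_span {cocircuit_vector E p C |C. C \<subseteq> E \<and> card C + 1 = r}"
    proof (rule image_subsetI)
      fix D assume "D \<in> cocircuits E \<B>"
      then have D: "D \<subseteq> E" "\<And>B. B \<in> \<B> \<Longrightarrow> D \<inter> B \<noteq> {}" "\<And>D'. D' \<subset> D \<Longrightarrow> \<exists>B\<in>\<B>. D' \<inter> B = {}"
        unfolding cocircuits_iff [OF sub] by auto
      obtain B\<^sub>0 where "B\<^sub>0 \<in> \<B>"
        using valuated_matroid_basis [OF vm] by (auto simp: bases)
      then obtain k where k: "k \<in> D" using D(2) by blast
      then obtain B where B: "B \<in> \<B>" "(D - {k}) \<inter> B = {}"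
        using D(3) [of "D - {k}"] by blast
      then have kB: "k \<in> B" using D(2) [OF B(1)] by blast
      define C where "C = B - {k}"
      have finB: "finite B" using B(1) fin finite_subset by (auto simp: bases)
      have C: "C \<subseteq> E" "card C + 1 = r" "insert k C = B" "D \<inter> C = {}"
        using B kB finB card_Suc_Diff1 [OF finB kB] by (auto simp: C_def bases)
      have "k \<in> supp C"
        using B(1) kB C(3) by (auto simp: supp_def bases C_def)
      moreover have "supp C \<subseteq> D"
      proof
        fix j assume "j \<in> supp C"
        then have "D \<inter> insert j C \<noteq> {}"
          using D(2) insert_basis C by blast
        then show "j \<in> D" using C(4) by blast
      qed
      ultimately have "supp C = D"
        using D(3) [of "supp C"] supp_meets [of C] C(1,2) by blast
      then show "indicator_vector D \<in> submodule_span {cocircuit_vector E p C |C. C \<subseteq> E \<and> card C + 1 = r}"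
        using C(1,2) vector by (intro span_base) auto
    qed
  qed
qed


section \<open>Hall's marriage theorem\<close>

text \<open>
  By induction on the number of rows. If some proper nonempty subset has exactly as many
  neighbours as elements, it is matched first and its neighbours are removed; otherwise one row
  can be matched arbitrarily, and removing its partner keeps the condition.
\<close>

lemma hall_marriage:
  assumes "finite R" "\<And>x. x \<in> R \<Longrightarrow> finite (N x)"
    and "\<And>S. S \<subseteq> R \<Longrightarrow> card S \<le> card (\<Union>x\<in>S. N x)"
  obtains \<sigma> where "inj_on \<sigma> R" "\<And>x. x \<in> R \<Longrightarrow> \<sigma> x \<in> N x"
proof -
  have "\<exists>\<sigma>. inj_on \<sigma> R \<and> (\<forall>x\<in>R. \<sigma> x \<in> N x)"
    using assms
  proof (induction "card R" arbitrary: R N rule: less_induct)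
    case less
    note finR = less.prems(1) and finN = less.prems(2) and hall = less.prems(3)
    have finU: "finite (\<Union>x\<in>S. N x)" if "S \<subseteq> R" for S
      using that finR finN by (meson finite_UN_I finite_subset subsetD)
    show ?case
    proof (cases "R = {}")
      case False
      show ?thesis
      proof (cases "\<exists>S\<subset>R. S \<noteq> {} \<and> card (\<Union>x\<in>S. N x) = card S")
        case True
        then obtain S where S: "S \<subset> R" "S \<noteq> {}" "card (\<Union>x\<in>S. N x) = card S" by blast
        have finS: "finite S" using S finR finite_subset by blast
        let ?U = "\<Union>x\<in>S. N x"
        have "\<exists>\<sigma>. inj_on \<sigma> S \<and> (\<forall>x\<in>S. \<sigma> x \<in> N x)"
        proof (rule less.hyps)
          show "card S < card R" using S finR psubset_card_mono by blast
        qed (use S finS finN hall in auto)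
        then obtain \<sigma> where \<sigma>: "inj_on \<sigma> S" "\<forall>x\<in>S. \<sigma> x \<in> N x" by blast
        have "\<exists>\<tau>. inj_on \<tau> (R - S) \<and> (\<forall>x\<in>R - S. \<tau> x \<in> N x - ?U)"
        proof (rule less.hyps)
          show "card (R - S) < card R" using S finR by (intro psubset_card_mono) auto
          fix Q assume Q: "Q \<subseteq> R - S"
          have finQ: "finite Q" using Q finR finite_subset by blast
          have "card Q + card S = card (Q \<union> S)"
            using Q finS finQ by (subst card_Un_disjoint) auto
          also have "\<dots> \<le> card (\<Union>x\<in>Q \<union> S. N x)"
            using Q S by (intro hall) auto
          also have "(\<Union>x\<in>Q \<union> S. N x) = (\<Union>x\<in>Q. N x - ?U) \<union> ?U" by auto
          also have "card \<dots> \<le> card (\<Union>x\<in>Q. N x - ?U) + card ?U" by (rule card_Un_le)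
          finally show "card Q \<le> card (\<Union>x\<in>Q. N x - ?U)" using S(3) by simp
        qed (use finR finN in auto)
        then obtain \<tau> where \<tau>: "inj_on \<tau> (R - S)" "\<forall>x\<in>R - S. \<tau> x \<in> N x - ?U" by blast
        let ?\<rho> = "\<lambda>x. if x \<in> S then \<sigma> x else \<tau> x"
        have "inj_on ?\<rho> R"
        proof (rule inj_onI)
          fix x y assume xy: "x \<in> R" "y \<in> R" "?\<rho> x = ?\<rho> y"
          have sep: "\<sigma> u \<noteq> \<tau> w" if "u \<in> S" "w \<in> R" "w \<notin> S" for u w
            using \<sigma>(2) \<tau>(2) that by (metis DiffD2 DiffI UN_I)
          show "x = y"
            using xy sep [of x y] sep [of y x] inj_onD [OF \<sigma>(1), of x y] inj_onD [OF \<tau>(1), of x y]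
            by (auto split: if_splits)
        qed
        moreover have "\<forall>x\<in>R. ?\<rho> x \<in> N x" using \<sigma>(2) \<tau>(2) by auto
        ultimately show ?thesis by (intro exI [of _ ?\<rho>]) blast
      next
        case strict: False
        obtain x where x: "x \<in> R" using False by blast
        then have "card {x} \<le> card (\<Union>z\<in>{x}. N z)" by (intro hall) auto
        then obtain y where y: "y \<in> N x" by fastforce
        have "\<exists>\<tau>. inj_on \<tau> (R - {x}) \<and> (\<forall>z\<in>R - {x}. \<tau> z \<in> N z - {y})"
        proof (rule less.hyps)
          show "card (R - {x}) < card R" using x finR by (intro psubset_card_mono) auto
          fix Q assume Q: "Q \<subseteq> R - {x}"
          show "card Q \<le> card (\<Union>z\<in>Q. N z - {y})"
          proof (cases "Q = {}")
            case False
            have QR: "Q \<subset> R" using Q x by auto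
            then have "card Q \<le> card (\<Union>z\<in>Q. N z)" by (intro hall) auto
            then have "card Q < card (\<Union>z\<in>Q. N z)"
              using strict False QR by (metis le_neq_implies_less)
            moreover have "(\<Union>z\<in>Q. N z - {y}) = (\<Union>z\<in>Q. N z) - {y}" by auto
            moreover have "card (\<Union>z\<in>Q. N z) - 1 \<le> card ((\<Union>z\<in>Q. N z) - {y})"
              using finU [of Q] QR by (simp add: card_Diff_singleton_if)
            ultimately show ?thesis by simp
          qed simp
        qed (use finR finN in auto)
        then obtain \<tau> where \<tau>: "inj_on \<tau> (R - {x})" "\<forall>z\<in>R - {x}. \<tau> z \<in> N z - {y}" by blast
        let ?\<rho> = "\<tau>(x := y)"
        have "inj_on ?\<rho> R"
        proof (rule inj_onI)
          fix u w assume uw: "u \<in> R" "w \<in> R" "?\<rho> u = ?\<rho> w"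
          have sep: "\<tau> z \<noteq> y" if "z \<in> R" "z \<noteq> x" for z using \<tau>(2) that by auto
          show "u = w"
            using uw sep [of u] sep [of w] inj_onD [OF \<tau>(1), of u w]
            by (auto split: if_splits)
        qed
        moreover have "\<forall>z\<in>R. ?\<rho> z \<in> N z" using \<tau>(2) y by auto
        ultimately show ?thesis by (intro exI [of _ ?\<rho>]) blast
      qed
    qed simp
  qed
  then show thesis using that by blast
qed


section \<open>The Maclagan--Rincon matroids\<close>

text \<open>
  The columns in which the rows \<open>S\<close> of the Macaulay matrices of \<open>x\<^sub>0 + x\<^sub>1 + x\<^sub>2\<close> are nonzero.
\<close>

definition children :: "monom set \<Rightarrow> monom set"
  where "children S = (\<Union>X\<in>S. (\<lambda>i. X + single i 1) ` {0, 1, 2})"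

lemma children_iff: "Z \<in> children S \<longleftrightarrow> (\<exists>X\<in>S. \<exists>i\<in>{0, 1, 2}. Z = X + single i 1)"
  by (auto simp: children_def)

lemma children_mono: "S \<subseteq> T \<Longrightarrow> children S \<subseteq> children T"
  by (auto simp: children_def)

lemma children_Un: "children (S \<union> T) = children S \<union> children T"
  by (auto simp: children_def)

lemma children_monoms: "S \<subseteq> monoms 2 k \<Longrightarrow> children S \<subseteq> monoms 2 (Suc k)"
proof
  fix Z assume S: "S \<subseteq> monoms 2 k" and "Z \<in> children S"
  then obtain X i where "X \<in> monoms 2 k" "i \<in> {0, 1, 2}" "Z = X + single i 1"
    by (auto simp: children_iff)
  then show "Z \<in> monoms 2 (Suc k)"
    using monoms_add [of X 2 k "single i 1" 1] single_in_monoms [of i 2 1] by auto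
qed

lemma finite_children: "finite S \<Longrightarrow> finite (children S)"
  by (simp add: children_def)

lemma children_triangle: "children ((+) m ` monoms 2 j) = (+) m ` monoms 2 (Suc j)"
proof (intro equalityI subsetI)
  fix Z assume "Z \<in> children ((+) m ` monoms 2 j)"
  then obtain u i where u: "u \<in> monoms 2 j" "i \<in> {0, 1, 2}" "Z = m + u + single i 1"
    by (auto simp: children_iff)
  then have "u + single i 1 \<in> monoms 2 (Suc j)"
    using monoms_add [of u 2 j "single i 1" 1] single_in_monoms [of i 2 1] by auto
  then show "Z \<in> (+) m ` monoms 2 (Suc j)"
    using u(3) by (auto simp: add.assoc)
next
  fix Z assume "Z \<in> (+) m ` monoms 2 (Suc j)"
  then obtain w where w: "w \<in> monoms 2 (Suc j)" "Z = m + w" by blast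
  have "w \<noteq> 0" using w(1) by (auto simp: monoms_def mdeg_zero)
  then obtain i where i: "lookup w i \<noteq> 0"
    by (metis poly_mapping_eqI lookup_zero)
  then obtain u where u: "w = single i 1 + u" by (rule monom_divide)
  have "i \<in> keys w" using i by (simp add: in_keys_iff)
  then have i2: "i \<le> 2" using w(1) by (auto simp: monoms_def)
  then have "u \<in> monoms 2 j"
    using w(1) monoms_add_iff [OF single_in_monoms [OF i2, of 1], of u j] by (simp add: u)
  moreover have "i \<in> {0, 1, 2}" using i2 by auto
  ultimately show "Z \<in> children ((+) m ` monoms 2 j)"
    unfolding children_iff w(2) u by (intro bexI [of _ "m + u"] bexI [of _ i]) (auto simp: add_ac)
qed

text \<open>
  The excess of columns over rows in a triangle is the bound on the number of elements that a
  cobasis may have in this triangle.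
\<close>

lemma card_triangle_children: "card ((+) m ` monoms 2 (Suc j)) = card ((+) m ` monoms 2 j) + j + 2"
proof -
  have inj: "inj_on ((+) m) S" for S by (simp add: inj_on_def)
  have "2 + Suc j = Suc (Suc (Suc j))" "2 + j = Suc (Suc j)" by simp_all
  then have "card (monoms 2 (Suc j)) = card (monoms 2 j) + (Suc (Suc j) choose Suc j)"
    unfolding card_monoms by (simp only: binomial_Suc_Suc)
  also have "Suc (Suc j) choose Suc j = j + 2"
    by (simp only: binomial_Suc_n)
  finally show ?thesis
    by (simp add: card_image [OF inj])
qed

text \<open>
  This is the matching condition of Hall, for sets of rows that already contain every row with two
  of its three neighbours among the columns reached. Such a set is a disjoint union of triangles
  that do not touch each other: a row adjacent to a side of a maximal triangle would force the
  whole line of rows along this side into the set, hence a larger triangle. For a single triangle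
  the condition is the one that defines the cobases.
\<close>

lemma hall_condition_closed:
  assumes Y: "Y \<subseteq> monoms 2 (Suc k)"
    and MR: "\<And>j K. j \<le> Suc k \<Longrightarrow> K \<in> monom_translates j (Suc k) \<Longrightarrow> card (Y \<inter> K) \<le> j + 1"
    and "S \<subseteq> monoms 2 k"
    and "\<And>X i j. X \<in> monoms 2 k \<Longrightarrow> {i, j} \<subseteq> {0, 1, 2} \<Longrightarrow> i \<noteq> j \<Longrightarrow>
      X + single i 1 \<in> children S \<Longrightarrow> X + single j 1 \<in> children S \<Longrightarrow> X \<in> S"
  shows "card S + card (Y \<inter> children S) \<le> card (children S)"
  using assms(3,4)
proof (induction "card S" arbitrary: S rule: less_induct)
  case less
  note S = less.prems(1) and closed = less.prems(2)
  have finS: "finite S" using S finite_subset [OF _ finite_monoms] by blast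
  show ?case
  proof (cases "S = {}")
    case True
    then show ?thesis by (simp add: children_def)
  next
    case False
    define triangle where "triangle j m \<longleftrightarrow> j \<le> k \<and> m \<in> monoms 2 (k - j) \<and> (+) m ` monoms 2 j \<subseteq> S" for j m
    obtain X\<^sub>0 where "X\<^sub>0 \<in> S" using False by blast
    then have "triangle 0 X\<^sub>0"
      using S by (auto simp: triangle_def monoms_zero)
    then have ex: "\<exists>m. triangle 0 m" by blast
    have bound: "\<forall>j. (\<exists>m. triangle j m) \<longrightarrow> j \<le> k" by (auto simp: triangle_def)
    define j where "j = (GREATEST j. \<exists>m. triangle j m)"
    have "\<exists>m. triangle j m"
      unfolding j_def using GreatestI_nat [of "\<lambda>j. \<exists>m. triangle j m", OF ex] bound by blast
    then obtain m where m: "triangle j m" by blast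
    have maximal: "\<not> triangle (Suc j) m'" for m'
    proof
      assume "triangle (Suc j) m'"
      then have "Suc j \<le> j"
        unfolding j_def using Greatest_le_nat [of "\<lambda>j. \<exists>m. triangle j m" "Suc j" k] bound
        by (simp add: j_def) blast
      then show False by simp
    qed
    define T where "T = (+) m ` monoms 2 j"
    have jk: "j \<le> k" and m_deg: "m \<in> monoms 2 (k - j)" and TS: "T \<subseteq> S"
      using m by (auto simp: triangle_def T_def)
    have children_T: "children T = (+) m ` monoms 2 (Suc j)"
      unfolding T_def by (rule children_triangle)
    have disjoint: "children T \<inter> children (S - T) = {}"
    proof (rule ccontr)
      assume "\<not> ?thesis"
      then obtain Z where Z: "Z \<in> children T" "Z \<in> children (S - T)" by blast
      obtain X i where X: "X \<in> S" "X \<notin> T" and i: "i \<in> {0, 1, 2}" and ZX: "Z = X + single i 1"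
        using Z(2) by (auto simp: children_iff)
      obtain u where u: "u \<in> monoms 2 (Suc j)" and Zu: "Z = m + u"
        using Z(1) unfolding children_T by blast
      let ?x = "\<lambda>i. single i 1 :: monom"
      have xi: "?x i \<in> monoms 2 1" using i by (intro single_in_monoms) auto
      have ui: "lookup u i = 0"
      proof (rule ccontr)
        assume "lookup u i \<noteq> 0"
        then obtain u' where u': "u = ?x i + u'" by (rule monom_divide)
        then have "u' \<in> monoms 2 j" using u monoms_add_iff [OF xi, of u' j] by simp
        moreover have "X + ?x i = m + u' + ?x i"
          unfolding ZX [symmetric] Zu u' by (simp only: add_ac)
        then have "X = m + u'" by (rule add_right_imp_eq)
        ultimately show False using X(2) by (simp add: T_def)
      qed
      have "lookup X i + 1 = lookup m i + lookup u i"
        using ZX Zu by (metis lookup_add lookup_single_eq)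
      then have "lookup m i \<noteq> 0" using ui by simp
      then obtain m' where m': "m = ?x i + m'" by (rule monom_divide)
      have "X + ?x i = m' + u + ?x i"
        unfolding ZX [symmetric] Zu m' by (simp only: add_ac)
      then have X_eq: "X = m' + u" by (rule add_right_imp_eq)
      have "j \<noteq> k"
        using m_deg m' monoms_zero [of 2] by (auto simp: monoms_def mdeg_add mdeg_single)
      then have kj: "k - j = 1 + (k - Suc j)" "Suc j \<le> k" using jk by auto
      have m'_deg: "m' \<in> monoms 2 (k - Suc j)"
        using m_deg monoms_add_iff [OF xi, of m' "k - Suc j"] unfolding m' kj(1) by simp
      obtain p q where pq: "{i, p, q} = {0, 1, 2}" "i \<noteq> p" "i \<noteq> q" "p \<noteq> q"
      proof -
        consider "i = 0" | "i = 1" | "i = 2" using i by blast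
        then show thesis
        proof cases
          case 1
          then show thesis by (intro that [of 1 2]) simp_all
        next
          case 2
          then show thesis by (intro that [of 0 2]) auto
        next
          case 3
          then show thesis by (intro that [of 0 1]) auto
        qed
      qed
      \<comment> \<open>The rows \<open>m' + line a\<close> are those adjacent to the side of the triangle touched by \<open>X\<close>.\<close>
      define line where "line a = single p a + single q (Suc j - a)" for a :: nat
      have pq_range: "p \<in> {0, 1, 2}" "q \<in> {0, 1, 2}"
        using pq(1) by blast+
      then have pq2: "p \<le> 2" "q \<le> 2" by auto
      have line_deg: "line a \<in> monoms 2 (Suc j)" if "a \<le> Suc j" for a
        unfolding line_def
        using monoms_add [OF single_in_monoms [OF pq2(1), of a] single_in_monoms [OF pq2(2), of "Suc j - a"]] that
        by simp
      have line_complete: "w = line (lookup w p) \<and> lookup w p \<le> Suc j"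
        if w: "w \<in> monoms 2 (Suc j)" "lookup w i = 0" for w
      proof -
        have keys: "keys w \<subseteq> {i, p, q}"
        proof -
          have "{0..2::nat} = {0, 1, 2}" by auto
          then show ?thesis using w(1) unfolding pq(1) by (simp add: monoms_def)
        qed
        have "mdeg w = Suc j" using w(1) by (simp add: monoms_def)
        then have deg: "lookup w p + lookup w q = Suc j"
          using mdeg_eq_sum [OF _ keys] pq(2-4) w(2) by simp
        have "w = line (lookup w p)"
        proof (rule poly_mapping_eqI)
          fix l
          have "l \<in> {i, p, q} \<or> lookup w l = 0"
            using keys in_keys_iff [of l w] by blast
          then show "lookup w l = lookup (line (lookup w p)) l"
            using pq(2-4) w(2) deg by (auto simp: line_def lookup_add lookup_single when_def)
        qed
        then show ?thesis using deg by simp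
      qed
      have line_rows: "m' + line a \<in> monoms 2 k" if "a \<le> Suc j" for a
        using monoms_add [OF m'_deg line_deg [OF that]] kj(2) by simp
      have line_T: "m' + line a + ?x i \<in> children S" if "a \<le> Suc j" for a
      proof -
        have "m' + line a + ?x i = m + line a" by (simp add: m' add_ac)
        then have "m' + line a + ?x i \<in> children T"
          unfolding children_T using line_deg [OF that] by simp
        then show ?thesis using children_mono [OF TS] by blast
      qed
      have shift: "line (Suc a) + ?x q = line a + ?x p" if "a < Suc j" for a
      proof (rule poly_mapping_eqI)
        fix l
        show "lookup (line (Suc a) + ?x q) l = lookup (line a + ?x p) l"
          using that pq(4) by (auto simp: line_def lookup_add lookup_single when_def)
      qed
      \<comment> \<open>A row next to one of the set on this line has two neighbours among the columns reached:
        one shared with the triangle and one shared with the adjacent row.\<close>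
      have up: "m' + line (Suc a) \<in> S" if a: "a < Suc j" and "m' + line a \<in> S" for a
      proof (rule closed)
        show "m' + line (Suc a) \<in> monoms 2 k" using a by (intro line_rows) simp
        show "{i, q} \<subseteq> {0, 1, 2}" using i pq_range by blast
        show "i \<noteq> q" by (rule pq(3))
        show "m' + line (Suc a) + ?x i \<in> children S" using a by (intro line_T) simp
        have "m' + line (Suc a) + ?x q = m' + line a + ?x p"
          using shift [OF a] by (simp add: add.assoc)
        then show "m' + line (Suc a) + ?x q \<in> children S"
          unfolding children_iff using that(2) pq_range(1) by metis
      qed
      have down: "m' + line a \<in> S" if a: "a < Suc j" and "m' + line (Suc a) \<in> S" for a
      proof (rule closed)
        show "m' + line a \<in> monoms 2 k" using a by (intro line_rows) simp
        show "{i, p} \<subseteq> {0, 1, 2}" using i pq_range by blast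
        show "i \<noteq> p" by (rule pq(2))
        show "m' + line a + ?x i \<in> children S" using a by (intro line_T) simp
        have "m' + line a + ?x p = m' + line (Suc a) + ?x q"
          using shift [OF a] by (simp add: add.assoc)
        then show "m' + line a + ?x p \<in> children S"
          unfolding children_iff using that(2) pq_range(2) by metis
      qed
      define a\<^sub>0 where "a\<^sub>0 = lookup u p"
      have start: "m' + line a\<^sub>0 \<in> S" "a\<^sub>0 \<le> Suc j"
        using line_complete [OF u ui] X(1) X_eq by (auto simp: a\<^sub>0_def)
      have line_S: "m' + line a \<in> S" if "a \<le> Suc j" for a
      proof (cases "a\<^sub>0 \<le> a")
        case True
        then show ?thesis using that
        proof (induction a rule: dec_induct)
          case (step b)
          then show ?case using up [of b] by simp
        qed (rule start)
      next
        case False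
        then have "a \<le> a\<^sub>0" by simp
        then show ?thesis
        proof (induction a rule: inc_induct)
          case (step b)
          then show ?case using down [of b] start(2) by simp
        qed (rule start)
      qed
      have "(+) m' ` monoms 2 (Suc j) \<subseteq> S"
      proof (rule image_subsetI)
        fix w assume w: "w \<in> monoms 2 (Suc j)"
        show "m' + w \<in> S"
        proof (cases "lookup w i = 0")
          case True
          then show ?thesis using line_complete [OF w] line_S by metis
        next
          case False
          then obtain w' where w': "w = ?x i + w'" by (rule monom_divide)
          then have "w' \<in> monoms 2 j" using w monoms_add_iff [OF xi, of w' j] by simp
          moreover have "m' + w = m + w'" by (simp add: m' w' add_ac)
          ultimately show ?thesis using TS by (auto simp: T_def)
        qed
      qed
      then show False
        using maximal [of m'] m'_deg kj(2) by (simp add: triangle_def)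
    qed
    have finT: "finite T" using TS finS finite_subset by blast
    have "T \<noteq> {}" using card_monoms [of 2 j] by (auto simp: T_def)
    then have "S - T \<subset> S" using TS by blast
    then have smaller: "card (S - T) < card S" using finS psubset_card_mono by blast
    have rest: "card (S - T) + card (Y \<inter> children (S - T)) \<le> card (children (S - T))"
    proof (rule less.hyps [OF smaller])
      show "S - T \<subseteq> monoms 2 k" using S by blast
      fix X and i l :: nat
      assume X: "X \<in> monoms 2 k" "{i, l} \<subseteq> {0, 1, 2}" "i \<noteq> l"
        and ch: "X + single i 1 \<in> children (S - T)" "X + single l 1 \<in> children (S - T)"
      have "children (S - T) \<subseteq> children S" by (rule children_mono) blast
      then have "X \<in> S" using ch by (intro closed [OF X]) blast+
      moreover have "X \<notin> T"
      proof
        assume "X \<in> T"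
        then have "X + single i 1 \<in> children T"
          using X(2) by (auto simp: children_iff)
        then show False using ch(1) disjoint by blast
      qed
      ultimately show "X \<in> S - T" by blast
    qed
    have "children T \<in> monom_translates (Suc j) (Suc k)"
      using m_deg unfolding children_T monom_translates_def by auto
    then have "card (Y \<inter> children T) \<le> j + 2"
      using MR [of "Suc j" "children T"] jk by simp
    then have tri: "card T + card (Y \<inter> children T) \<le> card (children T)"
      using card_triangle_children [of m j] unfolding children_T unfolding T_def by simp
    have "S = T \<union> (S - T)" using TS by blast
    then have split: "children S = children T \<union> children (S - T)"
      using children_Un [of T "S - T"] by simp
    have fin: "finite (children T)" "finite (children (S - T))"
      using finT finS by (simp_all add: finite_children)
    have "card (children S) = card (children T) + card (children (S - T))"
      unfolding split using fin disjoint by (rule card_Un_disjoint)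
    moreover have "card (Y \<inter> children S) = card (Y \<inter> children T) + card (Y \<inter> children (S - T))"
      unfolding split Int_Un_distrib using fin disjoint by (intro card_Un_disjoint) auto
    moreover have "card S = card T + card (S - T)"
      using TS finS finT by (metis card_Diff_subset card_mono le_add_diff_inverse)
    ultimately show ?thesis using tri rest by simp
  qed
qed

text \<open>
  Adding to a violating set a row with at most one new neighbour leaves it violating. So a
  largest violating set would be closed in the sense of the previous lemma.
\<close>

lemma hall_condition:
  assumes Y: "Y \<subseteq> monoms 2 (Suc k)"
    and MR: "\<And>j K. j \<le> Suc k \<Longrightarrow> K \<in> monom_translates j (Suc k) \<Longrightarrow> card (Y \<inter> K) \<le> j + 1"
    and S: "S \<subseteq> monoms 2 k"
  shows "card S + card (Y \<inter> children S) \<le> card (children S)"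
proof (rule ccontr)
  assume bad: "\<not> ?thesis"
  let ?bad = "{S. S \<subseteq> monoms 2 k \<and> card (children S) < card S + card (Y \<inter> children S)}"
  have "finite ?bad"
    by (rule finite_subset [of _ "Pow (monoms 2 k)"]) (auto simp: finite_monoms)
  moreover have "?bad \<noteq> {}" using bad S by auto
  ultimately obtain M where M: "M \<in> ?bad" and max: "\<And>S. S \<in> ?bad \<Longrightarrow> card S \<le> card M"
    using finite_maximizer [of ?bad card] by blast
  have finM: "finite M" using M finite_subset [OF _ finite_monoms] by blast
  have "card M + card (Y \<inter> children M) \<le> card (children M)"
  proof (rule hall_condition_closed [OF Y MR])
    show "M \<subseteq> monoms 2 k" using M by simp
    fix X and i j :: nat
    assume X: "X \<in> monoms 2 k" and ij: "{i, j} \<subseteq> {0, 1, 2}" "i \<noteq> j"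
      and ch: "X + single i 1 \<in> children M" "X + single j 1 \<in> children M"
    show "X \<in> M"
    proof (rule ccontr)
      assume new: "X \<notin> M"
      obtain l where l: "{0, 1, 2} = {i, j, l}"
        using ij by (auto simp: doubleton_eq_iff)
      have "children (insert X M) \<subseteq> insert (X + single l 1) (children M)"
      proof
        fix Z assume "Z \<in> children (insert X M)"
        then obtain X' h where Z: "X' \<in> insert X M" "h \<in> {0, 1, 2}" "Z = X' + single h 1"
          unfolding children_iff by blast
        show "Z \<in> insert (X + single l 1) (children M)"
        proof (cases "X' \<in> M")
          case True
          then have "Z \<in> children M" using Z(2,3) unfolding children_iff by blast
          then show ?thesis by (rule insertI2)
        next
          case False
          then have "X' = X" using Z(1) by blast
          moreover have "h = i \<or> h = j \<or> h = l" using Z(2) unfolding l by blast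
          ultimately show ?thesis using Z(3) ch by auto
        qed
      qed
      then have "card (children (insert X M)) \<le> card (insert (X + single l 1) (children M))"
        using finM finite_children by (intro card_mono) auto
      also have "\<dots> \<le> card (children M) + 1"
        by (simp add: card_insert_le_m1 card_insert_if finM finite_children)
      also have "\<dots> < card (insert X M) + card (Y \<inter> children M)"
        using M new finM by simp
      also have "card (Y \<inter> children M) \<le> card (Y \<inter> children (insert X M))"
        using finM finite_children children_mono [of M "insert X M"] by (intro card_mono) auto
      finally have "insert X M \<in> ?bad" using M X by simp
      then have "card (insert X M) \<le> card M" by (rule max)
      then show False using new finM by simp
    qed
  qed (use MR in auto)
  then show False using M by simp
qed

text \<open>
  A matching avoids the cobasis and maps the rows of a triangle into its columns, so the number
  of elements of the cobasis in the triangle is at most the excess of columns over rows.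
  Conversely, the bounds for triangles imply Hall's condition for all sets of rows.
\<close>

lemma MR_cobases_iff_matching:
  assumes B: "B \<subseteq> monoms 2 (Suc k)"
  shows "monoms 2 (Suc k) - B \<in> MR_cobases (Suc k) \<longleftrightarrow>
    (\<exists>\<sigma>. bij_betw \<sigma> (monoms 2 k) B \<and> (\<forall>X\<in>monoms 2 k. \<sigma> X \<in> children {X}))"
proof
  let ?E = "monoms 2 (Suc k)" and ?R = "monoms 2 k"
  have finB: "finite B" using B finite_subset [OF _ finite_monoms] by blast
  have card_E: "card ?E = card ?R + k + 2"
    using card_triangle_children [of 0 k] by (simp add: card_image inj_on_def)
  {
    assume MR: "?E - B \<in> MR_cobases (Suc k)"
    let ?Y = "?E - B"
    have Y_MR: "card (?Y \<inter> K) \<le> j + 1"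
      if "j \<le> Suc k" "K \<in> monom_translates j (Suc k)" for j K
      using MR that by (auto simp: MR_cobases_def)
    have card_B: "card B = card ?R"
    proof -
      have "card ?Y = k + 2" using MR by (simp add: MR_cobases_def)
      then show ?thesis using card_E card_Diff_subset [OF finB B] card_mono [OF finite_monoms B] by simp
    qed
    obtain \<sigma> where \<sigma>: "inj_on \<sigma> ?R" "\<And>X. X \<in> ?R \<Longrightarrow> \<sigma> X \<in> children {X} - ?Y"
    proof (rule hall_marriage [OF finite_monoms, of 2 k "\<lambda>X. children {X} - ?Y"])
      show "finite (children {X} - ?Y)" for X by (simp add: finite_children)
      fix S assume S: "S \<subseteq> ?R"
      have finS: "finite S" using S finite_subset [OF _ finite_monoms] by blast
      have "(\<Union>X\<in>S. children {X} - ?Y) = children S - ?Y" by (auto simp: children_def)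
      moreover have "card (children S - ?Y) = card (children S) - card (?Y \<inter> children S)"
        using finite_children [OF finS] by (simp add: card_Diff_subset_Int Int_commute)
      moreover have "card S + card (?Y \<inter> children S) \<le> card (children S)"
        by (rule hall_condition [OF _ Y_MR S]) auto
      ultimately show "card S \<le> card (\<Union>X\<in>S. children {X} - ?Y)" by simp
    qed blast
    have "\<sigma> ` ?R \<subseteq> B"
    proof (rule image_subsetI)
      fix X assume X: "X \<in> ?R"
      have "children {X} \<subseteq> ?E" by (rule children_monoms) (use X in simp)
      then show "\<sigma> X \<in> B" using \<sigma>(2) [OF X] by blast
    qed
    then have "\<sigma> ` ?R = B"
      using card_image [OF \<sigma>(1)] card_B finB by (metis card_subset_eq)
    then show "\<exists>\<sigma>. bij_betw \<sigma> ?R B \<and> (\<forall>X\<in>?R. \<sigma> X \<in> children {X})"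
      using \<sigma> by (auto simp: bij_betw_def)
  }
  assume "\<exists>\<sigma>. bij_betw \<sigma> ?R B \<and> (\<forall>X\<in>?R. \<sigma> X \<in> children {X})"
  then obtain \<sigma> where \<sigma>: "bij_betw \<sigma> ?R B" "\<And>X. X \<in> ?R \<Longrightarrow> \<sigma> X \<in> children {X}" by blast
  have "card B = card ?R" using \<sigma>(1) by (simp add: bij_betw_same_card)
  then have "card (?E - B) = k + 2"
    using card_E card_Diff_subset [OF finB B] by simp
  moreover have "card ((?E - B) \<inter> K) \<le> j + 1"
    if j: "j \<in> {0..Suc k}" and K: "K \<in> monom_translates j (Suc k)" for j K
  proof -
    obtain m where m: "m \<in> monoms 2 (Suc k - j)" "K = (+) m ` monoms 2 j"
      using K by (auto simp: monom_translates_def)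
    have finK: "finite K" using m(2) finite_monoms by simp
    show ?thesis
    proof (cases j)
      case 0
      then have "card K = 1" using m(2) by (simp add: monoms_zero)
      moreover have "card ((?E - B) \<inter> K) \<le> card K" using finK by (intro card_mono) auto
      ultimately show ?thesis by simp
    next
      case (Suc i)
      let ?T = "(+) m ` monoms 2 i"
      have T: "?T \<subseteq> ?R"
        using m(1) j Suc monoms_add [of m 2 "k - i"] by force
      have "\<sigma> ` ?T \<subseteq> K"
      proof (rule image_subsetI)
        fix X assume X: "X \<in> ?T"
        then have "\<sigma> X \<in> children ?T"
          using \<sigma>(2) [of X] T children_mono [of "{X}" ?T] by blast
        then show "\<sigma> X \<in> K" unfolding children_triangle m(2) Suc .
      qed
      moreover have "\<sigma> ` ?T \<subseteq> B"
        using \<sigma>(1) T by (auto simp: bij_betw_def)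
      ultimately have "(?E - B) \<inter> K \<subseteq> K - \<sigma> ` ?T" by blast
      then have "card ((?E - B) \<inter> K) \<le> card (K - \<sigma> ` ?T)"
        using finK by (intro card_mono) auto
      also have "\<dots> = card K - card (\<sigma> ` ?T)"
        using \<open>\<sigma> ` ?T \<subseteq> K\<close> finK finite_subset by (intro card_Diff_subset) blast+
      also have "card (\<sigma> ` ?T) = card ?T"
        using \<sigma>(1) T by (intro card_image) (auto simp: bij_betw_def inj_on_subset)
      also have "card K = card ?T + i + 2"
        unfolding m(2) Suc by (rule card_triangle_children)
      finally show ?thesis using Suc by simp
    qed
  qed
  ultimately show "?E - B \<in> MR_cobases (Suc k)"
    by (auto simp: MR_cobases_def)
qed

lemma span_empty: "submodule_span {} = ({0} :: ('e \<Rightarrow>\<^sub>0 's::comm_semiring_1) set)"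
proof -
  have "is_submodule ({0} :: ('e \<Rightarrow>\<^sub>0 's) set)"
    by (auto simp: is_submodule_iff poly_mapping_eq_iff fun_eq_iff lookup_scale)
  then show ?thesis
    using span_minimal [of "{}" "{0} :: ('e \<Rightarrow>\<^sub>0 's) set"] span_zero by blast
qed

lemma macaulay_ideal_line_eq_MR_ideal:
  "macaulay_ideal 2 (Var 0 + Var 1 + Var 2 :: boolean mpoly) = MR_ideal"
proof -
  define f :: "boolean mpoly" where "f = Var 0 + Var 1 + Var 2"
  let ?x = "\<lambda>i. single i 1 :: monom"
  have keys: "keys f = ?x ` {0, 1, 2}"
    by (auto simp: f_def Var_def in_keys_iff lookup_add lookup_single when_def split: if_splits)
  have "mdeg ` keys f = {1}"
    unfolding keys by (simp add: image_image mdeg_single)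
  then have deg: "pdeg f = 1" by (simp add: pdeg_def)
  have f_nz: "f \<noteq> 0"
  proof
    assume "f = 0"
    then show False using keys by simp
  qed
  interpret homogeneous_form 2 f
  proof
    show "f \<in> hom_polys 2 (pdeg f)"
      using single_in_monoms [of 0 2 1] single_in_monoms [of 1 2 1] single_in_monoms [of 2 2 1]
      by (simp add: deg hom_polys_def keys)
  qed (rule f_nz)
  have "macaulay_part 2 f d = submodule_span (indicator_vector ` cocircuits (monoms 2 d) (MR_bases d))" for d
  proof (cases d)
    case 0
    have "{0} \<in> MR_cobases 0"
    proof -
      have "card ({0} \<inter> K) \<le> 1" for K :: "monom set"
        by (rule order_trans [OF card_mono [of "{0}"]]) auto
      then show ?thesis by (auto simp: MR_cobases_def monoms_zero)
    qed
    then have empty: "{} \<in> MR_bases 0"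
      unfolding MR_bases_def by (rule rev_image_eqI) (simp add: monoms_zero)
    have "MR_bases 0 \<subseteq> Pow (monoms 2 0)" by (auto simp: MR_bases_def)
    from cocircuits_iff [OF this] empty have "cocircuits (monoms 2 0) (MR_bases 0) = {}" by blast
    then show ?thesis by (simp add: 0 macaulay_part_def deg span_empty)
  next
    case (Suc k)
    let ?E = "monoms 2 (Suc k)"
    have le: "pdeg f \<le> Suc k" by (simp add: deg)
    have child: "macaulay_matrix f X Z \<noteq> 0 \<longleftrightarrow> Z \<in> children {X}" for X Z
    proof
      assume "macaulay_matrix f X Z \<noteq> 0"
      then obtain m where "Z = X + m" "m \<in> keys f"
        by (rule macaulay_matrix_nonzero)
      then show "Z \<in> children {X}" by (auto simp: children_iff keys)
    next
      assume "Z \<in> children {X}"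
      then obtain i where i: "i \<in> {0, 1, 2}" "Z = X + ?x i" by (auto simp: children_iff)
      then have "?x i \<in> keys f" unfolding keys by blast
      then show "macaulay_matrix f X Z \<noteq> 0"
        by (simp add: i(2) macaulay_matrix_translate in_keys_iff)
    qed
    have minor: "minor (Suc k) B \<noteq> 0 \<longleftrightarrow> ?E - B \<in> MR_cobases (Suc k)" if "B \<subseteq> ?E" for B
      unfolding MR_cobases_iff_matching [OF that] trop_minor_nonzero_iff [OF finite_monoms]
      by (simp add: child deg)
    have "B \<in> MR_bases (Suc k) \<longleftrightarrow> B \<subseteq> ?E \<and> ?E - B \<in> MR_cobases (Suc k)" for B
    proof
      assume "B \<in> MR_bases (Suc k)"
      then obtain Y where Y: "Y \<in> MR_cobases (Suc k)" "B = ?E - Y" by (auto simp: MR_bases_def)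
      then have "?E - B = Y" by (auto simp: MR_cobases_def)
      with Y show "B \<subseteq> ?E \<and> ?E - B \<in> MR_cobases (Suc k)" by auto
    next
      assume "B \<subseteq> ?E \<and> ?E - B \<in> MR_cobases (Suc k)"
      then show "B \<in> MR_bases (Suc k)"
        unfolding MR_bases_def by (intro image_eqI [of _ _ "?E - B"]) auto
    qed
    moreover have "card B = card (rows (Suc k))" if nz: "minor (Suc k) B \<noteq> 0" for B
    proof -
      obtain \<sigma> where "bij_betw \<sigma> (rows (Suc k)) B"
        using nz by (rule trop_minor_attained)
      then show ?thesis by (simp add: bij_betw_same_card)
    qed
    ultimately have bases: "MR_bases (Suc k) = {B. B \<subseteq> ?E \<and> card B = card (rows (Suc k)) \<and> minor (Suc k) B \<noteq> 0}"
      using minor by blast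
    show ?thesis
      unfolding Suc macaulay_part_eq [OF le]
      by (rule lin_space_eq_span_cocircuits [OF minor_valuated_matroid [OF le] bases])
  qed
  then have "macaulay_part 2 f =
      (\<lambda>d. submodule_span (indicator_vector ` cocircuits (monoms 2 d) (MR_bases d)))"
    by (rule ext)
  then show ?thesis
    unfolding f_def [symmetric] macaulay_ideal_def MR_ideal_def by (rule arg_cong)
qed


section \<open>The Macaulay tropical ideal of a homogeneous polynomial\<close>

theorem theorem1:
  fixes n :: nat and f :: "trop mpoly"
  assumes "f \<in> polys n" and "f \<noteq> 0" and "homogeneous f"
  shows "tropical_ideal n (macaulay_ideal n f)
    \<and> tropically_principal_over n (macaulay_ideal n f) f
    \<and> trop_variety n (macaulay_ideal n f) = trop_hypersurface n f
    \<and> (\<forall>d. hilbert_fun n (macaulay_ideal n f) d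
          = num_monoms n (int d) - num_monoms n (int d - int (pdeg f)))
    \<and> (card (Poly_Mapping.keys f) \<ge> 3
        \<and> (\<forall>m\<in>Poly_Mapping.keys f. \<exists>i\<in>Poly_Mapping.keys m.
              \<forall>m'\<in>Poly_Mapping.keys f - {m}. i \<notin> Poly_Mapping.keys m')
        \<longrightarrow> \<not> realizable_over TYPE('k::field) n (macaulay_ideal n f))
    \<and> macaulay_ideal 2 (Var 0 + Var 1 + Var 2 :: boolean mpoly) = MR_ideal"
proof -
  interpret homogeneous_form n f
    using assms homogeneous_imp_hom_polys by unfold_locales
  have "\<not> realizable_over TYPE('k) n (macaulay_ideal n f)"
    if "card (keys f) \<ge> 3"
      "\<forall>m\<in>keys f. \<exists>i\<in>keys m.
        \<forall>m'\<in>keys f - {m}. i \<notin> keys m'"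
    using macaulay_ideal_not_realizable [OF homogeneous_form_axioms that(1)] that(2) by blast
  then show ?thesis
    using tropical_ideal_macaulay_ideal tropically_principal_macaulay_ideal
      trop_variety_macaulay_ideal hilbert_fun_macaulay_ideal macaulay_ideal_line_eq_MR_ideal
    by blast
qed

end
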